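(* Let $\mathcal G$ be a braided stability groupoid with stability category $U\mathcal G$, let $R$ be a commutative ring, let $N\in\mathbb N$ and $k,a\in\mathbb N$, and assume condition H3($N$): $\widetilde H_i(R\mathrm{Hom}_{U\mathcal G}(0,-))_n=0$ for all $-1\le i<N$ and all $n>k\cdot i+a$. Let $V$ be a $U\mathcal G$-module and let $d_0,\dots,d_N\in\mathbb Z$ with $d_{i+1}-d_i\ge\max(k,a)$ for all $i$. Then the following are equivalent: (a) there is an exact sequence of $U\mathcal G$-modules $P_N\to P_{N-1}\to\dots\to P_0\to V\to 0$ in which each $P_i$ is freely generated in ranks $\le d_i$; (b) $\widetilde H_i(V)_n=0$ for all $-1\le i<N$ and all $n>d_{i+1}$.
   Context: A stability groupoid is a monoidal groupoid $(\mathcal G,\oplus,0)$ whose monoid of objects is $(\mathbb N,+,0)$; write $G_n=\mathrm{Aut}_{\mathcal G}(n)$. It is required that (i) $\oplus\colon G_m\times G_n\to G_{m+n}$ is injective; (ii) $G_0$ is trivial; (iii) $(G_{l+m}\times 1)\cap(1\times G_{m+n})=1\times G_m\times 1$ inside $G_{l+m+n}$ for all $l,m,n$. A braiding is a braiding of this monoidal groupoid, i.e. elements $b_{m,n}\in G_{m+n}$ with $(g\oplus f)b_{m,n}=b_{m,n}(f\oplus g)$ for $f\in G_m$, $g\in G_n$, and $b_{l,m+n}=(\mathrm{id}_m\oplus b_{l,n})(b_{l,m}\oplus\mathrm{id}_n)$, $b_{l+m,n}=(b_{l,n}\oplus\mathrm{id}_m)(\mathrm{id}_l\oplus b_{m,n})$.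 The stability category $U\mathcal G$ has objects $\mathbb N$, $\mathrm{Hom}(m,n)=\emptyset$ if $m>n$ and $\mathrm{Hom}(m,n)=G_n/G_{n-m}$ (cosets $fG_{n-m}$, with $G_{n-m}\subset G_n$ via $g\mapsto g\oplus\mathrm{id}_m$) if $m\le n$; composition is $fG_l\circ gG_m=f(\mathrm{id}_l\oplus g)G_{l+m}$ for $gG_m\colon n\to m+n$ and $fG_l\colon m+n\to l+m+n$. It is monoidal via $f_1G_{m_1}\oplus f_2G_{m_2}=(f_1\oplus f_2)(\mathrm{id}_{m_1}\oplus b^{-1}_{n_1,m_2}\oplus\mathrm{id}_{n_2})G_{m_1+m_2}$ for $f_jG_{m_j}\colon n_j\to m_j+n_j$; $0$ is initial and $\iota_n\colon 0\to n$ denotes the unique morphism. A $U\mathcal G$-module is a functor $V\colon U\mathcal G\to R\text{-Mod}$; write $V_n=V(n)$, a $G_n$-representation. $R\mathrm{Hom}(m,-)$ denotes the linearized representable functor; $R\mathrm{Hom}(0,-)$ is the constant functor $R$. A $U\mathcal G$-module $P$ is freely generated in ranks $\le m$ if $P\cong\bigoplus_{j\in J}R\mathrm{Hom}(m_j,-)$ with all $m_j\le m$. Central stability complex: $\widetilde C_p(V)_n=RG_n\otimes_{RG_{n-p-1}}V_{n-p-1}$ for $p\ge-1$, $n\ge p+1$ (and $0$ if $n<p+1$), where $G_{n-p-1}\subset G_n$ via $g\mapsto g\oplus\mathrm{id}_{p+1}$; so $\widetilde C_{-1}(V)_n=V_n$. The differential is $\sum_{i=0}^p(-1)^id_i$ with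 $d_i(g\otimes v)=g(\mathrm{id}_{n-p-1}\oplus b_{1,i}\oplus\mathrm{id}_{p-i})\otimes V(\mathrm{id}_{n-p-1}\oplus\iota_1)(v)$ (for $p=0$: $g\otimes v\mapsto g\cdot V(\mathrm{id}_{n-1}\oplus\iota_1)(v)\in V_n$). Its homology in degree $i\ge -1$ is the central stability homology $\widetilde H_i(V)_n$. *)

theory Defs
  imports "HOL-Algebra.Algebra"
begin

text \<open>A (strict) monoidal groupoid with object monoid (nat,+,0) is encoded by the family of
  automorphism groups G n = Aut(n) (all carried by one element type 'g) together with the
  monoidal product on morphisms  os m n f g = f \<oplus> g  (G m \<times> G n \<rightarrow> G (m+n)).\<close>

definition stability_groupoid ::
  "(nat \<Rightarrow> 'g monoid) \<Rightarrow> (nat \<Rightarrow> nat \<Rightarrow> 'g \<Rightarrow> 'g \<Rightarrow> 'g) \<Rightarrow> bool" where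
  "stability_groupoid G os \<longleftrightarrow>
     (\<forall>n. group (G n)) \<and>
     \<comment> \<open>the monoidal product is a functor G m \<times> G n \<rightarrow> G (m+n)\<close>
     (\<forall>m n f g. f \<in> carrier (G m) \<and> g \<in> carrier (G n) \<longrightarrow> os m n f g \<in> carrier (G (m+n))) \<and>
     (\<forall>m n f f' g g'. f \<in> carrier (G m) \<and> f' \<in> carrier (G m) \<and> g \<in> carrier (G n) \<and> g' \<in> carrier (G n)
        \<longrightarrow> os m n (monoid.mult (G m) f f') (monoid.mult (G n) g g') = monoid.mult (G (m+n)) (os m n f g) (os m n f' g')) \<and>
     (\<forall>m n. os m n (monoid.one (G m)) (monoid.one (G n)) = monoid.one (G (m+n))) \<and>
     \<comment> \<open>strict associativity and unit\<close>
     (\<forall>l m n f g h. f \<in> carrier (G l) \<and> g \<in> carrier (G m) \<and> h \<in> carrier (G n)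
        \<longrightarrow> os (l+m) n (os l m f g) h = os l (m+n) f (os m n g h)) \<and>
     (\<forall>n g. g \<in> carrier (G n) \<longrightarrow> os 0 n (monoid.one (G 0)) g = g \<and> os n 0 g (monoid.one (G 0)) = g) \<and>
     \<comment> \<open>(i) injectivity\<close>
     (\<forall>m n f f' g g'. f \<in> carrier (G m) \<and> f' \<in> carrier (G m) \<and> g \<in> carrier (G n) \<and> g' \<in> carrier (G n)
        \<and> os m n f g = os m n f' g' \<longrightarrow> f = f' \<and> g = g') \<and>
     \<comment> \<open>(ii) G 0 trivial\<close>
     carrier (G 0) = {monoid.one (G 0)} \<and>
     \<comment> \<open>(iii) intersection condition\<close>
     (\<forall>l m n. (\<lambda>x. os (l+m) n x (monoid.one (G n))) ` carrier (G (l+m))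
              \<inter> (\<lambda>y. os l (m+n) (monoid.one (G l)) y) ` carrier (G (m+n))
            = (\<lambda>z. os l (m+n) (monoid.one (G l)) (os m n z (monoid.one (G n)))) ` carrier (G m))"

definition braiding ::
  "(nat \<Rightarrow> 'g monoid) \<Rightarrow> (nat \<Rightarrow> nat \<Rightarrow> 'g \<Rightarrow> 'g \<Rightarrow> 'g) \<Rightarrow> (nat \<Rightarrow> nat \<Rightarrow> 'g) \<Rightarrow> bool" where
  "braiding G os b \<longleftrightarrow>
     (\<forall>m n. b m n \<in> carrier (G (m+n))) \<and>
     (\<forall>m n f g. f \<in> carrier (G m) \<and> g \<in> carrier (G n) \<longrightarrow>
        monoid.mult (G (m+n)) (os n m g f) (b m n) = monoid.mult (G (m+n)) (b m n) (os m n f g)) \<and>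
     (\<forall>l m n. b l (m+n) =
        monoid.mult (G (l+m+n)) (os m (l+n) (monoid.one (G m)) (b l n)) (os (l+m) n (b l m) (monoid.one (G n)))) \<and>
     (\<forall>l m n. b (l+m) n =
        monoid.mult (G (l+m+n)) (os (l+n) m (b l n) (monoid.one (G m))) (os l (m+n) (monoid.one (G l)) (b m n)))"

definition stabsub :: "(nat \<Rightarrow> 'g monoid) \<Rightarrow> (nat \<Rightarrow> nat \<Rightarrow> 'g \<Rightarrow> 'g \<Rightarrow> 'g) \<Rightarrow> nat \<Rightarrow> nat \<Rightarrow> 'g set" where
  "stabsub G os m n = (\<lambda>g. os m n g (monoid.one (G n))) ` carrier (G m)"

definition UHom :: "(nat \<Rightarrow> 'g monoid) \<Rightarrow> (nat \<Rightarrow> nat \<Rightarrow> 'g \<Rightarrow> 'g \<Rightarrow> 'g) \<Rightarrow> nat \<Rightarrow> nat \<Rightarrow> 'g set set" where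
  "UHom G os s t = (if s \<le> t then (\<lambda>f. l_coset (G t) f (stabsub G os (t - s) s)) ` carrier (G t) else {})"

definition crep :: "'a set \<Rightarrow> 'a" where
  "crep A = (SOME x. x \<in> A)"

definition ucomp :: "(nat \<Rightarrow> 'g monoid) \<Rightarrow> (nat \<Rightarrow> nat \<Rightarrow> 'g \<Rightarrow> 'g \<Rightarrow> 'g) \<Rightarrow> nat \<Rightarrow> nat \<Rightarrow> nat \<Rightarrow> 'g set \<Rightarrow> 'g set \<Rightarrow> 'g set" where
  "ucomp G os s t u \<Psi> \<Phi> =
     l_coset (G u) (monoid.mult (G u) (crep \<Psi>) (os (u - t) t (monoid.one (G (u - t))) (crep \<Phi>))) (stabsub G os (u - s) s)"

definition uid :: "(nat \<Rightarrow> 'g monoid) \<Rightarrow> (nat \<Rightarrow> nat \<Rightarrow> 'g \<Rightarrow> 'g \<Rightarrow> 'g) \<Rightarrow> nat \<Rightarrow> 'g set" where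
  "uid G os n = l_coset (G n) (monoid.one (G n)) (stabsub G os 0 n)"

definition iota :: "(nat \<Rightarrow> 'g monoid) \<Rightarrow> (nat \<Rightarrow> nat \<Rightarrow> 'g \<Rightarrow> 'g \<Rightarrow> 'g) \<Rightarrow> nat \<Rightarrow> 'g set" where
  "iota G os n = l_coset (G n) (monoid.one (G n)) (stabsub G os n 0)"

text \<open>Monoidal product of F1 = f1 G_m1 : n1 \<rightarrow> m1+n1 and F2 = f2 G_m2 : n2 \<rightarrow> m2+n2.\<close>
definition uoplus :: "(nat \<Rightarrow> 'g monoid) \<Rightarrow> (nat \<Rightarrow> nat \<Rightarrow> 'g \<Rightarrow> 'g \<Rightarrow> 'g) \<Rightarrow> (nat \<Rightarrow> nat \<Rightarrow> 'g) \<Rightarrow>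
    nat \<Rightarrow> nat \<Rightarrow> 'g set \<Rightarrow> nat \<Rightarrow> nat \<Rightarrow> 'g set \<Rightarrow> 'g set" where
  "uoplus G os b n1 m1 F1 n2 m2 F2 =
     l_coset (G (m1 + n1 + m2 + n2))
       (monoid.mult (G (m1 + n1 + m2 + n2)) (os (m1 + n1) (m2 + n2) (crep F1) (crep F2))
          (os m1 (n1 + m2 + n2) (monoid.one (G m1))
             (os (n1 + m2) n2 (m_inv (G (n1 + m2)) (b n1 m2)) (monoid.one (G n2)))))
       (stabsub G os (m1 + m2) (n1 + n2))"

definition ginc :: "(nat \<Rightarrow> 'g monoid) \<Rightarrow> (nat \<Rightarrow> nat \<Rightarrow> 'g \<Rightarrow> 'g \<Rightarrow> 'g) \<Rightarrow> (nat \<Rightarrow> nat \<Rightarrow> 'g) \<Rightarrow> nat \<Rightarrow> 'g set" where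
  "ginc G os b a = uoplus G os b a 0 (uid G os a) 0 1 (iota G os 1)"

definition linear_map :: "'r ring \<Rightarrow> ('r,'x) module \<Rightarrow> ('r,'y) module \<Rightarrow> ('x \<Rightarrow> 'y) \<Rightarrow> bool" where
  "linear_map R M M' f \<longleftrightarrow>
     (\<forall>x\<in>carrier M. f x \<in> carrier M') \<and>
     (\<forall>x\<in>carrier M. \<forall>y\<in>carrier M. f (ring.add M x y) = ring.add M' (f x) (f y)) \<and>
     (\<forall>r\<in>carrier R. \<forall>x\<in>carrier M. f (module.smult M r x) = module.smult M' r (f x))"

definition ug_module :: "(nat \<Rightarrow> 'g monoid) \<Rightarrow> (nat \<Rightarrow> nat \<Rightarrow> 'g \<Rightarrow> 'g \<Rightarrow> 'g) \<Rightarrow> 'r ring \<Rightarrow>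
    (nat \<Rightarrow> ('r,'x) module) \<Rightarrow> (nat \<Rightarrow> nat \<Rightarrow> 'g set \<Rightarrow> 'x \<Rightarrow> 'x) \<Rightarrow> bool" where
  "ug_module G os R M act \<longleftrightarrow>
     (\<forall>n. module R (M n)) \<and>
     (\<forall>s t \<phi>. \<phi> \<in> UHom G os s t \<longrightarrow> linear_map R (M s) (M t) (act s t \<phi>)) \<and>
     (\<forall>n x. x \<in> carrier (M n) \<longrightarrow> act n n (uid G os n) x = x) \<and>
     (\<forall>s t u \<phi> \<psi> x. \<phi> \<in> UHom G os s t \<and> \<psi> \<in> UHom G os t u \<and> x \<in> carrier (M s) \<longrightarrow>
        act s u (ucomp G os s t u \<psi> \<phi>) x = act t u \<psi> (act s t \<phi> x))"

definition ug_hom :: "(nat \<Rightarrow> 'g monoid) \<Rightarrow> (nat \<Rightarrow> nat \<Rightarrow> 'g \<Rightarrow> 'g \<Rightarrow> 'g) \<Rightarrow> 'r ring \<Rightarrow>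
    (nat \<Rightarrow> ('r,'x) module) \<Rightarrow> (nat \<Rightarrow> nat \<Rightarrow> 'g set \<Rightarrow> 'x \<Rightarrow> 'x) \<Rightarrow>
    (nat \<Rightarrow> ('r,'y) module) \<Rightarrow> (nat \<Rightarrow> nat \<Rightarrow> 'g set \<Rightarrow> 'y \<Rightarrow> 'y) \<Rightarrow> (nat \<Rightarrow> 'x \<Rightarrow> 'y) \<Rightarrow> bool" where
  "ug_hom G os R M act M' act' \<eta> \<longleftrightarrow>
     (\<forall>n. linear_map R (M n) (M' n) (\<eta> n)) \<and>
     (\<forall>s t \<phi> x. \<phi> \<in> UHom G os s t \<and> x \<in> carrier (M s) \<longrightarrow> \<eta> t (act s t \<phi> x) = act' s t \<phi> (\<eta> s x))"

text \<open>The linearized representable functor sum: (\<Oplus>_{j \<in> J} R Hom(rk j, -))(n), as finitely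
  supported R-valued functions on the pairs (j, \<phi>) with j \<in> J, \<phi> \<in> Hom(rk j, n).\<close>
definition free_mod :: "(nat \<Rightarrow> 'g monoid) \<Rightarrow> (nat \<Rightarrow> nat \<Rightarrow> 'g \<Rightarrow> 'g \<Rightarrow> 'g) \<Rightarrow> 'r ring \<Rightarrow>
    'j set \<Rightarrow> ('j \<Rightarrow> nat) \<Rightarrow> nat \<Rightarrow> ('r, ('j \<times> 'g set) \<Rightarrow> 'r) module" where
  "free_mod G os R J rk n =
     \<lparr>partial_object.carrier = {c. (\<forall>x. c x \<in> carrier R) \<and> finite {x. c x \<noteq> ring.zero R} \<and>
                    {x. c x \<noteq> ring.zero R} \<subseteq> {(j, \<phi>). j \<in> J \<and> \<phi> \<in> UHom G os (rk j) n}},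
      monoid.mult = (\<lambda>c d. undefined), monoid.one = undefined,
      ring.zero = (\<lambda>x. ring.zero R), ring.add = (\<lambda>c d x. ring.add R (c x) (d x)),
      module.smult = (\<lambda>r c x. monoid.mult R r (c x))\<rparr>"

definition free_act :: "(nat \<Rightarrow> 'g monoid) \<Rightarrow> (nat \<Rightarrow> nat \<Rightarrow> 'g \<Rightarrow> 'g \<Rightarrow> 'g) \<Rightarrow> 'r ring \<Rightarrow>
    ('j \<Rightarrow> nat) \<Rightarrow> nat \<Rightarrow> nat \<Rightarrow> 'g set \<Rightarrow> (('j \<times> 'g set) \<Rightarrow> 'r) \<Rightarrow> (('j \<times> 'g set) \<Rightarrow> 'r)" where
  "free_act G os R rk s t \<psi> c =
     (\<lambda>(j, \<phi>'). finsum R (\<lambda>\<phi>. c (j, \<phi>))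
        {\<phi>. \<phi> \<in> UHom G os (rk j) s \<and> c (j, \<phi>) \<noteq> ring.zero R \<and> ucomp G os (rk j) s t \<psi> \<phi> = \<phi>'})"

definition free_gen_le :: "(nat \<Rightarrow> 'g monoid) \<Rightarrow> (nat \<Rightarrow> nat \<Rightarrow> 'g \<Rightarrow> 'g \<Rightarrow> 'g) \<Rightarrow> 'r ring \<Rightarrow>
    (nat \<Rightarrow> ('r,'x) module) \<Rightarrow> (nat \<Rightarrow> nat \<Rightarrow> 'g set \<Rightarrow> 'x \<Rightarrow> 'x) \<Rightarrow> int \<Rightarrow> bool" where
  "free_gen_le G os R M act d \<longleftrightarrow>
     (\<exists>(J :: 'x set) rk \<eta>. (\<forall>j\<in>J. int (rk j) \<le> d) \<and>
        ug_hom G os R (free_mod G os R J rk) (free_act G os R rk) M act \<eta> \<and>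
        (\<forall>n. bij_betw (\<eta> n) (carrier (free_mod G os R J rk n)) (carrier (M n))))"

definition free_resolution :: "(nat \<Rightarrow> 'g monoid) \<Rightarrow> (nat \<Rightarrow> nat \<Rightarrow> 'g \<Rightarrow> 'g \<Rightarrow> 'g) \<Rightarrow> 'r ring \<Rightarrow>
    nat \<Rightarrow> (nat \<Rightarrow> int) \<Rightarrow>
    (nat \<Rightarrow> ('r,'v) module) \<Rightarrow> (nat \<Rightarrow> nat \<Rightarrow> 'g set \<Rightarrow> 'v \<Rightarrow> 'v) \<Rightarrow>
    (nat \<Rightarrow> nat \<Rightarrow> ('r,'p) module) \<Rightarrow> (nat \<Rightarrow> nat \<Rightarrow> nat \<Rightarrow> 'g set \<Rightarrow> 'p \<Rightarrow> 'p) \<Rightarrow>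
    (nat \<Rightarrow> nat \<Rightarrow> 'p \<Rightarrow> 'p) \<Rightarrow> (nat \<Rightarrow> 'p \<Rightarrow> 'v) \<Rightarrow> bool" where
  "free_resolution G os R N d V Vact P Pact \<delta> \<epsilon> \<longleftrightarrow>
     (\<forall>i\<le>N. ug_module G os R (P i) (Pact i) \<and> free_gen_le G os R (P i) (Pact i) (d i)) \<and>
     (\<forall>i<N. ug_hom G os R (P (Suc i)) (Pact (Suc i)) (P i) (Pact i) (\<delta> i)) \<and>
     ug_hom G os R (P 0) (Pact 0) V Vact \<epsilon> \<and>
     (\<forall>n. \<epsilon> n ` carrier (P 0 n) = carrier (V n)) \<and>
     (1 \<le> N \<longrightarrow> (\<forall>n. \<delta> 0 n ` carrier (P 1 n) = {x \<in> carrier (P 0 n). \<epsilon> n x = ring.zero (V n)})) \<and>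
     (\<forall>i n. 1 \<le> i \<and> i < N \<longrightarrow>
        \<delta> i n ` carrier (P (Suc i) n) = {x \<in> carrier (P i n). \<delta> (i - 1) n x = ring.zero (P (i - 1) n)})"

text \<open>The constant UG-module R = R Hom(0,-).\<close>
definition ring_mod :: "'r ring \<Rightarrow> ('r,'r) module" where
  "ring_mod R = \<lparr>partial_object.carrier = carrier R, monoid.mult = monoid.mult R, monoid.one = monoid.one R, ring.zero = ring.zero R, ring.add = ring.add R,
                 module.smult = monoid.mult R\<rparr>"

definition const_act :: "nat \<Rightarrow> nat \<Rightarrow> 'g set \<Rightarrow> 'r \<Rightarrow> 'r" where
  "const_act s t \<phi> x = x"

definition gact :: "(nat \<Rightarrow> 'g monoid) \<Rightarrow> (nat \<Rightarrow> nat \<Rightarrow> 'g \<Rightarrow> 'g \<Rightarrow> 'g) \<Rightarrow>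
    (nat \<Rightarrow> nat \<Rightarrow> 'g set \<Rightarrow> 'x \<Rightarrow> 'x) \<Rightarrow> nat \<Rightarrow> 'g \<Rightarrow> 'x \<Rightarrow> 'x" where
  "gact G os act n g x = act n n (l_coset (G n) g (stabsub G os 0 n)) x"

definition minc :: "(nat \<Rightarrow> 'g monoid) \<Rightarrow> (nat \<Rightarrow> nat \<Rightarrow> 'g \<Rightarrow> 'g \<Rightarrow> 'g) \<Rightarrow> (nat \<Rightarrow> nat \<Rightarrow> 'g) \<Rightarrow>
    (nat \<Rightarrow> nat \<Rightarrow> 'g set \<Rightarrow> 'x \<Rightarrow> 'x) \<Rightarrow> nat \<Rightarrow> 'x \<Rightarrow> 'x" where
  "minc G os b act a x = act a (Suc a) (ginc G os b a) x"

text \<open>Formal R-linear combinations (lists of coefficient/generator pairs) and their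
  coefficient functions, i.e. elements of a free R-module.\<close>
definition fs :: "'r ring \<Rightarrow> ('r \<times> 'k) list \<Rightarrow> 'k \<Rightarrow> 'r" where
  "fs R L = (\<lambda>k. foldr (\<lambda>(r, k') acc. if k' = k then ring.add R r acc else acc) L (ring.zero R))"

definition valid :: "'r ring \<Rightarrow> 'k set \<Rightarrow> ('r \<times> 'k) list \<Rightarrow> bool" where
  "valid R S L \<longleftrightarrow> (\<forall>(r, k)\<in>set L. r \<in> carrier R \<and> k \<in> S)"

definition in_span :: "'r ring \<Rightarrow> ('r \<times> 'k) list set \<Rightarrow> ('r \<times> 'k) list \<Rightarrow> bool" where
  "in_span R S L \<longleftrightarrow>
     (\<exists>ts. (\<forall>(r, s)\<in>set ts. r \<in> carrier R \<and> s \<in> S) \<and>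
        fs R L = fs R (concat (map (\<lambda>(r, s). map (\<lambda>(a, k). (monoid.mult R r a, k)) s) ts)))"

text \<open>Generators g \<otimes> x of C_p(M)_n = RG_n \<otimes>_{RG_(n-p-1)} M_(n-p-1)  (p \<ge> 0); none if n < p+1.\<close>
definition cs_gens :: "(nat \<Rightarrow> 'g monoid) \<Rightarrow> (nat \<Rightarrow> ('r,'x) module) \<Rightarrow> nat \<Rightarrow> nat \<Rightarrow> ('g \<times> 'x) set" where
  "cs_gens G M p n = {(g, x). p + 1 \<le> n \<and> g \<in> carrier (G n) \<and> x \<in> carrier (M (n - p - 1))}"

text \<open>Defining relations of the tensor product RG_n \<otimes>_{RG_m} M_m, m = n-p-1, as a quotient of
  the free R-module on G_n \<times> M_m; G_m \<subseteq> G_n via h \<mapsto> h \<oplus> id_(p+1).\<close>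
definition cs_rels :: "(nat \<Rightarrow> 'g monoid) \<Rightarrow> (nat \<Rightarrow> nat \<Rightarrow> 'g \<Rightarrow> 'g \<Rightarrow> 'g) \<Rightarrow> 'r ring \<Rightarrow>
    (nat \<Rightarrow> ('r,'x) module) \<Rightarrow> (nat \<Rightarrow> nat \<Rightarrow> 'g set \<Rightarrow> 'x \<Rightarrow> 'x) \<Rightarrow> nat \<Rightarrow> nat \<Rightarrow>
    ('r \<times> ('g \<times> 'x)) list set" where
  "cs_rels G os R M act p n =
     {[(monoid.one R, (g, ring.add (M (n - p - 1)) x y)), (a_inv R (monoid.one R), (g, x)), (a_inv R (monoid.one R), (g, y))] | g x y.
        (g, x) \<in> cs_gens G M p n \<and> (g, y) \<in> cs_gens G M p n} \<union>
     {[(monoid.one R, (g, module.smult (M (n - p - 1)) r x)), (a_inv R r, (g, x))] | g x r.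
        (g, x) \<in> cs_gens G M p n \<and> r \<in> carrier R} \<union>
     {[(monoid.one R, (monoid.mult (G n) g (os (n - p - 1) (p + 1) h (monoid.one (G (p + 1)))), x)),
       (a_inv R (monoid.one R), (g, gact G os act (n - p - 1) h x))] | g h x.
        (g, x) \<in> cs_gens G M p n \<and> h \<in> carrier (G (n - p - 1))}"

definition cs_eq :: "(nat \<Rightarrow> 'g monoid) \<Rightarrow> (nat \<Rightarrow> nat \<Rightarrow> 'g \<Rightarrow> 'g \<Rightarrow> 'g) \<Rightarrow> 'r ring \<Rightarrow>
    (nat \<Rightarrow> ('r,'x) module) \<Rightarrow> (nat \<Rightarrow> nat \<Rightarrow> 'g set \<Rightarrow> 'x \<Rightarrow> 'x) \<Rightarrow> nat \<Rightarrow> nat \<Rightarrow>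
    ('r \<times> ('g \<times> 'x)) list \<Rightarrow> ('r \<times> ('g \<times> 'x)) list \<Rightarrow> bool" where
  "cs_eq G os R M act p n L L' \<longleftrightarrow>
     in_span R (cs_rels G os R M act p n) (L @ map (\<lambda>(r, k). (a_inv R r, k)) L')"

definition cs_face :: "(nat \<Rightarrow> 'g monoid) \<Rightarrow> (nat \<Rightarrow> nat \<Rightarrow> 'g \<Rightarrow> 'g \<Rightarrow> 'g) \<Rightarrow> (nat \<Rightarrow> nat \<Rightarrow> 'g) \<Rightarrow>
    nat \<Rightarrow> nat \<Rightarrow> nat \<Rightarrow> 'g" where
  "cs_face G os b p n i =
     os (n - p - 1) (p + 1) (monoid.one (G (n - p - 1))) (os (1 + i) (p - i) (b 1 i) (monoid.one (G (p - i))))"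

definition cs_d :: "(nat \<Rightarrow> 'g monoid) \<Rightarrow> (nat \<Rightarrow> nat \<Rightarrow> 'g \<Rightarrow> 'g \<Rightarrow> 'g) \<Rightarrow> (nat \<Rightarrow> nat \<Rightarrow> 'g) \<Rightarrow> 'r ring \<Rightarrow>
    (nat \<Rightarrow> nat \<Rightarrow> 'g set \<Rightarrow> 'x \<Rightarrow> 'x) \<Rightarrow> nat \<Rightarrow> nat \<Rightarrow>
    ('r \<times> ('g \<times> 'x)) list \<Rightarrow> ('r \<times> ('g \<times> 'x)) list" where
  "cs_d G os b R act p n L =
     concat (map (\<lambda>(r, (g, x)). map (\<lambda>i. (if even i then r else a_inv R r,
                   (monoid.mult (G n) g (cs_face G os b p n i), minc G os b act (n - p - 1) x))) [0..<p + 1]) L)"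

definition cs_d0 :: "(nat \<Rightarrow> 'g monoid) \<Rightarrow> (nat \<Rightarrow> nat \<Rightarrow> 'g \<Rightarrow> 'g \<Rightarrow> 'g) \<Rightarrow> (nat \<Rightarrow> nat \<Rightarrow> 'g) \<Rightarrow>
    (nat \<Rightarrow> ('r,'x) module) \<Rightarrow> (nat \<Rightarrow> nat \<Rightarrow> 'g set \<Rightarrow> 'x \<Rightarrow> 'x) \<Rightarrow> nat \<Rightarrow>
    ('r \<times> ('g \<times> 'x)) list \<Rightarrow> 'x" where
  "cs_d0 G os b M act n L =
     foldr (\<lambda>(r, (g, x)) acc. ring.add (M n) (module.smult (M n) r (gact G os act n g (minc G os b act (n - 1) x))) acc)
       L (ring.zero (M n))"

definition cs_homology_vanishes :: "(nat \<Rightarrow> 'g monoid) \<Rightarrow> (nat \<Rightarrow> nat \<Rightarrow> 'g \<Rightarrow> 'g \<Rightarrow> 'g) \<Rightarrow>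
    (nat \<Rightarrow> nat \<Rightarrow> 'g) \<Rightarrow> 'r ring \<Rightarrow>
    (nat \<Rightarrow> ('r,'x) module) \<Rightarrow> (nat \<Rightarrow> nat \<Rightarrow> 'g set \<Rightarrow> 'x \<Rightarrow> 'x) \<Rightarrow> int \<Rightarrow> nat \<Rightarrow> bool" where
  "cs_homology_vanishes G os b R M act i n \<longleftrightarrow>
     (if i = -1 then
        (\<forall>x\<in>carrier (M n). \<exists>L. valid R (cs_gens G M 0 n) L \<and> cs_d0 G os b M act n L = x)
      else if i = 0 then
        (\<forall>L. valid R (cs_gens G M 0 n) L \<and> cs_d0 G os b M act n L = ring.zero (M n) \<longrightarrow>
           (\<exists>L'. valid R (cs_gens G M 1 n) L' \<and> cs_eq G os R M act 0 n (cs_d G os b R act 1 n L') L))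
      else if i \<ge> 1 then
        (\<forall>L. valid R (cs_gens G M (nat i) n) L \<and> cs_eq G os R M act (nat i - 1) n (cs_d G os b R act (nat i) n L) [] \<longrightarrow>
           (\<exists>L'. valid R (cs_gens G M (nat i + 1) n) L' \<and>
                 cs_eq G os R M act (nat i) n (cs_d G os b R act (nat i + 1) n L') L))
      else True)"

end

theory Submission
  imports Defs
begin

text \<open>
  Since \<open>R[G_n]\<close> is free over \<open>R[G_(n-p-1)]\<close>, a short exact sequence \<open>0 \<rightarrow> K \<rightarrow> P \<rightarrow> V \<rightarrow> 0\<close> of modules induces a
  short exact sequence of central stability complexes. If \<open>P\<close> is free on generators of rank at most \<open>d_0\<close>, the
  braiding identifies the complex of \<open>P\<close> in rank \<open>n\<close> with a sum of copies of the complexes of the constant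
  functor in ranks \<open>n - m\<close>, \<open>m \<le> d_0\<close>; so by H3 the homology of \<open>P\<close> vanishes in degree \<open>i\<close> beyond
  \<open>k i + a + d_0 \<le> d_(i+1)\<close>, and in degree \<open>-1\<close> beyond \<open>d_0\<close>. The long exact sequence then turns the vanishing range
  of \<open>V\<close> into the one of \<open>K\<close> shifted by one degree, and conversely. Vanishing in degree \<open>-1\<close> beyond \<open>d_0\<close> says that
  \<open>V\<close> is generated in ranks at most \<open>d_0\<close>, i.e. covered by such a \<open>P\<close>; the theorem follows by induction on \<open>N\<close>.
\<close>

section \<open>Augmented semisimplicial abelian groups\<close>

lemma (in abelian_group_hom) hom_finsum:
  assumes "f \<in> S \<rightarrow> carrier G"
  shows "h (\<Oplus>\<^bsub>G\<^esub>i\<in>S. f i) = (\<Oplus>\<^bsub>H\<^esub>i\<in>S. h (f i))"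
  using assms
proof (induction S rule: infinite_finite_induct)
  case (insert i S)
  then show ?case by (simp add: G.finsum_insert H.finsum_insert Pi_iff)
qed simp_all

lemma abelian_group_homI_add:
  assumes "abelian_group A" "abelian_group B" and "\<And>x. x \<in> carrier A \<Longrightarrow> f x \<in> carrier B"
    and "\<And>x y. \<lbrakk>x \<in> carrier A; y \<in> carrier A\<rbrakk> \<Longrightarrow> f (x \<oplus>\<^bsub>A\<^esub> y) = f x \<oplus>\<^bsub>B\<^esub> f y"
  shows "abelian_group_hom A B f"
  using assms by (intro abelian_group_homI group_hom.intro group_hom_axioms.intro homI abelian_group.a_group) simp_all

lemma abelian_group_hom_cong:
  assumes hom: "abelian_group_hom A B f" and eq: "\<And>x. x \<in> carrier A \<Longrightarrow> g x = f x"
  shows "abelian_group_hom A B g"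
proof -
  interpret abelian_group_hom A B f by (rule hom)
  show ?thesis by (rule abelian_group_homI_add) (simp_all add: eq G.abelian_group_axioms H.abelian_group_axioms)
qed

lemma (in module) smult_hom: "a \<in> carrier R \<Longrightarrow> abelian_group_hom M M (\<lambda>x. a \<odot>\<^bsub>M\<^esub> x)"
  by (rule abelian_group_homI_add) (simp_all add: M.abelian_group_axioms smult_r_distr)

lemma abelian_group_hom_compose:
  assumes "abelian_group_hom A B f" "abelian_group_hom B C g"
  shows "abelian_group_hom A C (\<lambda>x. g (f x))"
proof -
  interpret f: abelian_group_hom A B f by fact
  interpret g: abelian_group_hom B C g by fact
  show ?thesis by (rule abelian_group_homI_add) (simp_all add: f.G.abelian_group_axioms g.H.abelian_group_axioms)
qed

lemma (in abelian_group_hom) hom_minus: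
  "\<lbrakk>x \<in> carrier G; y \<in> carrier G\<rbrakk> \<Longrightarrow> h (x \<ominus>\<^bsub>G\<^esub> y) = h x \<ominus>\<^bsub>H\<^esub> h y"
  by (simp add: a_minus_def)

lemma (in abelian_group) minus_zero_right: "x \<in> carrier G \<Longrightarrow> x \<ominus> \<zero> = x"
  by (simp add: a_minus_def)

lemma (in abelian_monoid) finsum_product:
  assumes fin: "finite A" "finite B" and f: "\<And>a b. \<lbrakk>a \<in> A; b \<in> B\<rbrakk> \<Longrightarrow> f a b \<in> carrier G"
  shows "(\<Oplus>a\<in>A. \<Oplus>b\<in>B. f a b) = (\<Oplus>p\<in>A \<times> B. f (fst p) (snd p))"
proof -
  have row: "(\<Oplus>b\<in>B. f a b) = (\<Oplus>p\<in>Pair a ` B. f (fst p) (snd p))" if "a \<in> A" for a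
    using f that by (subst finsum_reindex) (auto simp: inj_on_def)
  have "(\<Oplus>a\<in>A. \<Oplus>b\<in>B. f a b) = (\<Oplus>a\<in>A. \<Oplus>p\<in>Pair a ` B. f (fst p) (snd p))"
    using row f by (intro finsum_cong') (auto intro!: finsum_closed)
  also have "\<dots> = (\<Oplus>p\<in>(\<Union>a\<in>A. Pair a ` B). f (fst p) (snd p))"
    using fin f by (intro add.finprod_UN_disjoint[symmetric]) (auto simp: pairwise_def disjnt_def)
  also have "(\<Union>a\<in>A. Pair a ` B) = A \<times> B" by auto
  finally show ?thesis .
qed

definition signed :: "('a, 'm) ring_scheme \<Rightarrow> nat \<Rightarrow> 'a \<Rightarrow> 'a" where
  "signed A i x = (if even i then x else \<ominus>\<^bsub>A\<^esub> x)"

lemma (in abelian_group) signed_closed [simp]: "x \<in> carrier G \<Longrightarrow> signed G i x \<in> carrier G"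
  by (simp add: signed_def)

lemma (in abelian_group_hom) hom_signed: "x \<in> carrier G \<Longrightarrow> h (signed G i x) = signed H i (h x)"
  by (simp add: signed_def)

lemma lower_triangle_swap:
  fixes q :: nat
  defines "below \<equiv> {(j, i). i < j \<and> j \<le> Suc q}" and "swap \<equiv> \<lambda>(j, i). (i, j - 1)"
  shows "finite below" "inj_on swap below" "below \<inter> swap ` below = {}" "{..Suc q} \<times> {..q} = below \<union> swap ` below"
proof -
  show "finite below"
    by (rule finite_subset[of _ "{..Suc q} \<times> {..q}"]) (auto simp: below_def)
  show "inj_on swap below" by (rule inj_onI) (auto simp: below_def swap_def)
  show "below \<inter> swap ` below = {}" by (auto simp: below_def swap_def)
  have "p \<in> below \<union> swap ` below" if "p \<in> {..Suc q} \<times> {..q}" for p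
  proof (cases "snd p < fst p")
    case True
    then show ?thesis using that by (auto simp: below_def)
  next
    case False
    then have "p = swap (Suc (snd p), fst p)" "(Suc (snd p), fst p) \<in> below"
      using that by (auto simp: below_def swap_def)
    then show ?thesis by blast
  qed
  then show "{..Suc q} \<times> {..q} = below \<union> swap ` below" by (auto simp: below_def swap_def)
qed

lemma (in abelian_group) alternating_double_sum_eq_zero:
  assumes closed: "\<And>i j. \<lbrakk>j \<le> Suc q; i \<le> q\<rbrakk> \<Longrightarrow> a j i \<in> carrier G"
    and face: "\<And>i j. \<lbrakk>i < j; j \<le> Suc q\<rbrakk> \<Longrightarrow> a j i = a i (j - 1)"
  shows "(\<Oplus>j\<in>{..Suc q}. \<Oplus>i\<in>{..q}. signed G (i + j) (a j i)) = \<zero>"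
proof -
  define f where "f p = signed G (snd p + fst p) (a (fst p) (snd p))" for p
  define swap :: "nat \<times> nat \<Rightarrow> nat \<times> nat" where "swap = (\<lambda>(j, i). (i, j - 1))"
  define below where "below = {(j, i). i < j \<and> j \<le> Suc q}"
  note triangle = lower_triangle_swap[of q, folded below_def swap_def]
  have f_closed: "f p \<in> carrier G" "f (swap p) \<in> carrier G" if "p \<in> below" for p
    using that closed by (auto simp: f_def below_def swap_def)
  have cancel: "f p \<oplus> f (swap p) = \<zero>" if p: "p \<in> below" for p
  proof -
    obtain j i where ji: "p = (j, i)" "i < j" "j \<le> Suc q" using p by (auto simp: below_def)
    then obtain k where k: "j = Suc k" by (cases j) auto
    have "a j i = a i k" using face[OF ji(2,3)] k by simp
    then show ?thesis
      using ji k closed[of i k] by (simp add: f_def swap_def signed_def l_neg r_neg)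
  qed
  have "(\<Oplus>j\<in>{..Suc q}. \<Oplus>i\<in>{..q}. signed G (i + j) (a j i)) = finsum G f ({..Suc q} \<times> {..q})"
    unfolding f_def using closed by (intro finsum_product) auto
  also have "\<dots> = finsum G f below \<oplus> finsum G f (swap ` below)"
    unfolding triangle(4) using triangle(1,3) f_closed by (intro finsum_Un_disjoint) auto
  also have "finsum G f (swap ` below) = (\<Oplus>p\<in>below. f (swap p))"
    using triangle(2) f_closed by (intro finsum_reindex) auto
  also have "finsum G f below \<oplus> (\<Oplus>p\<in>below. f (swap p)) = (\<Oplus>p\<in>below. f p \<oplus> f (swap p))"
    using f_closed by (intro finsum_addf[symmetric]) auto
  also have "\<dots> = \<zero>" using cancel by (intro add.finprod_one_eqI) auto
  finally show ?thesis .
qed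

text \<open>The group \<open>C 0\<close> is the augmentation, so degree \<open>q\<close> here is degree \<open>q - 1\<close> in the usual numbering.\<close>

locale semisimplicial_group =
  fixes C :: "nat \<Rightarrow> ('c, 'm) ring_scheme" and face :: "nat \<Rightarrow> nat \<Rightarrow> 'c \<Rightarrow> 'c"
  assumes abelian_group [simp]: "abelian_group (C q)"
    and face_hom: "i \<le> q \<Longrightarrow> abelian_group_hom (C (Suc q)) (C q) (face q i)"
    and face_face: "\<lbrakk>i < j; j \<le> Suc q; x \<in> carrier (C (Suc (Suc q)))\<rbrakk>
      \<Longrightarrow> face q i (face (Suc q) j x) = face q (j - 1) (face (Suc q) i x)"
begin

lemma face_closed [simp]: "\<lbrakk>i \<le> q; x \<in> carrier (C (Suc q))\<rbrakk> \<Longrightarrow> face q i x \<in> carrier (C q)"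
  by (rule abelian_group_hom.hom_closed[OF face_hom])

definition boundary :: "nat \<Rightarrow> 'c \<Rightarrow> 'c" where
  "boundary q x = (\<Oplus>\<^bsub>C q\<^esub>i\<in>{..q}. signed (C q) i (face q i x))"

lemma boundary_closed [simp]: "x \<in> carrier (C (Suc q)) \<Longrightarrow> boundary q x \<in> carrier (C q)"
  unfolding boundary_def
  by (intro abelian_monoid.finsum_closed abelian_group.axioms(1)) (auto intro: abelian_group.signed_closed)

lemma boundary_hom: "abelian_group_hom (C (Suc q)) (C q) (boundary q)"
proof -
  interpret S: abelian_group "C (Suc q)" by simp
  interpret T: abelian_group "C q" by simp
  show ?thesis
  proof (rule abelian_group_homI)
    have "boundary q (x \<oplus>\<^bsub>C (Suc q)\<^esub> y) = boundary q x \<oplus>\<^bsub>C q\<^esub> boundary q y"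
      if xy: "x \<in> carrier (C (Suc q))" "y \<in> carrier (C (Suc q))" for x y
    proof -
      have "signed (C q) i (face q i (x \<oplus>\<^bsub>C (Suc q)\<^esub> y))
          = signed (C q) i (face q i x) \<oplus>\<^bsub>C q\<^esub> signed (C q) i (face q i y)" if "i \<le> q" for i
        using that xy abelian_group_hom.hom_add[OF face_hom] by (simp add: signed_def T.minus_add)
      then have "boundary q (x \<oplus>\<^bsub>C (Suc q)\<^esub> y)
          = (\<Oplus>\<^bsub>C q\<^esub>i\<in>{..q}. signed (C q) i (face q i x) \<oplus>\<^bsub>C q\<^esub> signed (C q) i (face q i y))"
        unfolding boundary_def using xy by (intro T.finsum_cong') auto
      then show ?thesis unfolding boundary_def using xy by (simp add: T.finsum_addf Pi_iff)
    qed
    then show "group_hom (add_monoid (C (Suc q))) (add_monoid (C q)) (boundary q)"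
      by (intro group_hom.intro group_hom_axioms.intro S.a_group T.a_group homI) simp_all
  qed simp_all
qed

lemma boundary_zero [simp]: "boundary q \<zero>\<^bsub>C (Suc q)\<^esub> = \<zero>\<^bsub>C q\<^esub>"
  by (rule abelian_group_hom.hom_zero[OF boundary_hom])

lemma minus_closed [simp]: "\<lbrakk>x \<in> carrier (C q); y \<in> carrier (C q)\<rbrakk> \<Longrightarrow> x \<ominus>\<^bsub>C q\<^esub> y \<in> carrier (C q)"
  by (rule abelian_group.minus_closed[OF abelian_group])

lemma minus_self [simp]: "x \<in> carrier (C q) \<Longrightarrow> x \<ominus>\<^bsub>C q\<^esub> x = \<zero>\<^bsub>C q\<^esub>"
  by (simp add: a_minus_def abelian_group.r_neg)

lemmas boundary_minus = abelian_group_hom.hom_minus[OF boundary_hom]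

lemma boundary_boundary:
  assumes "x \<in> carrier (C (Suc (Suc q)))"
  shows "boundary q (boundary (Suc q) x) = \<zero>\<^bsub>C q\<^esub>"
proof -
  interpret T: abelian_group "C q" by simp
  interpret S: abelian_group "C (Suc q)" by simp
  interpret B: abelian_group_hom "C (Suc q)" "C q" "boundary q" by (rule boundary_hom)
  have "boundary q (signed (C (Suc q)) j (face (Suc q) j x))
      = (\<Oplus>\<^bsub>C q\<^esub>i\<in>{..q}. signed (C q) (i + j) (face q i (face (Suc q) j x)))" if "j \<le> Suc q" for j
  proof -
    have "signed (C q) i (face q i (signed (C (Suc q)) j (face (Suc q) j x)))
        = signed (C q) (i + j) (face q i (face (Suc q) j x))" if "i \<le> q" for i
      using that \<open>j \<le> Suc q\<close> assms abelian_group_hom.hom_signed[OF face_hom[OF that]] by (auto simp: signed_def)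
    then show ?thesis unfolding boundary_def using that assms by (intro T.finsum_cong') auto
  qed
  then have "boundary q (boundary (Suc q) x)
      = (\<Oplus>\<^bsub>C q\<^esub>j\<in>{..Suc q}. \<Oplus>\<^bsub>C q\<^esub>i\<in>{..q}. signed (C q) (i + j) (face q i (face (Suc q) j x)))"
    unfolding boundary_def[of "Suc q"] using assms by (subst B.hom_finsum) (auto intro!: T.finsum_cong')
  also have "\<dots> = \<zero>\<^bsub>C q\<^esub>"
    using assms face_face by (intro T.alternating_double_sum_eq_zero) auto
  finally show ?thesis .
qed

definition cycles :: "nat \<Rightarrow> 'c set" where
  "cycles q = {x \<in> carrier (C q). \<forall>p. q = Suc p \<longrightarrow> boundary p x = \<zero>\<^bsub>C p\<^esub>}"

definition exact_at :: "nat \<Rightarrow> bool" where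
  "exact_at q \<longleftrightarrow> cycles q \<subseteq> boundary q ` carrier (C (Suc q))"

lemma boundary_cycles: "x \<in> carrier (C (Suc q)) \<Longrightarrow> boundary q x \<in> cycles q"
  by (auto simp: cycles_def boundary_boundary)

lemma exact_atE:
  assumes "exact_at q" "x \<in> cycles q"
  obtains y where "y \<in> carrier (C (Suc q))" "boundary q y = x"
  using assms by (auto simp: exact_at_def)

end

locale semisimplicial_hom = X: semisimplicial_group C face + Y: semisimplicial_group C' face'
  for C :: "nat \<Rightarrow> ('c, 'm) ring_scheme" and face and C' :: "nat \<Rightarrow> ('d, 'n) ring_scheme" and face' +
  fixes h :: "nat \<Rightarrow> 'c \<Rightarrow> 'd"
  assumes hom: "abelian_group_hom (C q) (C' q) (h q)"
    and hom_face: "\<lbrakk>i \<le> q; x \<in> carrier (C (Suc q))\<rbrakk> \<Longrightarrow> h q (face q i x) = face' q i (h (Suc q) x)"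
begin

lemma hom_closed [simp]: "x \<in> carrier (C q) \<Longrightarrow> h q x \<in> carrier (C' q)"
  and hom_zero [simp]: "h q \<zero>\<^bsub>C q\<^esub> = \<zero>\<^bsub>C' q\<^esub>"
  using abelian_group_hom.hom_closed[OF hom] abelian_group_hom.hom_zero[OF hom] by auto

lemmas hom_minus = abelian_group_hom.hom_minus[OF hom]

lemma hom_boundary:
  assumes "x \<in> carrier (C (Suc q))"
  shows "h q (X.boundary q x) = Y.boundary q (h (Suc q) x)"
proof -
  interpret H: abelian_group_hom "C q" "C' q" "h q" by (rule hom)
  show ?thesis unfolding X.boundary_def Y.boundary_def
    using assms by (subst H.hom_finsum) (auto simp: H.hom_signed hom_face intro!: H.H.finsum_cong')
qed

lemma hom_cycles: "x \<in> X.cycles q \<Longrightarrow> h q x \<in> Y.cycles q"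
  by (auto simp: X.cycles_def Y.cycles_def hom_boundary[symmetric])

lemma cycles_if_hom_cycles:
  assumes "\<And>p. inj_on (h p) (carrier (C p))" "x \<in> carrier (C q)" "h q x \<in> Y.cycles q"
  shows "x \<in> X.cycles q"
  unfolding X.cycles_def
proof (intro CollectI conjI allI impI)
  fix p assume q: "q = Suc p"
  then have "h p (X.boundary p x) = h p \<zero>\<^bsub>C p\<^esub>"
    using assms(2,3) by (simp add: hom_boundary Y.cycles_def)
  then show "X.boundary p x = \<zero>\<^bsub>C p\<^esub>"
    using inj_onD[OF assms(1)[of p]] assms(2) q by (auto simp: abelian_groupE(2))
qed (rule assms(2))

lemma exact_at_surj:
  assumes lift: "\<And>y. y \<in> Y.cycles q \<Longrightarrow> \<exists>x\<in>X.cycles q. h q x = y" and exact: "X.exact_at q"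
  shows "Y.exact_at q"
  unfolding Y.exact_at_def
proof
  fix y assume "y \<in> Y.cycles q"
  then obtain x where "x \<in> X.cycles q" "h q x = y" using lift by blast
  then obtain z where "z \<in> carrier (C (Suc q))" "h q (X.boundary q z) = y"
    using X.exact_atE[OF exact] by metis
  then show "y \<in> Y.boundary q ` carrier (C' (Suc q))"
    using hom_boundary hom_closed by (metis imageI)
qed

lemma exact_at_0_surj:
  assumes "\<And>q. h q ` carrier (C q) = carrier (C' q)" "X.exact_at 0"
  shows "Y.exact_at 0"
  using assms(2) by (rule exact_at_surj[rotated]) (use assms(1)[of 0] in \<open>force simp: X.cycles_def Y.cycles_def\<close>)

lemma exact_at_bij:
  assumes bij: "\<And>q. bij_betw (h q) (carrier (C q)) (carrier (C' q))" and exact: "X.exact_at q"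
  shows "Y.exact_at q"
  using exact
proof (rule exact_at_surj[rotated])
  have inj: "inj_on (h p) (carrier (C p))" for p using bij by (simp add: bij_betw_def)
  fix y assume y: "y \<in> Y.cycles q"
  then have "y \<in> h q ` carrier (C q)"
    using bij[of q] by (simp add: Y.cycles_def bij_betw_def)
  then obtain x where "x \<in> carrier (C q)" "h q x = y" by blast
  then show "\<exists>x\<in>X.cycles q. h q x = y" using cycles_if_hom_cycles[OF inj] y by blast
qed

end

locale semisimplicial_ses = I: semisimplicial_hom K faceK P faceP \<iota> + E: semisimplicial_hom P faceP V faceV \<epsilon>
  for K :: "nat \<Rightarrow> ('c, 'm) ring_scheme" and faceK and P :: "nat \<Rightarrow> ('d, 'n) ring_scheme" and faceP
    and V :: "nat \<Rightarrow> ('e, 'k) ring_scheme" and faceV and \<iota> \<epsilon> +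
  assumes inj: "inj_on (\<iota> q) (carrier (K q))"
    and surj: "\<epsilon> q ` carrier (P q) = carrier (V q)"
    and kernel: "\<iota> q ` carrier (K q) = {y \<in> carrier (P q). \<epsilon> q y = \<zero>\<^bsub>V q\<^esub>}"
begin

lemma kernelE:
  assumes "y \<in> carrier (P q)" "\<epsilon> q y = \<zero>\<^bsub>V q\<^esub>"
  obtains x where "x \<in> carrier (K q)" "\<iota> q x = y"
proof -
  have "y \<in> \<iota> q ` carrier (K q)" using assms by (simp add: kernel)
  then show thesis using that by blast
qed

lemma surjE:
  assumes "z \<in> carrier (V q)"
  obtains y where "y \<in> carrier (P q)" "\<epsilon> q y = z"
  using assms surj[of q] by (metis imageE)

lemma comp_zero: "x \<in> carrier (K q) \<Longrightarrow> \<epsilon> q (\<iota> q x) = \<zero>\<^bsub>V q\<^esub>"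
  using kernel[of q] by auto

lemma exact_at_quotient:
  assumes K: "I.X.exact_at q" and P: "I.Y.exact_at (Suc q)"
  shows "E.Y.exact_at (Suc q)"
  using P
proof (rule E.exact_at_surj[rotated])
  fix z assume z: "z \<in> E.Y.cycles (Suc q)"
  then obtain y where y: "y \<in> carrier (P (Suc q))" "\<epsilon> (Suc q) y = z"
    using surjE[of z "Suc q"] by (auto simp: E.Y.cycles_def)
  have "\<epsilon> q (I.Y.boundary q y) = \<zero>\<^bsub>V q\<^esub>"
    using E.hom_boundary[OF y(1)] y(2) z by (simp add: E.Y.cycles_def)
  then obtain x where x: "x \<in> carrier (K q)" "\<iota> q x = I.Y.boundary q y"
    using kernelE y(1) by (metis I.Y.boundary_closed)
  then have "x \<in> I.X.cycles q"
    using I.cycles_if_hom_cycles[OF inj] I.Y.boundary_cycles[OF y(1)] by simp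
  then obtain w where w: "w \<in> carrier (K (Suc q))" "I.X.boundary q w = x"
    using I.X.exact_atE[OF K] by blast
  let ?y = "y \<ominus>\<^bsub>P (Suc q)\<^esub> \<iota> (Suc q) w"
  have "I.Y.boundary q (\<iota> (Suc q) w) = I.Y.boundary q y"
    using I.hom_boundary[OF w(1)] w(2) x(2) by simp
  then have "?y \<in> I.Y.cycles (Suc q)"
    using y(1) w(1) by (simp add: I.Y.cycles_def I.Y.boundary_minus)
  moreover have "\<epsilon> (Suc q) ?y = z"
    using y w(1) comp_zero[OF w(1)] E.hom_closed[OF y(1)] by (simp add: E.hom_minus abelian_group.minus_zero_right)
  ultimately show "\<exists>y\<in>I.Y.cycles (Suc q). \<epsilon> (Suc q) y = z" by blast
qed

lemma exact_at_sub:
  assumes P: "I.Y.exact_at q" and V: "E.Y.exact_at (Suc q)"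
  shows "I.X.exact_at q"
  unfolding I.X.exact_at_def
proof
  fix x assume x: "x \<in> I.X.cycles q"
  then have xK: "x \<in> carrier (K q)" by (simp add: I.X.cycles_def)
  obtain y where y: "y \<in> carrier (P (Suc q))" "I.Y.boundary q y = \<iota> q x"
    using I.Y.exact_atE[OF P I.hom_cycles[OF x]] by blast
  have "\<epsilon> (Suc q) y \<in> E.Y.cycles (Suc q)"
    using y comp_zero[OF xK] by (simp add: E.Y.cycles_def E.hom_boundary[symmetric])
  then obtain z where z: "z \<in> carrier (V (Suc (Suc q)))" "E.Y.boundary (Suc q) z = \<epsilon> (Suc q) y"
    using E.Y.exact_atE[OF V] by blast
  obtain u where u: "u \<in> carrier (P (Suc (Suc q)))" "\<epsilon> (Suc (Suc q)) u = z"
    using surjE[OF z(1)] by blast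
  let ?y = "y \<ominus>\<^bsub>P (Suc q)\<^esub> I.Y.boundary (Suc q) u"
  have yP: "?y \<in> carrier (P (Suc q))" using y(1) u(1) by simp
  have "\<epsilon> (Suc q) ?y = \<zero>\<^bsub>V (Suc q)\<^esub>"
    using y(1) u E.hom_boundary[OF u(1)] z(2) by (simp add: E.hom_minus)
  then obtain w where w: "w \<in> carrier (K (Suc q))" "\<iota> (Suc q) w = ?y"
    using kernelE[OF yP] by blast
  have "\<iota> q (I.X.boundary q w) = I.Y.boundary q ?y" using I.hom_boundary[OF w(1)] w(2) by simp
  also have "\<dots> = \<iota> q x"
    using y u(1) xK I.Y.boundary_boundary[OF u(1)] by (simp add: I.Y.boundary_minus abelian_group.minus_zero_right)
  finally have "I.X.boundary q w = x"
    using inj_onD[OF inj] w(1) xK I.X.boundary_closed by blast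
  then show "x \<in> I.X.boundary q ` carrier (K (Suc q))" using w(1) by blast
qed

end

locale semisimplicial_sum = X: semisimplicial_group C face
  for C :: "nat \<Rightarrow> ('c, 'm) ring_scheme" and face +
  fixes S :: "'s set" and D :: "'s \<Rightarrow> nat \<Rightarrow> ('d, 'n) ring_scheme" and faceD and h :: "'s \<Rightarrow> nat \<Rightarrow> 'd \<Rightarrow> 'c"
  assumes summand: "s \<in> S \<Longrightarrow> semisimplicial_hom (D s) (faceD s) C face (h s)"
begin

lemma summand_group: "s \<in> S \<Longrightarrow> semisimplicial_group (D s) (faceD s)"
  using summand semisimplicial_hom_def by blast

lemma summand_abelian: "s \<in> S \<Longrightarrow> abelian_group (D s q)"
  by (rule semisimplicial_group.abelian_group[OF summand_group])

lemma summand_hom: "s \<in> S \<Longrightarrow> abelian_group_hom (D s q) (C q) (h s q)"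
  by (rule semisimplicial_hom.hom[OF summand])

lemma summand_closed: "\<lbrakk>s \<in> S; y \<in> carrier (D s q)\<rbrakk> \<Longrightarrow> h s q y \<in> carrier (C q)"
  by (rule semisimplicial_hom.hom_closed[OF summand])

definition families :: "nat \<Rightarrow> 's set \<Rightarrow> ('s \<Rightarrow> 'd) set" where
  "families q T = {y. finite T \<and> T \<subseteq> S \<and> (\<forall>s\<in>T. y s \<in> carrier (D s q))}"

definition family_sum :: "nat \<Rightarrow> 's set \<Rightarrow> ('s \<Rightarrow> 'd) \<Rightarrow> 'c" where
  "family_sum q T y = (\<Oplus>\<^bsub>C q\<^esub>s\<in>T. h s q (y s))"

lemma family_sum_closed: "y \<in> families q T \<Longrightarrow> family_sum q T y \<in> carrier (C q)"
  unfolding family_sum_def using summand_closed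
  by (intro abelian_monoid.finsum_closed abelian_group.axioms(1)[OF X.abelian_group]) (auto simp: families_def)

definition family_sums :: "nat \<Rightarrow> 'c set" where
  "family_sums q = {x. \<exists>T. \<exists>y\<in>families q T. x = family_sum q T y}"

lemma family_sumsE:
  assumes "x \<in> family_sums q"
  obtains T y where "y \<in> families q T" "x = family_sum q T y"
  using assms by (auto simp: family_sums_def)

lemma family_sum_extend:
  assumes y: "y \<in> families q T" and U: "finite U" "T \<subseteq> U" "U \<subseteq> S"
  obtains z where "z \<in> families q U" "family_sum q U z = family_sum q T y"
proof
  interpret abelian_group "C q" by simp
  let ?z = "\<lambda>s. if s \<in> T then y s else \<zero>\<^bsub>D s q\<^esub>"
  show "?z \<in> families q U"
    using y U summand_abelian by (auto simp: families_def abelian_groupE(2))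
  have "h s q \<zero>\<^bsub>D s q\<^esub> = \<zero>\<^bsub>C q\<^esub>" if "s \<in> U" for s
    using that U abelian_group_hom.hom_zero[OF summand_hom] by blast
  then show "family_sum q U ?z = family_sum q T y"
    unfolding family_sum_def using y U summand_closed
    by (intro add.finprod_mono_neutral_cong_right) (auto simp: families_def)
qed

lemma family_sums_zero: "\<zero>\<^bsub>C q\<^esub> \<in> family_sums q"
proof -
  interpret abelian_group "C q" by simp
  have "(\<lambda>_. undefined) \<in> families q {}" "\<zero>\<^bsub>C q\<^esub> = family_sum q {} (\<lambda>_. undefined)"
    by (simp_all add: families_def family_sum_def)
  then show ?thesis unfolding family_sums_def by blast
qed

lemma family_sums_summand:
  assumes "s \<in> S" "y \<in> carrier (D s q)"
  shows "h s q y \<in> family_sums q"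
proof -
  interpret abelian_group "C q" by simp
  have "(\<lambda>_. y) \<in> families q {s}" "h s q y = family_sum q {s} (\<lambda>_. y)"
    using assms summand_closed by (simp_all add: families_def family_sum_def)
  then show ?thesis unfolding family_sums_def by blast
qed

lemma family_sums_add:
  assumes "x \<in> family_sums q" "x' \<in> family_sums q"
  shows "x \<oplus>\<^bsub>C q\<^esub> x' \<in> family_sums q"
proof -
  interpret abelian_group "C q" by simp
  obtain T y T' y' where y: "y \<in> families q T" "x = family_sum q T y"
    and y': "y' \<in> families q T'" "x' = family_sum q T' y'"
    using assms by (elim family_sumsE)
  have U: "finite (T \<union> T')" "T \<union> T' \<subseteq> S" using y(1) y'(1) by (auto simp: families_def)
  obtain z where z: "z \<in> families q (T \<union> T')" "family_sum q (T \<union> T') z = x"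
    using family_sum_extend[OF y(1) U(1) _ U(2)] y(2) by auto
  obtain z' where z': "z' \<in> families q (T \<union> T')" "family_sum q (T \<union> T') z' = x'"
    using family_sum_extend[OF y'(1) U(1) _ U(2)] y'(2) by auto
  let ?z = "\<lambda>s. z s \<oplus>\<^bsub>D s q\<^esub> z' s"
  have closed: "z s \<in> carrier (D s q)" "z' s \<in> carrier (D s q)" "s \<in> S" if "s \<in> T \<union> T'" for s
    using that z(1) z'(1) by (auto simp: families_def)
  have "family_sum q (T \<union> T') ?z
      = (\<Oplus>\<^bsub>C q\<^esub>s\<in>T \<union> T'. h s q (z s) \<oplus>\<^bsub>C q\<^esub> h s q (z' s))"
    unfolding family_sum_def using closed summand_closed abelian_group_hom.hom_add[OF summand_hom]
    by (intro finsum_cong') auto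
  also have "\<dots> = family_sum q (T \<union> T') z \<oplus>\<^bsub>C q\<^esub> family_sum q (T \<union> T') z'"
    unfolding family_sum_def using closed summand_closed by (intro finsum_addf) auto
  finally have "x \<oplus>\<^bsub>C q\<^esub> x' = family_sum q (T \<union> T') ?z" using z(2) z'(2) by simp
  moreover have "?z \<in> families q (T \<union> T')"
    using U closed summand_abelian by (auto simp: families_def abelian_groupE(1))
  ultimately show ?thesis unfolding family_sums_def by blast
qed

lemma boundary_family_sum:
  assumes "y \<in> families (Suc q) T"
  shows "X.boundary q (family_sum (Suc q) T y)
    = family_sum q T (\<lambda>s. semisimplicial_group.boundary (D s) (faceD s) q (y s))"
proof -
  interpret B: abelian_group_hom "C (Suc q)" "C q" "X.boundary q" by (rule X.boundary_hom)
  have y: "s \<in> S" "y s \<in> carrier (D s (Suc q))" if "s \<in> T" for s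
    using assms that by (auto simp: families_def)
  have closed: "h s (Suc q) (y s) \<in> carrier (C (Suc q))" if "s \<in> T" for s
    using y[OF that] by (rule summand_closed)
  have "X.boundary q (family_sum (Suc q) T y) = (\<Oplus>\<^bsub>C q\<^esub>s\<in>T. X.boundary q (h s (Suc q) (y s)))"
    unfolding family_sum_def using closed by (intro B.hom_finsum) auto
  also have "\<dots> = family_sum q T (\<lambda>s. semisimplicial_group.boundary (D s) (faceD s) q (y s))"
    unfolding family_sum_def
  proof (rule B.H.finsum_cong'[OF refl])
    fix s assume s: "s \<in> T"
    show "X.boundary q (h s (Suc q) (y s)) = h s q (semisimplicial_group.boundary (D s) (faceD s) q (y s))"
      using semisimplicial_hom.hom_boundary[OF summand] y[OF s] by simp
  next
    show "(\<lambda>s. h s q (semisimplicial_group.boundary (D s) (faceD s) q (y s))) \<in> T \<rightarrow> carrier (C q)"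
      using y by (auto intro!: summand_closed semisimplicial_group.boundary_closed[OF summand_group])
  qed
  finally show ?thesis .
qed

context
  assumes independent: "\<And>p T y s. \<lbrakk>y \<in> families p T; family_sum p T y = \<zero>\<^bsub>C p\<^esub>; s \<in> T\<rbrakk> \<Longrightarrow> y s = \<zero>\<^bsub>D s p\<^esub>"
begin

lemma component_cycles:
  assumes y: "y \<in> families q T" "family_sum q T y \<in> X.cycles q" and s: "s \<in> T"
  shows "y s \<in> semisimplicial_group.cycles (D s) (faceD s) q"
proof -
  have S: "s \<in> S" if "s \<in> T" for s using y(1) that by (auto simp: families_def)
  show ?thesis
    unfolding semisimplicial_group.cycles_def[OF summand_group[OF S[OF s]]]
  proof (intro CollectI conjI allI impI)
    show "y s \<in> carrier (D s q)" using y(1) s by (simp add: families_def)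
    fix p assume p: "q = Suc p"
    let ?dy = "\<lambda>s. semisimplicial_group.boundary (D s) (faceD s) p (y s)"
    have "?dy \<in> families p T"
      using y(1) p S by (auto simp: families_def semisimplicial_group.boundary_closed[OF summand_group])
    moreover have "family_sum p T ?dy = \<zero>\<^bsub>C p\<^esub>"
      using boundary_family_sum[of y p T] y p by (simp add: X.cycles_def)
    ultimately show "?dy s = \<zero>\<^bsub>D s p\<^esub>" using s by (rule independent)
  qed
qed

theorem exact_at_sum:
  assumes span: "carrier (C q) \<subseteq> family_sums q"
    and exact: "\<And>s. s \<in> S \<Longrightarrow> semisimplicial_group.exact_at (D s) (faceD s) q"
  shows "X.exact_at q"
  unfolding X.exact_at_def
proof
  fix x assume x: "x \<in> X.cycles q"
  then have "x \<in> family_sums q" using span by (auto simp: X.cycles_def)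
  then obtain T y where y: "y \<in> families q T" "x = family_sum q T y" by (rule family_sumsE)
  have S: "s \<in> S" if "s \<in> T" for s using y(1) that by (auto simp: families_def)
  have "\<exists>z\<in>carrier (D s (Suc q)). semisimplicial_group.boundary (D s) (faceD s) q z = y s" if "s \<in> T" for s
    using semisimplicial_group.exact_atE[OF summand_group exact component_cycles[OF y(1)]] x y(2) that S by metis
  then obtain z where z: "\<And>s. s \<in> T \<Longrightarrow> z s \<in> carrier (D s (Suc q))"
    "\<And>s. s \<in> T \<Longrightarrow> semisimplicial_group.boundary (D s) (faceD s) q (z s) = y s"
    by metis
  have z_families: "z \<in> families (Suc q) T" using y(1) z(1) by (simp add: families_def)
  interpret abelian_group "C q" by simp
  have "X.boundary q (family_sum (Suc q) T z) = x"
    unfolding boundary_family_sum[OF z_families] unfolding y(2) family_sum_def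
    using z(2) S y(1) summand_closed by (intro finsum_cong') (auto simp: families_def)
  moreover have "family_sum (Suc q) T z \<in> carrier (C (Suc q))"
    using z_families by (rule family_sum_closed)
  ultimately show "x \<in> X.boundary q ` carrier (C (Suc q))" by blast
qed

end

end

section \<open>Induced modules\<close>

definition pointwise :: "('y, 'm) ring_scheme \<Rightarrow> ('a \<Rightarrow> 'y) set \<Rightarrow> ('a \<Rightarrow> 'y) ring" where
  "pointwise M S = \<lparr>carrier = S, monoid.mult = (\<lambda>c d. undefined), one = undefined,
     ring.zero = (\<lambda>_. \<zero>\<^bsub>M\<^esub>), add = (\<lambda>c d g. c g \<oplus>\<^bsub>M\<^esub> d g)\<rparr>"

lemma pointwise_simps [simp]:
  "carrier (pointwise M S) = S" "\<zero>\<^bsub>pointwise M S\<^esub> = (\<lambda>_. \<zero>\<^bsub>M\<^esub>)"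
  "c \<oplus>\<^bsub>pointwise M S\<^esub> d = (\<lambda>g. c g \<oplus>\<^bsub>M\<^esub> d g)"
  by (simp_all add: pointwise_def)

text \<open>
  The module induced along an injective homomorphism \<open>emb\<close> from \<open>H\<close> to \<open>A\<close> is realised as a group of functions on
  \<open>A\<close>: the value of \<open>g \<otimes> x\<close> at \<open>g'\<close> is the coefficient of \<open>g'\<close> when \<open>g'\<close> is taken as representative of its coset.
\<close>

locale induced_module = A: group A + H: group H + M: abelian_group M
  for A :: "'a monoid" and H :: "'h monoid" and M :: "('x, 'm) ring_scheme" +
  fixes emb :: "'h \<Rightarrow> 'a" and act :: "'h \<Rightarrow> 'x \<Rightarrow> 'x"
  assumes emb_closed [simp]: "h \<in> carrier H \<Longrightarrow> emb h \<in> carrier A"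
    and emb_mult: "\<lbrakk>h \<in> carrier H; k \<in> carrier H\<rbrakk> \<Longrightarrow> emb (h \<otimes>\<^bsub>H\<^esub> k) = emb h \<otimes>\<^bsub>A\<^esub> emb k"
    and emb_inj: "inj_on emb (carrier H)"
    and act_closed [simp]: "\<lbrakk>h \<in> carrier H; x \<in> carrier M\<rbrakk> \<Longrightarrow> act h x \<in> carrier M"
    and act_add: "\<lbrakk>h \<in> carrier H; x \<in> carrier M; y \<in> carrier M\<rbrakk> \<Longrightarrow> act h (x \<oplus>\<^bsub>M\<^esub> y) = act h x \<oplus>\<^bsub>M\<^esub> act h y"
    and act_one: "x \<in> carrier M \<Longrightarrow> act \<one>\<^bsub>H\<^esub> x = x"
    and act_mult: "\<lbrakk>h \<in> carrier H; k \<in> carrier H; x \<in> carrier M\<rbrakk> \<Longrightarrow> act (h \<otimes>\<^bsub>H\<^esub> k) x = act h (act k x)"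
begin

lemma act_zero: "h \<in> carrier H \<Longrightarrow> act h \<zero>\<^bsub>M\<^esub> = \<zero>\<^bsub>M\<^esub>"
  by (metis M.add.r_cancel_one' M.zero_closed act_add act_closed M.l_zero)

lemma emb_one: "emb \<one>\<^bsub>H\<^esub> = \<one>\<^bsub>A\<^esub>"
  by (metis A.l_cancel_one' H.one_closed H.l_one emb_closed emb_mult)

lemma subgroup_emb: "subgroup (emb ` carrier H) A"
  by (intro group_hom.img_is_subgroup group_hom.intro group_hom_axioms.intro homI
      A.group_axioms H.group_axioms emb_closed emb_mult)

definition coset :: "'a \<Rightarrow> 'a set" where
  "coset g = g <#\<^bsub>A\<^esub> (emb ` carrier H)"

lemma mem_coset_iff: "g \<in> coset g' \<longleftrightarrow> (\<exists>h\<in>carrier H. g = g' \<otimes>\<^bsub>A\<^esub> emb h)"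
  by (auto simp: coset_def l_coset_def)

lemma coset_eq_iff: "\<lbrakk>g \<in> carrier A; g' \<in> carrier A\<rbrakk> \<Longrightarrow> coset g = coset g' \<longleftrightarrow> g \<in> coset g'"
  using A.l_repr_independence[OF _ _ subgroup_emb] A.lcos_self[OF _ subgroup_emb] by (auto simp: coset_def)

definition tensor :: "'a \<Rightarrow> 'x \<Rightarrow> 'a \<Rightarrow> 'x" where
  "tensor g x = (\<lambda>g'. if g' \<in> carrier A \<and> g \<in> coset g'
     then act (the_inv_into (carrier H) (\<lambda>h. g' \<otimes>\<^bsub>A\<^esub> emb h) g) x else \<zero>\<^bsub>M\<^esub>)"

lemma tensor_inside:
  assumes "g' \<in> carrier A" "h \<in> carrier H"
  shows "tensor (g' \<otimes>\<^bsub>A\<^esub> emb h) x g' = act h x"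
proof -
  have "inj_on (\<lambda>h. g' \<otimes>\<^bsub>A\<^esub> emb h) (carrier H)"
    using assms(1) emb_inj by (auto simp: inj_on_def)
  from the_inv_into_f_f[OF this assms(2)] show ?thesis
    using assms by (auto simp: tensor_def mem_coset_iff)
qed

lemma tensor_outside: "g \<notin> coset g' \<Longrightarrow> tensor g x g' = \<zero>\<^bsub>M\<^esub>"
  by (simp add: tensor_def)

lemma tensor_outside_carrier: "g' \<notin> carrier A \<Longrightarrow> tensor g x g' = \<zero>\<^bsub>M\<^esub>"
  by (simp add: tensor_def)

lemma tensor_cases [consumes 1]:
  assumes "g \<in> carrier A"
  obtains (inside) h where "g' \<in> carrier A" "h \<in> carrier H" "g = g' \<otimes>\<^bsub>A\<^esub> emb h" "\<And>x. tensor g x g' = act h x"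
  | (outside) "g' \<notin> carrier A \<or> g \<notin> coset g'" "\<And>x. tensor g x g' = \<zero>\<^bsub>M\<^esub>"
proof (cases "g' \<in> carrier A \<and> g \<in> coset g'")
  case True
  then obtain h where "h \<in> carrier H" "g = g' \<otimes>\<^bsub>A\<^esub> emb h" by (auto simp: mem_coset_iff)
  then show thesis using True inside tensor_inside by blast
qed (use outside tensor_outside tensor_outside_carrier in blast)

lemma tensor_value_closed [simp]: "\<lbrakk>g \<in> carrier A; x \<in> carrier M\<rbrakk> \<Longrightarrow> tensor g x g' \<in> carrier M"
  by (rule tensor_cases[of g g']) auto

lemma tensor_self: "\<lbrakk>g \<in> carrier A; x \<in> carrier M\<rbrakk> \<Longrightarrow> tensor g x g = x"
  using tensor_inside[of g "\<one>\<^bsub>H\<^esub>" x] by (simp add: emb_one act_one)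

lemma tensor_add:
  "\<lbrakk>g \<in> carrier A; x \<in> carrier M; y \<in> carrier M\<rbrakk> \<Longrightarrow> tensor g (x \<oplus>\<^bsub>M\<^esub> y) g' = tensor g x g' \<oplus>\<^bsub>M\<^esub> tensor g y g'"
  by (rule tensor_cases[of g g']) (auto simp: act_add)

lemma tensor_mult_emb:
  assumes "g \<in> carrier A" "h \<in> carrier H" "x \<in> carrier M"
  shows "tensor (g \<otimes>\<^bsub>A\<^esub> emb h) x = tensor g (act h x)"
proof
  fix g'
  show "tensor (g \<otimes>\<^bsub>A\<^esub> emb h) x g' = tensor g (act h x) g'" using assms(1)
  proof (cases rule: tensor_cases[where g' = g'])
    case (inside k)
    then have "g \<otimes>\<^bsub>A\<^esub> emb h = g' \<otimes>\<^bsub>A\<^esub> emb (k \<otimes>\<^bsub>H\<^esub> h)"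
      using assms by (simp add: emb_mult A.m_assoc)
    then show ?thesis using inside assms tensor_inside[of g' "k \<otimes>\<^bsub>H\<^esub> h" x] by (simp add: act_mult)
  next
    case outside
    have "g \<otimes>\<^bsub>A\<^esub> emb h \<in> coset g" using assms(2) by (auto simp: mem_coset_iff)
    then have "coset (g \<otimes>\<^bsub>A\<^esub> emb h) = coset g" using assms by (simp add: coset_eq_iff)
    then have "g \<otimes>\<^bsub>A\<^esub> emb h \<in> coset g' \<Longrightarrow> g' \<in> carrier A \<Longrightarrow> g \<in> coset g'"
      using assms coset_eq_iff[of "g \<otimes>\<^bsub>A\<^esub> emb h" g'] coset_eq_iff[of g g'] by simp
    then show ?thesis using outside tensor_outside tensor_outside_carrier by metis
  qed
qed

definition terms :: "('a \<times> 'x) list set" where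
  "terms = {l. set l \<subseteq> carrier A \<times> carrier M}"

lemma terms_simps [simp]:
  "[] \<in> terms" "t # l \<in> terms \<longleftrightarrow> fst t \<in> carrier A \<and> snd t \<in> carrier M \<and> l \<in> terms"
  "l @ k \<in> terms \<longleftrightarrow> l \<in> terms \<and> k \<in> terms"
  by (auto simp: terms_def mem_Times_iff)

definition tensor_sum :: "('a \<times> 'x) list \<Rightarrow> 'a \<Rightarrow> 'x" where
  "tensor_sum l = (\<lambda>g'. foldr (\<lambda>(g, x) s. tensor g x g' \<oplus>\<^bsub>M\<^esub> s) l \<zero>\<^bsub>M\<^esub>)"

definition ind :: "('a \<Rightarrow> 'x) ring" where
  "ind = pointwise M (tensor_sum ` terms)"

lemma ind_simps [simp]: "\<zero>\<^bsub>ind\<^esub> = (\<lambda>_. \<zero>\<^bsub>M\<^esub>)" "c \<oplus>\<^bsub>ind\<^esub> d = (\<lambda>g. c g \<oplus>\<^bsub>M\<^esub> d g)"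
  by (simp_all add: ind_def)

lemma tensor_sum_Nil [simp]: "tensor_sum [] = (\<lambda>_. \<zero>\<^bsub>M\<^esub>)"
  and tensor_sum_Cons [simp]: "tensor_sum ((g, x) # l) = (\<lambda>g'. tensor g x g' \<oplus>\<^bsub>M\<^esub> tensor_sum l g')"
  by (simp_all add: tensor_sum_def)

lemma tensor_sum_value_closed [simp]: "l \<in> terms \<Longrightarrow> tensor_sum l g' \<in> carrier M"
  by (induction l) auto

lemma tensor_sum_append:
  "\<lbrakk>l \<in> terms; k \<in> terms\<rbrakk> \<Longrightarrow> tensor_sum (l @ k) = (\<lambda>g'. tensor_sum l g' \<oplus>\<^bsub>M\<^esub> tensor_sum k g')"
  by (induction l) (auto simp: M.a_assoc)

lemma tensor_sum_in_ind [simp]: "l \<in> terms \<Longrightarrow> tensor_sum l \<in> carrier ind"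
  by (simp add: ind_def)

lemma indE:
  assumes "c \<in> carrier ind"
  obtains l where "l \<in> terms" "c = tensor_sum l"
  using assms by (auto simp: ind_def)

lemma ind_value_closed [simp]: "c \<in> carrier ind \<Longrightarrow> c g \<in> carrier M"
  by (auto elim!: indE)

lemma tensor_in_ind [simp]:
  assumes "g \<in> carrier A" "x \<in> carrier M"
  shows "tensor g x \<in> carrier ind"
  using tensor_sum_in_ind[of "[(g, x)]"] assms by simp

lemma tensor_add_ind:
  "\<lbrakk>g \<in> carrier A; x \<in> carrier M; y \<in> carrier M\<rbrakk> \<Longrightarrow> tensor g (x \<oplus>\<^bsub>M\<^esub> y) = tensor g x \<oplus>\<^bsub>ind\<^esub> tensor g y"
  by (auto simp: tensor_add)

lemma ind_induct [consumes 1, case_names zero add]: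
  assumes "c \<in> carrier ind" and zero: "P \<zero>\<^bsub>ind\<^esub>"
    and add: "\<And>g x c. \<lbrakk>g \<in> carrier A; x \<in> carrier M; c \<in> carrier ind; P c\<rbrakk> \<Longrightarrow> P (tensor g x \<oplus>\<^bsub>ind\<^esub> c)"
  shows "P c"
proof -
  obtain l where "l \<in> terms" "c = tensor_sum l" using assms(1) by (rule indE)
  moreover have "P (tensor_sum l)" if "l \<in> terms" for l
    using that
  proof (induction l)
    case (Cons a l)
    then show ?case using add[of "fst a" "snd a" "tensor_sum l"] by (cases a) auto
  qed (use zero in simp)
  ultimately show ?thesis by simp
qed

definition negate :: "('a \<times> 'x) list \<Rightarrow> ('a \<times> 'x) list" where
  "negate = map (\<lambda>(g, x). (g, \<ominus>\<^bsub>M\<^esub> x))"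

lemma negate_terms [simp]: "l \<in> terms \<Longrightarrow> negate l \<in> terms"
  by (induction l) (auto simp: negate_def)

lemma tensor_sum_negate:
  assumes "l \<in> terms"
  shows "tensor_sum (negate l) g' \<oplus>\<^bsub>M\<^esub> tensor_sum l g' = \<zero>\<^bsub>M\<^esub>"
  using assms
proof (induction l)
  case (Cons a l)
  obtain g x where a: "a = (g, x)" by (cases a)
  have gx: "g \<in> carrier A" "x \<in> carrier M" "l \<in> terms" using Cons.prems a by auto
  have "tensor g (\<ominus>\<^bsub>M\<^esub> x) g' \<oplus>\<^bsub>M\<^esub> tensor g x g' = tensor g \<zero>\<^bsub>M\<^esub> g'"
    using gx by (simp add: tensor_add[symmetric] M.l_neg)
  also have "\<dots> = \<zero>\<^bsub>M\<^esub>" by (rule tensor_cases[OF gx(1), of g']) (simp_all add: act_zero)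
  finally have single: "tensor g (\<ominus>\<^bsub>M\<^esub> x) g' \<oplus>\<^bsub>M\<^esub> tensor g x g' = \<zero>\<^bsub>M\<^esub>" .
  have "tensor_sum (negate (a # l)) g' \<oplus>\<^bsub>M\<^esub> tensor_sum (a # l) g'
      = (tensor g (\<ominus>\<^bsub>M\<^esub> x) g' \<oplus>\<^bsub>M\<^esub> tensor g x g') \<oplus>\<^bsub>M\<^esub> (tensor_sum (negate l) g' \<oplus>\<^bsub>M\<^esub> tensor_sum l g')"
    using gx negate_terms[OF gx(3)] by (simp add: negate_def a M.a_ac)
  then show ?case using single Cons.IH[OF gx(3)] by simp
qed (simp add: negate_def)

lemma abelian_group_ind: "abelian_group ind"
proof (rule abelian_groupI)
  show "c \<oplus>\<^bsub>ind\<^esub> d \<in> carrier ind" if "c \<in> carrier ind" "d \<in> carrier ind" for c d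
  proof -
    obtain l k where "l \<in> terms" "c = tensor_sum l" "k \<in> terms" "d = tensor_sum k"
      using \<open>c \<in> carrier ind\<close> \<open>d \<in> carrier ind\<close> by (elim indE)
    then show ?thesis using tensor_sum_in_ind[of "l @ k"] by (simp add: tensor_sum_append)
  qed
  show "\<exists>d\<in>carrier ind. d \<oplus>\<^bsub>ind\<^esub> c = \<zero>\<^bsub>ind\<^esub>" if "c \<in> carrier ind" for c
  proof -
    obtain l where "l \<in> terms" "c = tensor_sum l" using \<open>c \<in> carrier ind\<close> by (rule indE)
    then show ?thesis by (intro bexI[of _ "tensor_sum (negate l)"]) (simp_all add: tensor_sum_negate)
  qed
  show "\<zero>\<^bsub>ind\<^esub> \<in> carrier ind" using tensor_sum_in_ind[of "[]"] by simp
qed (auto simp: M.a_ac)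

text \<open>
  Collecting the terms by cosets is a normal form: its coefficients are values of the function that the list represents,
  so a list representing \<open>0\<close> has only zero coefficients after collection. This gives the universal property below.
\<close>

primrec insert_term :: "'a \<Rightarrow> 'x \<Rightarrow> ('a \<times> 'x) list \<Rightarrow> ('a \<times> 'x) list" where
  "insert_term g x [] = [(g, x)]"
| "insert_term g x (t # l) = (if g \<in> coset (fst t) then (fst t, tensor g x (fst t) \<oplus>\<^bsub>M\<^esub> snd t) # l
     else t # insert_term g x l)"

definition collect_terms :: "('a \<times> 'x) list \<Rightarrow> ('a \<times> 'x) list" where
  "collect_terms l = foldr (\<lambda>(g, x). insert_term g x) l []"

definition distinct_cosets :: "('a \<times> 'x) list \<Rightarrow> bool" where
  "distinct_cosets l \<longleftrightarrow> distinct (map (coset \<circ> fst) l)"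

lemma insert_term_terms: "\<lbrakk>g \<in> carrier A; x \<in> carrier M; l \<in> terms\<rbrakk> \<Longrightarrow> insert_term g x l \<in> terms"
  by (induction l) auto

lemma collect_terms_terms: "l \<in> terms \<Longrightarrow> collect_terms l \<in> terms"
  by (induction l) (auto simp: collect_terms_def insert_term_terms)

lemma distinct_cosets_insert_term:
  assumes "g \<in> carrier A" "l \<in> terms" "distinct_cosets l"
  shows "distinct_cosets (insert_term g x l)"
proof -
  have subset: "set (map (coset \<circ> fst) (insert_term g x l)) \<subseteq> insert (coset g) (set (map (coset \<circ> fst) l))" for l
    by (induction l) auto
  show ?thesis using assms(2,3)
  proof (induction l)
    case (Cons t l)
    then have IH: "distinct_cosets (insert_term g x l)" and new: "coset (fst t) \<notin> set (map (coset \<circ> fst) l)"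
      by (simp_all add: distinct_cosets_def)
    show ?case
    proof (cases "g \<in> coset (fst t)")
      case True
      then show ?thesis using Cons.prems by (simp add: distinct_cosets_def)
    next
      case False
      then have "coset (fst t) \<noteq> coset g"
        using assms(1) Cons.prems(1) coset_eq_iff[of g "fst t"] by auto
      then have "coset (fst t) \<notin> set (map (coset \<circ> fst) (insert_term g x l))"
        using new subset[of l] by blast
      then show ?thesis using False IH by (simp add: distinct_cosets_def)
    qed
  qed (simp add: distinct_cosets_def)
qed

lemma distinct_cosets_collect_terms: "l \<in> terms \<Longrightarrow> distinct_cosets (collect_terms l)"
proof (induction l)
  case (Cons t l)
  then show ?case using distinct_cosets_insert_term[of "fst t" "collect_terms l" "snd t"] collect_terms_terms[of l]
    by (auto simp: collect_terms_def case_prod_beta)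
qed (simp add: collect_terms_def distinct_cosets_def)

lemma tensor_sum_outside:
  "\<lbrakk>l \<in> terms; g \<in> carrier A; coset g \<notin> set (map (coset \<circ> fst) l)\<rbrakk> \<Longrightarrow> tensor_sum l g = \<zero>\<^bsub>M\<^esub>"
proof (induction l)
  case (Cons t l)
  have "fst t \<in> carrier A" "coset (fst t) \<noteq> coset g" using Cons.prems by auto
  then have "tensor (fst t) (snd t) g = \<zero>\<^bsub>M\<^esub>"
    using Cons.prems(2) coset_eq_iff tensor_outside by blast
  moreover have "tensor_sum l g = \<zero>\<^bsub>M\<^esub>" using Cons by simp
  ultimately show ?case using tensor_sum_Cons[of "fst t" "snd t" l] by simp
qed simp

lemma tensor_sum_distinct_cosets:
  "\<lbrakk>l \<in> terms; distinct_cosets l; (g, x) \<in> set l\<rbrakk> \<Longrightarrow> tensor_sum l g = x"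
proof (induction l)
  case (Cons t l)
  obtain g' x' where t: "t = (g', x')" by (cases t)
  have l: "l \<in> terms" "g' \<in> carrier A" "x' \<in> carrier M" and dist: "distinct_cosets l"
    and new: "coset g' \<notin> set (map (coset \<circ> fst) l)"
    using Cons.prems(1,2) t by (auto simp: distinct_cosets_def)
  show ?case
  proof (cases "(g, x) \<in> set l")
    case True
    then have gx: "g \<in> carrier A" "x \<in> carrier M" "coset g \<in> set (map (coset \<circ> fst) l)"
      using l(1) by (force simp: terms_def)+
    then have "g' \<notin> coset g" using new coset_eq_iff[OF l(2) gx(1)] by metis
    then show ?thesis using Cons.IH[OF l(1) dist True] gx t by (simp add: tensor_outside)
  next
    case False
    then have "g = g'" "x = x'" using Cons.prems(3) t by auto
    then show ?thesis using tensor_sum_outside[OF l(1,2) new] l t by (simp add: tensor_self)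
  qed
qed simp

end

locale balanced_map = induced_module A H M emb act + N: comm_group N
  for A :: "'a monoid" and H :: "'h monoid" and M :: "('x, 'm) ring_scheme" and emb act
    and N :: "('n, 'k) monoid_scheme" +
  fixes \<phi> :: "'a \<Rightarrow> 'x \<Rightarrow> 'n"
  assumes map_closed [simp]: "\<lbrakk>g \<in> carrier A; x \<in> carrier M\<rbrakk> \<Longrightarrow> \<phi> g x \<in> carrier N"
    and map_add: "\<lbrakk>g \<in> carrier A; x \<in> carrier M; y \<in> carrier M\<rbrakk> \<Longrightarrow> \<phi> g (x \<oplus>\<^bsub>M\<^esub> y) = \<phi> g x \<otimes>\<^bsub>N\<^esub> \<phi> g y"
    and map_mult_emb: "\<lbrakk>g \<in> carrier A; h \<in> carrier H; x \<in> carrier M\<rbrakk> \<Longrightarrow> \<phi> (g \<otimes>\<^bsub>A\<^esub> emb h) x = \<phi> g (act h x)"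
begin

definition term_product :: "('a \<times> 'x) list \<Rightarrow> 'n" where
  "term_product l = foldr (\<lambda>(g, x) s. \<phi> g x \<otimes>\<^bsub>N\<^esub> s) l \<one>\<^bsub>N\<^esub>"

lemma term_product_Nil [simp]: "term_product [] = \<one>\<^bsub>N\<^esub>"
  and term_product_Cons [simp]: "term_product ((g, x) # l) = \<phi> g x \<otimes>\<^bsub>N\<^esub> term_product l"
  by (simp_all add: term_product_def)

lemma term_product_closed [simp]: "l \<in> terms \<Longrightarrow> term_product l \<in> carrier N"
  by (induction l) auto

lemma term_product_append:
  "\<lbrakk>l \<in> terms; k \<in> terms\<rbrakk> \<Longrightarrow> term_product (l @ k) = term_product l \<otimes>\<^bsub>N\<^esub> term_product k"
  by (induction l) (auto simp: N.m_assoc)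

lemma map_zero: "g \<in> carrier A \<Longrightarrow> \<phi> g \<zero>\<^bsub>M\<^esub> = \<one>\<^bsub>N\<^esub>"
  using map_add[of g "\<zero>\<^bsub>M\<^esub>" "\<zero>\<^bsub>M\<^esub>"] by (simp add: N.r_cancel_one)

lemma term_product_insert_term:
  assumes "g \<in> carrier A" "x \<in> carrier M" "l \<in> terms"
  shows "term_product (insert_term g x l) = \<phi> g x \<otimes>\<^bsub>N\<^esub> term_product l"
  using assms(3)
proof (induction l)
  case (Cons t l)
  obtain g' x' where t: "t = (g', x')" by (cases t)
  have l: "g' \<in> carrier A" "x' \<in> carrier M" "l \<in> terms" using Cons.prems t by auto
  show ?case using assms(1)
  proof (cases rule: tensor_cases[where g' = g'])
    case (inside h)
    then have "\<phi> g x = \<phi> g' (tensor g x g')" using assms(2) map_mult_emb by simp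
    moreover have "g \<in> coset g'" using inside by (auto simp: mem_coset_iff)
    ultimately show ?thesis
      using assms l by (simp add: t map_add N.m_assoc)
  next
    case outside
    then show ?thesis using Cons.IH l assms by (simp add: t N.m_lcomm)
  qed
qed simp

lemma term_product_collect_terms: "l \<in> terms \<Longrightarrow> term_product (collect_terms l) = term_product l"
  by (induction l)
    (auto simp: collect_terms_def collect_terms_terms[unfolded collect_terms_def] term_product_insert_term)

end

context induced_module
begin

lemma balanced_map_tensor: "balanced_map A H M emb act (add_monoid ind) tensor"
proof -
  interpret I: abelian_group ind by (rule abelian_group_ind)
  show ?thesis
    by (intro balanced_map.intro balanced_map_axioms.intro induced_module_axioms I.a_comm_group)
      (auto simp: tensor_add tensor_mult_emb)
qed

lemma tensor_sum_collect_terms: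
  assumes "l \<in> terms"
  shows "tensor_sum (collect_terms l) = tensor_sum l"
proof -
  interpret T: balanced_map A H M emb act "add_monoid ind" tensor by (rule balanced_map_tensor)
  have "T.term_product k = tensor_sum k" for k
    unfolding T.term_product_def by (induction k) auto
  then show ?thesis using T.term_product_collect_terms[OF assms] by (simp only:)
qed

lemma ind_distinctE:
  assumes "c \<in> carrier ind"
  obtains l where "l \<in> terms" "c = tensor_sum l" "\<And>g x. (g, x) \<in> set l \<Longrightarrow> c g = x"
proof -
  obtain l where l: "l \<in> terms" "c = tensor_sum l" using assms by (rule indE)
  have "c g = x" if "(g, x) \<in> set (collect_terms l)" for g x
    using tensor_sum_distinct_cosets[OF collect_terms_terms distinct_cosets_collect_terms that] l
    by (simp add: tensor_sum_collect_terms)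
  then show thesis using that[of "collect_terms l"] l collect_terms_terms tensor_sum_collect_terms by simp
qed

end

context balanced_map
begin

lemma term_product_eq_one:
  assumes "l \<in> terms" "tensor_sum l = (\<lambda>_. \<zero>\<^bsub>M\<^esub>)"
  shows "term_product l = \<one>\<^bsub>N\<^esub>"
proof -
  have zero: "x = \<zero>\<^bsub>M\<^esub>" if "(g, x) \<in> set (collect_terms l)" for g x
    using tensor_sum_distinct_cosets[OF collect_terms_terms distinct_cosets_collect_terms that] assms
    by (simp add: tensor_sum_collect_terms)
  have "term_product k = \<one>\<^bsub>N\<^esub>" if "k \<in> terms" "\<And>g x. (g, x) \<in> set k \<Longrightarrow> x = \<zero>\<^bsub>M\<^esub>" for k
    using that
  proof (induction k)
    case (Cons t k)
    obtain g x where t: "t = (g, x)" by (cases t)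
    then have "x = \<zero>\<^bsub>M\<^esub>" "g \<in> carrier A" "term_product k = \<one>\<^bsub>N\<^esub>" using Cons by auto
    then show ?case by (simp add: t map_zero)
  qed simp
  then have "term_product (collect_terms l) = \<one>\<^bsub>N\<^esub>" using zero collect_terms_terms assms(1) by blast
  then show ?thesis using term_product_collect_terms[OF assms(1)] by simp
qed

lemma term_product_cong:
  assumes l: "l \<in> terms" and k: "k \<in> terms" and eq: "tensor_sum l = tensor_sum k"
  shows "term_product l = term_product k"
proof -
  have "tensor_sum (negate k @ l) = (\<lambda>_. \<zero>\<^bsub>M\<^esub>)" "tensor_sum (negate k @ k) = (\<lambda>_. \<zero>\<^bsub>M\<^esub>)"
    using l k tensor_sum_negate[OF k] by (simp_all add: tensor_sum_append eq)
  then have "term_product (negate k @ l) = term_product (negate k @ k)"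
    using l k term_product_eq_one[of "negate k @ l"] term_product_eq_one[of "negate k @ k"] by simp
  then show ?thesis using l k by (simp add: term_product_append)
qed

definition extension :: "('a \<Rightarrow> 'x) \<Rightarrow> 'n" where
  "extension c = term_product (SOME l. l \<in> terms \<and> tensor_sum l = c)"

lemma extension_tensor_sum:
  assumes "l \<in> terms"
  shows "extension (tensor_sum l) = term_product l"
proof -
  define k where "k = (SOME k. k \<in> terms \<and> tensor_sum k = tensor_sum l)"
  have "k \<in> terms \<and> tensor_sum k = tensor_sum l"
    unfolding k_def by (rule someI[of "\<lambda>k. k \<in> terms \<and> tensor_sum k = tensor_sum l" l]) (simp add: assms)
  then have "term_product k = term_product l" using term_product_cong[of k l] assms by blast
  then show ?thesis by (simp add: extension_def k_def)
qed

lemma extension_hom: "extension \<in> hom (add_monoid ind) N"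
proof (rule homI)
  fix c d assume "c \<in> carrier (add_monoid ind)" "d \<in> carrier (add_monoid ind)"
  then obtain l k where "l \<in> terms" "c = tensor_sum l" "k \<in> terms" "d = tensor_sum k"
    by (auto elim!: indE)
  then show "extension (c \<otimes>\<^bsub>add_monoid ind\<^esub> d) = extension c \<otimes>\<^bsub>N\<^esub> extension d"
    using extension_tensor_sum[of "l @ k"] by (simp add: tensor_sum_append term_product_append extension_tensor_sum)
qed (auto elim!: indE simp: extension_tensor_sum)

lemma extension_tensor: "\<lbrakk>g \<in> carrier A; x \<in> carrier M\<rbrakk> \<Longrightarrow> extension (tensor g x) = \<phi> g x"
  using extension_tensor_sum[of "[(g, x)]"] by simp

end

locale induced_hom = X: induced_module A H M emb act + Y: induced_module A H M' emb act'
  for A :: "'a monoid" and H :: "'h monoid" and M :: "('x, 'm) ring_scheme" and emb act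
    and M' :: "('y, 'n) ring_scheme" and act' +
  fixes f :: "'x \<Rightarrow> 'y"
  assumes f_closed: "x \<in> carrier M \<Longrightarrow> f x \<in> carrier M'"
    and f_add: "\<lbrakk>x \<in> carrier M; y \<in> carrier M\<rbrakk> \<Longrightarrow> f (x \<oplus>\<^bsub>M\<^esub> y) = f x \<oplus>\<^bsub>M'\<^esub> f y"
    and f_act: "\<lbrakk>h \<in> carrier H; x \<in> carrier M\<rbrakk> \<Longrightarrow> f (act h x) = act' h (f x)"
begin

lemma f_zero: "f \<zero>\<^bsub>M\<^esub> = \<zero>\<^bsub>M'\<^esub>"
  using f_add[of "\<zero>\<^bsub>M\<^esub>" "\<zero>\<^bsub>M\<^esub>"] f_closed[of "\<zero>\<^bsub>M\<^esub>"] by simp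

lemma comp_tensor:
  assumes "g \<in> carrier A" "x \<in> carrier M"
  shows "f (X.tensor g x g') = Y.tensor g (f x) g'"
  using assms(1)
proof (cases rule: X.tensor_cases[where g' = g'])
  case (inside h)
  then show ?thesis using assms(2) Y.tensor_inside[of g' h] by (simp add: f_act)
next
  case outside
  then have "Y.tensor g (f x) g' = \<zero>\<^bsub>M'\<^esub>"
    using Y.tensor_outside Y.tensor_outside_carrier by (auto simp: X.coset_def Y.coset_def)
  then show ?thesis using outside by (simp add: f_zero)
qed

lemma comp_tensor_sum: "l \<in> X.terms \<Longrightarrow> (\<lambda>g'. f (X.tensor_sum l g')) = Y.tensor_sum (map (\<lambda>(g, x). (g, f x)) l)"
  by (induction l) (auto simp: f_zero f_add comp_tensor fun_eq_iff)

lemma map_terms: "l \<in> X.terms \<Longrightarrow> map (\<lambda>(g, x). (g, f x)) l \<in> Y.terms"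
  by (induction l) (auto simp: f_closed)

lemma comp_hom: "abelian_group_hom X.ind Y.ind (\<lambda>c g. f (c g))"
proof (rule abelian_group_homI_add[OF X.abelian_group_ind Y.abelian_group_ind])
  show "(\<lambda>g. f (c g)) \<in> carrier Y.ind" if "c \<in> carrier X.ind" for c
    using that comp_tensor_sum map_terms by (auto elim!: X.indE)
qed (simp add: f_add)

lemma comp_inj:
  assumes "inj_on f (carrier M)"
  shows "inj_on (\<lambda>c g. f (c g)) (carrier X.ind)"
  using assms by (auto simp: inj_on_def fun_eq_iff)

lemma comp_surj:
  assumes surj: "f ` carrier M = carrier M'"
  shows "(\<lambda>c g. f (c g)) ` carrier X.ind = carrier Y.ind"
proof -
  have lift: "\<exists>l\<in>X.terms. map (\<lambda>(g, x). (g, f x)) l = k" if "k \<in> Y.terms" for k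
    using that
  proof (induction k)
    case (Cons t k)
    obtain g y where t: "t = (g, y)" by (cases t)
    obtain l where "l \<in> X.terms" "map (\<lambda>(g, x). (g, f x)) l = k" using Cons by auto
    moreover have "y \<in> f ` carrier M" using surj Cons.prems t by simp
    then obtain x where "x \<in> carrier M" "f x = y" by blast
    ultimately show ?case using Cons.prems t by (intro bexI[of _ "(g, x) # l"]) auto
  qed (use X.terms_simps(1) in blast)
  then have "c \<in> (\<lambda>c g. f (c g)) ` carrier X.ind" if c: "c \<in> carrier Y.ind" for c
  proof -
    obtain k where "k \<in> Y.terms" "c = Y.tensor_sum k" using c by (rule Y.indE)
    then obtain l where "l \<in> X.terms" "c = (\<lambda>g. f (X.tensor_sum l g))" using lift comp_tensor_sum by metis
    then show ?thesis by (intro image_eqI[where x = "X.tensor_sum l"]) simp_all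
  qed
  then show ?thesis using abelian_group_hom.hom_closed[OF comp_hom] by blast
qed

lemma kernel_terms:
  assumes "c \<in> carrier X.ind" "\<And>g. f (c g) = \<zero>\<^bsub>M'\<^esub>"
  obtains l where "l \<in> X.terms" "c = X.tensor_sum l" "\<And>g x. (g, x) \<in> set l \<Longrightarrow> f x = \<zero>\<^bsub>M'\<^esub>"
  using X.ind_distinctE[OF assms(1)] assms(2) by metis

end

locale induced_hom_pair = I: induced_hom A H K emb actK P actP \<kappa> + E: induced_hom A H P emb actP V actV \<epsilon>
  for A :: "'a monoid" and H :: "'h monoid" and K :: "('x, 'k) ring_scheme" and emb actK
    and P :: "('y, 'p) ring_scheme" and actP and V :: "('z, 'v) ring_scheme" and actV \<kappa> \<epsilon>
begin

lemma comp_exact: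
  assumes kernel: "\<kappa> ` carrier K = {x \<in> carrier P. \<epsilon> x = \<zero>\<^bsub>V\<^esub>}"
  shows "(\<lambda>c g. \<kappa> (c g)) ` carrier I.X.ind = {c \<in> carrier I.Y.ind. (\<lambda>g. \<epsilon> (c g)) = \<zero>\<^bsub>E.Y.ind\<^esub>}"
proof (intro equalityI subsetI)
  fix c assume c: "c \<in> {c \<in> carrier I.Y.ind. (\<lambda>g. \<epsilon> (c g)) = \<zero>\<^bsub>E.Y.ind\<^esub>}"
  then obtain l where l: "l \<in> I.Y.terms" "c = I.Y.tensor_sum l" "\<And>g x. (g, x) \<in> set l \<Longrightarrow> \<epsilon> x = \<zero>\<^bsub>V\<^esub>"
    using E.kernel_terms[of c] by (auto simp: fun_eq_iff)
  have "\<exists>k\<in>I.X.terms. map (\<lambda>(g, x). (g, \<kappa> x)) k = l" using l(1,3)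
  proof (induction l)
    case (Cons t l)
    obtain g x where t: "t = (g, x)" by (cases t)
    obtain k where "k \<in> I.X.terms" "map (\<lambda>(g, x). (g, \<kappa> x)) k = l" using Cons by auto
    moreover have "x \<in> \<kappa> ` carrier K" using kernel Cons.prems t by auto
    then obtain y where "y \<in> carrier K" "\<kappa> y = x" by blast
    ultimately show ?case using Cons.prems t by (intro bexI[of _ "(g, y) # k"]) auto
  qed (use I.X.terms_simps(1) in blast)
  then obtain k where "k \<in> I.X.terms" "c = (\<lambda>g. \<kappa> (I.X.tensor_sum k g))"
    using l(2) I.comp_tensor_sum by metis
  then show "c \<in> (\<lambda>c g. \<kappa> (c g)) ` carrier I.X.ind"
    by (intro image_eqI[where x = "I.X.tensor_sum k"]) simp_all
next
  fix c assume "c \<in> (\<lambda>c g. \<kappa> (c g)) ` carrier I.X.ind"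
  then obtain w where w: "w \<in> carrier I.X.ind" "c = (\<lambda>g. \<kappa> (w g))" by blast
  have "\<epsilon> (\<kappa> x) = \<zero>\<^bsub>V\<^esub>" if "x \<in> carrier K" for x using kernel that by blast
  then show "c \<in> {c \<in> carrier I.Y.ind. (\<lambda>g. \<epsilon> (c g)) = \<zero>\<^bsub>E.Y.ind\<^esub>}"
    using w abelian_group_hom.hom_closed[OF I.comp_hom] by auto
qed

end

section \<open>Finitely supported functions\<close>

definition finsupp :: "'r ring \<Rightarrow> 'k set \<Rightarrow> ('r, 'k \<Rightarrow> 'r) module" where
  "finsupp R S = \<lparr>carrier = {c. (\<forall>k. c k \<in> carrier R) \<and> finite {k. c k \<noteq> \<zero>\<^bsub>R\<^esub>} \<and> {k. c k \<noteq> \<zero>\<^bsub>R\<^esub>} \<subseteq> S},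
     monoid.mult = (\<lambda>c d. undefined), one = undefined, ring.zero = (\<lambda>k. \<zero>\<^bsub>R\<^esub>),
     add = (\<lambda>c d k. c k \<oplus>\<^bsub>R\<^esub> d k), smult = (\<lambda>r c k. r \<otimes>\<^bsub>R\<^esub> c k)\<rparr>"

locale coefficient_ring = cring R for R :: "'r ring" (structure)
begin

definition support :: "('k \<Rightarrow> 'r) \<Rightarrow> 'k set" where
  "support c = {k. c k \<noteq> \<zero>}"

definition single :: "'k \<Rightarrow> 'r \<Rightarrow> 'k \<Rightarrow> 'r" where
  "single k r = (\<lambda>k'. if k' = k then r else \<zero>)"

lemma finsupp_simps [simp]: "\<zero>\<^bsub>finsupp R S\<^esub> = (\<lambda>k. \<zero>)" "c \<oplus>\<^bsub>finsupp R S\<^esub> d = (\<lambda>k. c k \<oplus> d k)"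
    "r \<odot>\<^bsub>finsupp R S\<^esub> c = (\<lambda>k. r \<otimes> c k)"
  by (simp_all add: finsupp_def)

lemma finsupp_carrier_iff:
  "c \<in> carrier (finsupp R S) \<longleftrightarrow> (\<forall>k. c k \<in> carrier R) \<and> finite (support c) \<and> support c \<subseteq> S"
  by (simp add: finsupp_def support_def)

lemma finsupp_value_closed [simp]: "c \<in> carrier (finsupp R S) \<Longrightarrow> c k \<in> carrier R"
  by (simp add: finsupp_carrier_iff)

lemma finsupp_carrierI:
  assumes "\<And>k. c k \<in> carrier R" "finite T" "support c \<subseteq> T" "T \<subseteq> S"
  shows "c \<in> carrier (finsupp R S)"
  using assms finite_subset by (auto simp: finsupp_carrier_iff)

lemma module_finsupp: "module R (finsupp R S)"
proof (rule moduleI)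
  show "abelian_group (finsupp R S)"
  proof (rule abelian_groupI)
    fix c d assume "c \<in> carrier (finsupp R S)" "d \<in> carrier (finsupp R S)"
    then show "c \<oplus>\<^bsub>finsupp R S\<^esub> d \<in> carrier (finsupp R S)"
      by (intro finsupp_carrierI[where T = "support c \<union> support d"]) (auto simp: finsupp_carrier_iff support_def)
  next
    fix c assume "c \<in> carrier (finsupp R S)"
    then have "(\<lambda>k. \<ominus> c k) \<in> carrier (finsupp R S)" "(\<lambda>k. \<ominus> c k) \<oplus>\<^bsub>finsupp R S\<^esub> c = \<zero>\<^bsub>finsupp R S\<^esub>"
      by (auto simp: finsupp_carrier_iff support_def l_neg intro!: finsupp_carrierI[where T = "support c"])
    then show "\<exists>d\<in>carrier (finsupp R S). d \<oplus>\<^bsub>finsupp R S\<^esub> c = \<zero>\<^bsub>finsupp R S\<^esub>" by blast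
  qed (auto simp: finsupp_carrier_iff support_def a_ac)
next
  fix r c assume "r \<in> carrier R" "c \<in> carrier (finsupp R S)"
  then show "r \<odot>\<^bsub>finsupp R S\<^esub> c \<in> carrier (finsupp R S)"
    by (intro finsupp_carrierI[where T = "support c"]) (auto simp: finsupp_carrier_iff support_def)
qed (auto simp: l_distr r_distr m_assoc is_cring)

lemma abelian_finsupp: "abelian_group (finsupp R S)"
  using module_finsupp by (rule module.axioms(2))

lemma single_closed [simp]: "\<lbrakk>k \<in> S; r \<in> carrier R\<rbrakk> \<Longrightarrow> single k r \<in> carrier (finsupp R S)"
  by (rule finsupp_carrierI[where T = "{k}"]) (auto simp: single_def support_def)

lemma single_add:
  "\<lbrakk>r \<in> carrier R; r' \<in> carrier R\<rbrakk> \<Longrightarrow> single k (r \<oplus> r') = single k r \<oplus>\<^bsub>finsupp R S\<^esub> single k r'"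
  by (auto simp: single_def)

lemma single_hom: "k \<in> S \<Longrightarrow> abelian_group_hom R (finsupp R S) (single k)"
  by (rule abelian_group_homI_add)
    (simp_all add: abelian_finsupp abelian_group_axioms single_add[of _ _ k S] del: finsupp_simps)

lemma smult_single: "a \<in> carrier R \<Longrightarrow> a \<odot>\<^bsub>finsupp R S\<^esub> single k r = single k (a \<otimes> r)"
  by (auto simp: single_def)

lemma finsupp_induct [consumes 1, case_names zero add]:
  assumes "c \<in> carrier (finsupp R S)" and zero: "P \<zero>\<^bsub>finsupp R S\<^esub>"
    and add: "\<And>k r c. \<lbrakk>k \<in> S; r \<in> carrier R; c \<in> carrier (finsupp R S); P c\<rbrakk> \<Longrightarrow> P (single k r \<oplus>\<^bsub>finsupp R S\<^esub> c)"
  shows "P c"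
proof -
  have "finite (support c)" using assms(1) by (simp add: finsupp_carrier_iff)
  then show ?thesis using assms(1)
  proof (induction "support c" arbitrary: c rule: finite_induct)
    case empty
    then have "c = \<zero>\<^bsub>finsupp R S\<^esub>" by (auto simp: support_def)
    then show ?case using zero by simp
  next
    case (insert k T)
    let ?c = "\<lambda>k'. if k' = k then \<zero> else c k'"
    have T: "T = support ?c" using insert.hyps(2,4) by (auto simp: support_def)
    have k: "k \<in> S" using insert.hyps(4) insert.prems by (auto simp: finsupp_carrier_iff)
    have c: "?c \<in> carrier (finsupp R S)"
      using insert.prems by (intro finsupp_carrierI[where T = "support c"]) (auto simp: finsupp_carrier_iff support_def)
    have "c = single k (c k) \<oplus>\<^bsub>finsupp R S\<^esub> ?c"
      using finsupp_value_closed[OF insert.prems] by (auto simp: single_def fun_eq_iff)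
    moreover have "P (single k (c k) \<oplus>\<^bsub>finsupp R S\<^esub> ?c)"
      by (rule add[OF k finsupp_value_closed[OF insert.prems] c insert.hyps(3)[OF T c]])
    ultimately show ?case by metis
  qed
qed

lemma finsupp_hom_eqI:
  assumes hom: "abelian_group_hom (finsupp R S) N f" "abelian_group_hom (finsupp R S) N f'"
    and single: "\<And>k r. \<lbrakk>k \<in> S; r \<in> carrier R\<rbrakk> \<Longrightarrow> f (single k r) = f' (single k r)"
    and "c \<in> carrier (finsupp R S)"
  shows "f c = f' c"
  using assms(4)
proof (induction rule: finsupp_induct)
  case zero
  show ?case using abelian_group_hom.hom_zero[OF hom(1)] abelian_group_hom.hom_zero[OF hom(2)] by (simp only:)
next
  case (add k r c)
  then show ?case
    using abelian_group_hom.hom_add[OF hom(1), of "single k r" c]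
      abelian_group_hom.hom_add[OF hom(2), of "single k r" c] single
    by (simp del: finsupp_simps)
qed

lemma finsupp_value_hom: "abelian_group_hom (finsupp R S) R (\<lambda>c. c k)"
  by (rule abelian_group_homI_add) (simp_all add: abelian_finsupp abelian_group_axioms)

end

locale finsupp_extension = coefficient_ring R + N: abelian_group N
  for R :: "'r ring" (structure) and N :: "('y, 'n) ring_scheme" +
  fixes S :: "'k set" and f :: "'k \<Rightarrow> 'r \<Rightarrow> 'y"
  assumes coeff_closed [simp]: "\<lbrakk>k \<in> S; r \<in> carrier R\<rbrakk> \<Longrightarrow> f k r \<in> carrier N"
    and coeff_add: "\<lbrakk>k \<in> S; r \<in> carrier R; r' \<in> carrier R\<rbrakk> \<Longrightarrow> f k (r \<oplus> r') = f k r \<oplus>\<^bsub>N\<^esub> f k r'"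
begin

definition extend :: "('k \<Rightarrow> 'r) \<Rightarrow> 'y" where
  "extend c = (\<Oplus>\<^bsub>N\<^esub>k\<in>support c. f k (c k))"

lemma coeff_zero: "k \<in> S \<Longrightarrow> f k \<zero> = \<zero>\<^bsub>N\<^esub>"
  using coeff_add[of k \<zero> \<zero>] coeff_closed[of k \<zero>] by simp

lemma extend_superset:
  assumes "c \<in> carrier (finsupp R S)" "finite T" "support c \<subseteq> T" "T \<subseteq> S"
  shows "extend c = (\<Oplus>\<^bsub>N\<^esub>k\<in>T. f k (c k))"
  unfolding extend_def
proof (rule N.add.finprod_mono_neutral_cong_left)
  fix k assume "k \<in> T - support c"
  then show "f k (c k) = \<zero>\<^bsub>N\<^esub>" using assms(4) coeff_zero by (auto simp: support_def)
qed (use assms in \<open>auto simp: finsupp_carrier_iff\<close>)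

lemma extend_single:
  assumes "k \<in> S" "r \<in> carrier R"
  shows "extend (single k r) = f k r"
proof -
  have "extend (single k r) = (\<Oplus>\<^bsub>N\<^esub>k'\<in>{k}. f k' (single k r k'))"
    by (rule extend_superset[OF single_closed[OF assms]]) (use assms in \<open>auto simp: support_def single_def\<close>)
  then show ?thesis using assms by (simp add: single_def)
qed

lemma extend_hom: "abelian_group_hom (finsupp R S) N extend"
proof (rule abelian_group_homI)
  show "group_hom (add_monoid (finsupp R S)) (add_monoid N) extend"
  proof (intro group_hom.intro group_hom_axioms.intro homI abelian_group.a_group abelian_finsupp N.abelian_group_axioms)
    fix c assume "c \<in> carrier (add_monoid (finsupp R S))"
    then show "extend c \<in> carrier (add_monoid N)"
      by (auto simp: extend_def finsupp_carrier_iff intro!: N.finsum_closed)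
  next
    fix c d assume "c \<in> carrier (add_monoid (finsupp R S))" "d \<in> carrier (add_monoid (finsupp R S))"
    then have c: "c \<in> carrier (finsupp R S)" and d: "d \<in> carrier (finsupp R S)" by simp_all
    let ?T = "support c \<union> support d"
    have T: "finite ?T" "?T \<subseteq> S" using c d by (auto simp: finsupp_carrier_iff)
    have cd: "c \<oplus>\<^bsub>finsupp R S\<^esub> d \<in> carrier (finsupp R S)" using c d by (rule abelian_groupE(1)[OF abelian_finsupp])
    have supp: "support (c \<oplus>\<^bsub>finsupp R S\<^esub> d) \<subseteq> ?T" by (auto simp: support_def)
    have "extend (c \<oplus>\<^bsub>finsupp R S\<^esub> d) = (\<Oplus>\<^bsub>N\<^esub>k\<in>?T. f k (c k \<oplus> d k))"
      using extend_superset[OF cd T(1) supp T(2)] by simp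
    also have "\<dots> = (\<Oplus>\<^bsub>N\<^esub>k\<in>?T. f k (c k) \<oplus>\<^bsub>N\<^esub> f k (d k))"
      using c d T(2) by (intro N.finsum_cong') (auto simp: coeff_add subset_iff)
    also have "\<dots> = (\<Oplus>\<^bsub>N\<^esub>k\<in>?T. f k (c k)) \<oplus>\<^bsub>N\<^esub> (\<Oplus>\<^bsub>N\<^esub>k\<in>?T. f k (d k))"
      using c d T(2) by (intro N.finsum_addf) (auto simp: subset_iff)
    also have "\<dots> = extend c \<oplus>\<^bsub>N\<^esub> extend d"
      using extend_superset[OF c T(1) _ T(2)] extend_superset[OF d T(1) _ T(2)] by simp
    finally show "extend (c \<otimes>\<^bsub>add_monoid (finsupp R S)\<^esub> d) = extend c \<otimes>\<^bsub>add_monoid N\<^esub> extend d" by simp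
  qed
qed (simp_all add: abelian_finsupp N.abelian_group_axioms)

lemmas extend_closed = abelian_group_hom.hom_closed[OF extend_hom]
  and extend_add = abelian_group_hom.hom_add[OF extend_hom]
  and extend_zero = abelian_group_hom.hom_zero[OF extend_hom]

lemma extend_smult:
  assumes "abelian_group_hom N N t" "a \<in> carrier R" "c \<in> carrier (finsupp R S)"
    and "\<And>k r. \<lbrakk>k \<in> S; r \<in> carrier R\<rbrakk> \<Longrightarrow> f k (a \<otimes> r) = t (f k r)"
  shows "extend (a \<odot>\<^bsub>finsupp R S\<^esub> c) = t (extend c)"
proof (rule finsupp_hom_eqI[OF _ _ _ assms(3)])
  show "abelian_group_hom (finsupp R S) N (\<lambda>c. extend (a \<odot>\<^bsub>finsupp R S\<^esub> c))"
    by (rule abelian_group_hom_compose[OF module.smult_hom[OF module_finsupp assms(2)] extend_hom])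
  show "abelian_group_hom (finsupp R S) N (\<lambda>c. t (extend c))"
    by (rule abelian_group_hom_compose[OF extend_hom assms(1)])
  fix k r assume "k \<in> S" "r \<in> carrier R"
  then show "extend (a \<odot>\<^bsub>finsupp R S\<^esub> single k r) = t (extend (single k r))"
    unfolding smult_single[OF assms(2)] using assms(2,4) by (simp add: extend_single)
qed

end

context coefficient_ring
begin

definition pushforward :: "('k \<Rightarrow> 'l) \<Rightarrow> ('k \<Rightarrow> 'r) \<Rightarrow> 'l \<Rightarrow> 'r" where
  "pushforward u c l = (\<Oplus>k\<in>{k \<in> support c. u k = l}. c k)"

context
  fixes u :: "'k \<Rightarrow> 'l" and S :: "'k set" and T :: "'l set"
  assumes u: "\<And>k. k \<in> S \<Longrightarrow> u k \<in> T"
begin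

interpretation finsupp_extension R "finsupp R T" S "\<lambda>k. single (u k)"
  by (intro finsupp_extension.intro finsupp_extension_axioms.intro coefficient_ring_axioms abelian_finsupp)
    (simp_all add: u single_add[of _ _ _ T] del: finsupp_simps)

lemma extend_eq_pushforward:
  assumes c: "c \<in> carrier (finsupp R S)"
  shows "extend c = pushforward u c"
proof
  fix l
  interpret V: abelian_group_hom "finsupp R T" R "\<lambda>c. c l" by (rule finsupp_value_hom)
  have supp: "finite (support c)" "support c \<subseteq> S" using c by (simp_all add: finsupp_carrier_iff)
  have value_closed: "c k \<in> carrier R" for k using c by simp
  have "extend c l = (\<Oplus>k\<in>support c. single (u k) (c k) l)"
    unfolding extend_def using supp(2) u value_closed by (intro V.hom_finsum) auto
  also have "\<dots> = pushforward u c l"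
    unfolding pushforward_def
    by (rule add.finprod_mono_neutral_cong_right) (use supp value_closed in \<open>auto simp: single_def\<close>)
  finally show "extend c l = pushforward u c l" .
qed

lemma pushforward_hom: "abelian_group_hom (finsupp R S) (finsupp R T) (pushforward u)"
  by (rule abelian_group_hom_cong[OF extend_hom extend_eq_pushforward[symmetric]])

lemma pushforward_single: "\<lbrakk>k \<in> S; r \<in> carrier R\<rbrakk> \<Longrightarrow> pushforward u (single k r) = single (u k) r"
  using extend_single[of k r] extend_eq_pushforward[of "single k r"] by simp

lemma pushforward_smult:
  assumes "a \<in> carrier R" "c \<in> carrier (finsupp R S)"
  shows "pushforward u (a \<odot>\<^bsub>finsupp R S\<^esub> c) = a \<odot>\<^bsub>finsupp R T\<^esub> pushforward u c"
proof -
  interpret F: module R "finsupp R S" by (rule module_finsupp)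
  have "extend (a \<odot>\<^bsub>finsupp R S\<^esub> c) = a \<odot>\<^bsub>finsupp R T\<^esub> extend c"
    using assms(1) by (intro extend_smult module.smult_hom[OF module_finsupp] assms smult_single[symmetric])
  then show ?thesis
    using extend_eq_pushforward[OF assms(2)] extend_eq_pushforward[OF F.smult_closed[OF assms]] by (simp only:)
qed

end

end

section \<open>Formal linear combinations\<close>

lemma valid_simps [simp]:
  "valid R S []" "valid R S ((r, k) # L) \<longleftrightarrow> r \<in> carrier R \<and> k \<in> S \<and> valid R S L"
  "valid R S (L @ L') \<longleftrightarrow> valid R S L \<and> valid R S L'"
  by (auto simp: valid_def)

context coefficient_ring
begin

lemma fs_Nil [simp]: "fs R [] = (\<lambda>k. \<zero>)"
  by (simp add: fs_def)

lemma fs_closed [simp]: "valid R S L \<Longrightarrow> fs R L \<in> carrier (finsupp R S)"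
  and fs_Cons: "valid R S ((r, k) # L) \<Longrightarrow> fs R ((r, k) # L) = single k r \<oplus>\<^bsub>finsupp R S\<^esub> fs R L"
proof -
  have Cons_eq: "fs R ((r, k) # L) = single k r \<oplus>\<^bsub>finsupp R S\<^esub> fs R L"
    if "r \<in> carrier R" "fs R L \<in> carrier (finsupp R S)" for r k L
    using that finsupp_value_closed[OF that(2)] by (auto simp: fs_def single_def fun_eq_iff)
  have closed: "fs R L \<in> carrier (finsupp R S)" if "valid R S L" for L
    using that
  proof (induction L)
    case Nil
    show ?case using abelian_groupE(2)[OF abelian_finsupp, of S] by simp
  next
    case (Cons t L)
    then show ?case
      using Cons_eq[of "fst t" L "snd t"] abelian_groupE(1)[OF abelian_finsupp, of "single (snd t) (fst t)" S "fs R L"]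
      by (cases t) auto
  qed
  show "valid R S L \<Longrightarrow> fs R L \<in> carrier (finsupp R S)" by (rule closed)
  show "valid R S ((r, k) # L) \<Longrightarrow> fs R ((r, k) # L) = single k r \<oplus>\<^bsub>finsupp R S\<^esub> fs R L"
    using Cons_eq closed by simp
qed

lemma fs_singleton: "\<lbrakk>k \<in> S; r \<in> carrier R\<rbrakk> \<Longrightarrow> fs R [(r, k)] = single k r"
  by (auto simp: fs_Cons[of UNIV] single_def fun_eq_iff)

lemma fs_append:
  assumes "valid R S L" "valid R S L'"
  shows "fs R (L @ L') = fs R L \<oplus>\<^bsub>finsupp R S\<^esub> fs R L'"
  using assms(1)
proof (induction L)
  case Nil
  then show ?case
    using abelian_monoid.l_zero[OF abelian_group.axioms(1)[OF abelian_finsupp] fs_closed[OF assms(2)]] by simp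
next
  case (Cons t L)
  then show ?case
    using assms(2) finsupp_value_closed[OF fs_closed[of S L]] finsupp_value_closed[OF fs_closed[OF assms(2)]]
    by (cases t) (auto simp: fs_Cons[of S] single_def a_assoc)
qed

definition scale :: "'r \<Rightarrow> ('r \<times> 'k) list \<Rightarrow> ('r \<times> 'k) list" where
  "scale r = map (\<lambda>(a, k). (r \<otimes> a, k))"

lemma valid_scale [simp]: "\<lbrakk>valid R S L; r \<in> carrier R\<rbrakk> \<Longrightarrow> valid R S (scale r L)"
  by (induction L) (auto simp: scale_def)

lemma fs_scale:
  assumes "valid R S L" "r \<in> carrier R"
  shows "fs R (scale r L) = r \<odot>\<^bsub>finsupp R S\<^esub> fs R L"
  using assms(1)
proof (induction L)
  case (Cons t L)
  then show ?case
    using assms(2) finsupp_value_closed[OF fs_closed[of S L]] fs_Cons[of S "r \<otimes> fst t" "snd t" "scale r L"]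
      valid_scale[of S L r]
    by (cases t) (auto simp: scale_def fs_Cons[of S] single_def r_distr)
qed (use assms(2) in \<open>simp add: scale_def\<close>)

definition combination :: "('r \<times> ('r \<times> 'k) list) list \<Rightarrow> ('r \<times> 'k) list" where
  "combination ts = concat (map (\<lambda>(r, s). scale r s) ts)"

definition span :: "('r \<times> 'k) list set \<Rightarrow> ('k \<Rightarrow> 'r) set" where
  "span T = {fs R (combination ts) | ts. valid R T ts}"

lemma in_span_iff: "in_span R T L \<longleftrightarrow> fs R L \<in> span T"
proof -
  have "in_span R T L \<longleftrightarrow> (\<exists>ts. valid R T ts \<and> fs R L = fs R (combination ts))"
    by (simp add: in_span_def valid_def combination_def scale_def)
  then show ?thesis by (auto simp: span_def)
qed

lemma spanE:
  assumes "c \<in> span T"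
  obtains ts where "valid R T ts" "c = fs R (combination ts)"
  using assms by (auto simp: span_def)

lemma combination_in_span: "valid R T ts \<Longrightarrow> fs R (combination ts) \<in> span T"
  by (auto simp: span_def)

context
  fixes S :: "'k set" and T :: "('r \<times> 'k) list set"
  assumes valid_generators: "\<forall>s\<in>T. valid R S s"
begin

lemmas generators_valid = bspec[OF valid_generators]

lemma valid_combination: "valid R T ts \<Longrightarrow> valid R S (combination ts)"
  by (induction ts) (auto simp: combination_def generators_valid)

lemma span_induct [consumes 1, case_names zero add]:
  assumes "c \<in> span T" and zero: "P \<zero>\<^bsub>finsupp R S\<^esub>"
    and add: "\<And>r s c. \<lbrakk>r \<in> carrier R; s \<in> T; c \<in> span T; P c\<rbrakk>
      \<Longrightarrow> P (r \<odot>\<^bsub>finsupp R S\<^esub> fs R s \<oplus>\<^bsub>finsupp R S\<^esub> c)"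
  shows "P c"
proof -
  obtain ts where "valid R T ts" "c = fs R (combination ts)" using assms(1) by (rule spanE)
  moreover have "P (fs R (combination ts))" if "valid R T ts" for ts
    using that
  proof (induction ts)
    case (Cons t ts)
    obtain r s where t: "t = (r, s)" by (cases t)
    have rs: "r \<in> carrier R" "s \<in> T" "valid R T ts" using Cons.prems t by auto
    have "combination (t # ts) = scale r s @ combination ts" by (simp add: combination_def t)
    then have "fs R (combination (t # ts)) = r \<odot>\<^bsub>finsupp R S\<^esub> fs R s \<oplus>\<^bsub>finsupp R S\<^esub> fs R (combination ts)"
      using fs_append[of S "scale r s" "combination ts"] fs_scale[OF generators_valid[OF rs(2)] rs(1)]
        valid_combination[OF rs(3)] rs generators_valid by simp
    then show ?case using add[OF rs(1,2) combination_in_span[OF rs(3)] Cons.IH[OF rs(3)]] by (simp only:)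
  qed (use zero in \<open>simp add: combination_def\<close>)
  ultimately show ?thesis by simp
qed

lemma span_closed: "c \<in> span T \<Longrightarrow> c \<in> carrier (finsupp R S)"
  by (auto elim!: spanE intro!: fs_closed valid_combination)

lemma generator_in_span:
  assumes "s \<in> T"
  shows "fs R s \<in> span T"
proof -
  have "fs R (scale \<one> s) = fs R s"
    using finsupp_value_closed[OF fs_closed[OF generators_valid[OF assms]]]
    by (simp add: fs_scale[OF generators_valid[OF assms]])
  then show ?thesis using combination_in_span[of T "[(\<one>, s)]"] assms by (simp add: combination_def)
qed

lemma span_add:
  assumes "c \<in> span T" "d \<in> span T"
  shows "c \<oplus>\<^bsub>finsupp R S\<^esub> d \<in> span T"
proof -
  obtain ts us where "valid R T ts" "c = fs R (combination ts)" "valid R T us" "d = fs R (combination us)"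
    using assms by (elim spanE)
  then show ?thesis
    using combination_in_span[of T "ts @ us"] fs_append[OF valid_combination valid_combination]
    by (simp add: combination_def)
qed

lemma span_neg:
  assumes "c \<in> span T"
  shows "\<ominus>\<^bsub>finsupp R S\<^esub> c \<in> span T"
  using assms
proof (induction rule: span_induct)
  interpret F: module R "finsupp R S" by (rule module_finsupp)
  {
    case zero
    have "\<ominus>\<^bsub>finsupp R S\<^esub> \<zero>\<^bsub>finsupp R S\<^esub> = \<zero>\<^bsub>finsupp R S\<^esub>"
      by (rule F.M.minus_equality) (simp_all del: finsupp_simps)
    then show ?case using combination_in_span[of T "[]"] by (simp add: combination_def)
  next
    case (add r s c)
    have s: "fs R s \<in> carrier (finsupp R S)" using generators_valid[OF add(2)] by (rule fs_closed)
    have "\<ominus> r \<odot>\<^bsub>finsupp R S\<^esub> fs R s \<in> span T"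
      using combination_in_span[of T "[(\<ominus> r, s)]"] add(1,2) fs_scale[OF generators_valid[OF add(2)], of "\<ominus> r"]
      by (simp add: combination_def)
    then show ?case
      using span_add[OF _ add(4)] add(1) s span_closed[OF add(3)]
      by (simp add: F.M.minus_add F.smult_l_minus del: finsupp_simps)
  }
qed

lemma abelian_subgroup_span: "abelian_subgroup (span T) (finsupp R S)"
proof (rule abelian_subgroupI3)
  interpret F: abelian_group "finsupp R S" by (rule abelian_finsupp)
  show "additive_subgroup (span T) (finsupp R S)"
  proof (intro additive_subgroup.intro F.add.subgroupI)
    show "span T \<noteq> {}" using combination_in_span[of T "[]"] by auto
  qed (use span_closed span_add span_neg in auto)
qed (rule abelian_finsupp)

end

end

section \<open>Braided stability groupoids\<close>

locale braided_stability_groupoid =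
  fixes G :: "nat \<Rightarrow> 'g monoid" and os :: "nat \<Rightarrow> nat \<Rightarrow> 'g \<Rightarrow> 'g \<Rightarrow> 'g" and b :: "nat \<Rightarrow> nat \<Rightarrow> 'g"
  assumes stability: "stability_groupoid G os" and braiding: "braiding G os b"
begin

abbreviation e :: "nat \<Rightarrow> 'g" where "e n \<equiv> \<one>\<^bsub>G n\<^esub>"

lemma group_G [simp]: "group (G n)"
  using stability by (simp add: stability_groupoid_def)

lemma monoid_G [simp]: "monoid (G n)"
  by (simp add: group.is_monoid)

lemmas group_simps [simp] =
  monoid.m_closed[OF monoid_G] monoid.l_one[OF monoid_G] monoid.r_one[OF monoid_G] monoid.one_closed[OF monoid_G]
  group.inv_closed[OF group_G] group.l_inv[OF group_G] group.r_inv[OF group_G] monoid.inv_one[OF monoid_G]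

lemmas m_assoc = monoid.m_assoc[OF monoid_G]

lemma mult_cancel_inv [simp]:
  "\<lbrakk>x \<in> carrier (G n); y \<in> carrier (G n)\<rbrakk> \<Longrightarrow> inv\<^bsub>G n\<^esub> x \<otimes>\<^bsub>G n\<^esub> (x \<otimes>\<^bsub>G n\<^esub> y) = y"
  "\<lbrakk>x \<in> carrier (G n); y \<in> carrier (G n)\<rbrakk> \<Longrightarrow> x \<otimes>\<^bsub>G n\<^esub> (inv\<^bsub>G n\<^esub> x \<otimes>\<^bsub>G n\<^esub> y) = y"
  by (simp_all add: m_assoc[symmetric])

lemma os_closed [simp]:
  "\<lbrakk>f \<in> carrier (G m); g \<in> carrier (G n); N = m + n\<rbrakk> \<Longrightarrow> os m n f g \<in> carrier (G N)"
  using stability by (simp add: stability_groupoid_def)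

lemma os_mult:
  "\<lbrakk>f \<in> carrier (G m); g \<in> carrier (G n); f' \<in> carrier (G m); g' \<in> carrier (G n); N = m + n\<rbrakk>
    \<Longrightarrow> os m n f g \<otimes>\<^bsub>G N\<^esub> os m n f' g' = os m n (f \<otimes>\<^bsub>G m\<^esub> f') (g \<otimes>\<^bsub>G n\<^esub> g')"
  using stability by (simp add: stability_groupoid_def)

lemma os_one: "os m n (e m) (e n) = e (m + n)"
  using stability by (simp add: stability_groupoid_def)

lemma os_assoc:
  "\<lbrakk>f \<in> carrier (G l); g \<in> carrier (G m); h \<in> carrier (G n); p = l + m\<rbrakk>
    \<Longrightarrow> os p n (os l m f g) h = os l (m + n) f (os m n g h)"
  using stability by (simp add: stability_groupoid_def)

lemma os_unit [simp]:
  "g \<in> carrier (G n) \<Longrightarrow> os 0 n (e 0) g = g"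
  "g \<in> carrier (G n) \<Longrightarrow> os n 0 g (e 0) = g"
  using stability by (simp_all add: stability_groupoid_def)

lemma os_inj:
  "\<lbrakk>f \<in> carrier (G m); g \<in> carrier (G n); f' \<in> carrier (G m); g' \<in> carrier (G n); os m n f g = os m n f' g'\<rbrakk>
    \<Longrightarrow> f = f' \<and> g = g'"
  using stability[unfolded stability_groupoid_def] by (elim conjE) metis

lemma carrier_G0: "carrier (G 0) = {e 0}"
  using stability unfolding stability_groupoid_def by (elim conjE) assumption

definition pad :: "nat \<Rightarrow> nat \<Rightarrow> nat \<Rightarrow> 'g \<Rightarrow> 'g" where
  "pad l m r g = os l (m + r) (e l) (os m r g (e r))"

lemma pad_closed [simp]: "\<lbrakk>g \<in> carrier (G m); N = l + m + r\<rbrakk> \<Longrightarrow> pad l m r g \<in> carrier (G N)"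
  by (simp add: pad_def)

lemma pad_mult:
  "\<lbrakk>f \<in> carrier (G m); g \<in> carrier (G m); N = l + m + r\<rbrakk>
    \<Longrightarrow> pad l m r f \<otimes>\<^bsub>G N\<^esub> pad l m r g = pad l m r (f \<otimes>\<^bsub>G m\<^esub> g)"
  by (simp add: pad_def os_mult)

lemma pad_one: "N = l + m + r \<Longrightarrow> pad l m r (e m) = e N"
  by (simp add: pad_def os_one add.assoc)

lemma pad_hom: "N = l + m + r \<Longrightarrow> group_hom (G m) (G N) (pad l m r)"
  by (intro group_hom.intro group_hom_axioms.intro homI) (simp_all add: pad_mult)

lemma pad_inv: "\<lbrakk>g \<in> carrier (G m); N = l + m + r\<rbrakk> \<Longrightarrow> inv\<^bsub>G N\<^esub> (pad l m r g) = pad l m r (inv\<^bsub>G m\<^esub> g)"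
  by (simp add: group_hom.hom_inv[OF pad_hom])

lemma pad_inj: "inj_on (pad l m r) (carrier (G m))"
proof (rule inj_onI)
  fix f g assume "f \<in> carrier (G m)" "g \<in> carrier (G m)" "pad l m r f = pad l m r g"
  then have "os m r f (e r) = os m r g (e r)"
    using os_inj[of "e l" l "os m r f (e r)" "m + r" "e l" "os m r g (e r)"] by (simp add: pad_def)
  then show "f = g" using os_inj[of f m "e r" r g "e r"] \<open>f \<in> carrier (G m)\<close> \<open>g \<in> carrier (G m)\<close> by simp
qed

lemma os_one_right: "\<lbrakk>g \<in> carrier (G m)\<rbrakk> \<Longrightarrow> os m r g (e r) = pad 0 m r g"
  by (simp add: pad_def)

lemma os_one_left: "\<lbrakk>g \<in> carrier (G m)\<rbrakk> \<Longrightarrow> os l m (e l) g = pad l m 0 g"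
  by (simp add: pad_def)

lemma pad_0_0 [simp]: "g \<in> carrier (G m) \<Longrightarrow> pad 0 m 0 g = g"
  by (simp add: pad_def)

lemma pad_pad:
  assumes g: "g \<in> carrier (G m)" and M: "M = l + m + r"
  shows "pad l' M r' (pad l m r g) = pad (l' + l) m (r + r') g"
proof -
  have "os M r' (os l (m + r) (e l) (os m r g (e r))) (e r')
      = os l (m + r + r') (e l) (os (m + r) r' (os m r g (e r)) (e r'))"
    using g M by (intro os_assoc) auto
  also have "os (m + r) r' (os m r g (e r)) (e r') = os m (r + r') g (e (r + r'))"
    using g by (simp add: os_assoc os_one)
  finally have "os M r' (pad l m r g) (e r') = os l (m + r + r') (e l) (os m (r + r') g (e (r + r')))"
    by (simp add: pad_def)
  then show ?thesis
    using g M os_assoc[of "e l'" l' "e l" l "os m (r + r') g (e (r + r'))" "m + r + r'" "l' + l"]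
    by (simp add: pad_def os_one add.assoc)
qed

lemma pad_commute:
  assumes "f \<in> carrier (G m)" "g \<in> carrier (G n)" "N = m + n"
  shows "pad 0 m n f \<otimes>\<^bsub>G N\<^esub> pad m n 0 g = pad m n 0 g \<otimes>\<^bsub>G N\<^esub> pad 0 m n f"
  using assms by (simp add: os_one_right[symmetric] os_one_left[symmetric] os_mult)

lemma b_closed [simp]: "N = m + n \<Longrightarrow> b m n \<in> carrier (G N)"
  using braiding by (simp add: braiding_def)

lemma b_naturality:
  "\<lbrakk>f \<in> carrier (G m); g \<in> carrier (G n); N = m + n\<rbrakk>
    \<Longrightarrow> os n m g f \<otimes>\<^bsub>G N\<^esub> b m n = b m n \<otimes>\<^bsub>G N\<^esub> os m n f g"
  using braiding by (simp add: braiding_def)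

lemma b_pad_right:
  "\<lbrakk>g \<in> carrier (G n); N = m + n\<rbrakk> \<Longrightarrow> b m n \<otimes>\<^bsub>G N\<^esub> pad m n 0 g = pad 0 n m g \<otimes>\<^bsub>G N\<^esub> b m n"
  by (simp add: b_naturality os_one_right[symmetric] os_one_left[symmetric])

lemma b_pad_left:
  "\<lbrakk>f \<in> carrier (G m); N = m + n\<rbrakk> \<Longrightarrow> b m n \<otimes>\<^bsub>G N\<^esub> pad 0 m n f = pad n m 0 f \<otimes>\<^bsub>G N\<^esub> b m n"
  by (simp add: b_naturality os_one_right[symmetric] os_one_left[symmetric])

lemma inv_conjugate:
  assumes "x \<in> carrier (G n)" "y \<in> carrier (G n)" "z \<in> carrier (G n)" "z \<otimes>\<^bsub>G n\<^esub> x = y \<otimes>\<^bsub>G n\<^esub> z"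
  shows "x \<otimes>\<^bsub>G n\<^esub> inv\<^bsub>G n\<^esub> z = inv\<^bsub>G n\<^esub> z \<otimes>\<^bsub>G n\<^esub> y"
proof -
  have "x \<otimes>\<^bsub>G n\<^esub> inv\<^bsub>G n\<^esub> z = inv\<^bsub>G n\<^esub> z \<otimes>\<^bsub>G n\<^esub> (z \<otimes>\<^bsub>G n\<^esub> x) \<otimes>\<^bsub>G n\<^esub> inv\<^bsub>G n\<^esub> z"
    using assms(1,3) by (simp add: m_assoc)
  also have "\<dots> = inv\<^bsub>G n\<^esub> z \<otimes>\<^bsub>G n\<^esub> y"
    unfolding assms(4) using assms(2,3) by (simp add: m_assoc)
  finally show ?thesis .
qed

lemma inv_b_pad_left:
  assumes "f \<in> carrier (G m)" "N = m + n"
  shows "pad 0 m n f \<otimes>\<^bsub>G N\<^esub> inv\<^bsub>G N\<^esub> (b m n) = inv\<^bsub>G N\<^esub> (b m n) \<otimes>\<^bsub>G N\<^esub> pad n m 0 f"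
  using assms by (intro inv_conjugate b_pad_left) simp_all

lemma inv_b_pad_right:
  assumes "g \<in> carrier (G n)" "N = m + n"
  shows "pad m n 0 g \<otimes>\<^bsub>G N\<^esub> inv\<^bsub>G N\<^esub> (b m n) = inv\<^bsub>G N\<^esub> (b m n) \<otimes>\<^bsub>G N\<^esub> pad 0 n m g"
  using assms by (intro inv_conjugate b_pad_right) simp_all

lemma b_add_right:
  "N = l + m + n \<Longrightarrow> b l (m + n) = pad m (l + n) 0 (b l n) \<otimes>\<^bsub>G N\<^esub> pad 0 (l + m) n (b l m)"
  using braiding by (simp add: braiding_def os_one_right[symmetric] os_one_left[symmetric])

lemma b_add_left:
  "N = l + m + n \<Longrightarrow> b (l + m) n = pad 0 (l + n) m (b l n) \<otimes>\<^bsub>G N\<^esub> pad l (m + n) 0 (b m n)"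
  using braiding by (simp add: braiding_def os_one_right[symmetric] os_one_left[symmetric])

lemma b_zero_right: "b n 0 = e n"
proof -
  have "b n 0 = b n 0 \<otimes>\<^bsub>G n\<^esub> b n 0" using b_add_right[of n n 0 0] by simp
  then show ?thesis by (metis add.right_neutral b_closed group.l_cancel_one group_G)
qed

lemma stabsub_eq: "stabsub G os m n = pad 0 m n ` carrier (G m)"
  by (auto simp: stabsub_def os_one_right)

lemma subgroup_stabsub: "s \<le> t \<Longrightarrow> subgroup (stabsub G os (t - s) s) (G t)"
  unfolding stabsub_eq by (intro group_hom.img_is_subgroup pad_hom) simp

definition mor :: "nat \<Rightarrow> nat \<Rightarrow> 'g \<Rightarrow> 'g set" where
  "mor s t f = f <#\<^bsub>G t\<^esub> stabsub G os (t - s) s"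

lemma mem_mor_iff: "x \<in> mor s t f \<longleftrightarrow> (\<exists>h\<in>carrier (G (t - s)). x = f \<otimes>\<^bsub>G t\<^esub> pad 0 (t - s) s h)"
  by (auto simp: mor_def l_coset_def stabsub_eq)

lemma mor_self: "\<lbrakk>s \<le> t; f \<in> carrier (G t)\<rbrakk> \<Longrightarrow> f \<in> mor s t f"
  by (auto simp: mem_mor_iff pad_one intro!: bexI[of _ "e (t - s)"])

lemma mor_eq_iff:
  assumes "s \<le> t" "f \<in> carrier (G t)" "f' \<in> carrier (G t)"
  shows "mor s t f = mor s t f' \<longleftrightarrow> (\<exists>h\<in>carrier (G (t - s)). f = f' \<otimes>\<^bsub>G t\<^esub> pad 0 (t - s) s h)"
  using assms mor_self[of s t f] group.l_repr_independence[OF group_G _ _ subgroup_stabsub, of f t f' s]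
  by (auto simp: mem_mor_iff[symmetric] mor_def)

lemma mor_absorb:
  "\<lbrakk>s \<le> t; f \<in> carrier (G t); h \<in> carrier (G (t - s))\<rbrakk> \<Longrightarrow> mor s t (f \<otimes>\<^bsub>G t\<^esub> pad 0 (t - s) s h) = mor s t f"
  by (subst mor_eq_iff) auto

lemma crep_mor:
  assumes "s \<le> t" "f \<in> carrier (G t)"
  obtains h where "h \<in> carrier (G (t - s))" "crep (mor s t f) = f \<otimes>\<^bsub>G t\<^esub> pad 0 (t - s) s h"
proof -
  have "crep (mor s t f) \<in> mor s t f" unfolding crep_def using mor_self[OF assms] by (rule someI)
  then show thesis using that by (auto simp: mem_mor_iff)
qed

lemma UHom_iff: "\<phi> \<in> UHom G os s t \<longleftrightarrow> s \<le> t \<and> (\<exists>f\<in>carrier (G t). \<phi> = mor s t f)"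
  by (auto simp: UHom_def mor_def)

lemma mor_UHom [simp]: "\<lbrakk>s \<le> t; f \<in> carrier (G t)\<rbrakk> \<Longrightarrow> mor s t f \<in> UHom G os s t"
  by (auto simp: UHom_iff)

lemma UHomE:
  assumes "\<phi> \<in> UHom G os s t"
  obtains f where "s \<le> t" "f \<in> carrier (G t)" "\<phi> = mor s t f"
  using assms UHom_iff by auto

lemma crep_UHom:
  assumes "\<phi> \<in> UHom G os s t"
  shows "crep \<phi> \<in> carrier (G t)" "mor s t (crep \<phi>) = \<phi>"
proof -
  obtain f where f: "s \<le> t" "f \<in> carrier (G t)" "\<phi> = mor s t f" using assms by (rule UHomE)
  obtain h where "h \<in> carrier (G (t - s))" "crep \<phi> = f \<otimes>\<^bsub>G t\<^esub> pad 0 (t - s) s h"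
    using crep_mor[OF f(1,2)] f(3) by metis
  then show "crep \<phi> \<in> carrier (G t)" "mor s t (crep \<phi>) = \<phi>" using f by (simp_all add: mor_absorb)
qed

lemma ucomp_mor:
  assumes st: "s \<le> t" "t \<le> u" and g: "g \<in> carrier (G u)" and f: "f \<in> carrier (G t)"
  shows "ucomp G os s t u (mor t u g) (mor s t f) = mor s u (g \<otimes>\<^bsub>G u\<^esub> pad (u - t) t 0 f)"
proof -
  obtain k where k: "k \<in> carrier (G (u - t))" "crep (mor t u g) = g \<otimes>\<^bsub>G u\<^esub> pad 0 (u - t) t k"
    using crep_mor st(2) g by blast
  obtain h where h: "h \<in> carrier (G (t - s))" "crep (mor s t f) = f \<otimes>\<^bsub>G t\<^esub> pad 0 (t - s) s h"
    using crep_mor st(1) f by blast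
  let ?k = "pad 0 (u - s) s (pad 0 (u - t) (t - s) k)" and ?h = "pad 0 (u - s) s (pad (u - t) (t - s) 0 h)"
  have stab: "pad 0 (u - t) t k = ?k" "pad (u - t) t 0 (pad 0 (t - s) s h) = ?h"
    using st k(1) h(1) by (simp_all add: pad_pad)
  have closed: "pad (u - t) t 0 f \<in> carrier (G u)" "pad 0 (u - t) t k \<in> carrier (G u)"
    "pad (u - t) t 0 (pad 0 (t - s) s h) \<in> carrier (G u)"
    using st f k(1) h(1) by simp_all
  have "crep (mor t u g) \<otimes>\<^bsub>G u\<^esub> pad (u - t) t 0 (crep (mor s t f))
      = g \<otimes>\<^bsub>G u\<^esub> (pad 0 (u - t) t k \<otimes>\<^bsub>G u\<^esub> pad (u - t) t 0 f) \<otimes>\<^bsub>G u\<^esub> pad (u - t) t 0 (pad 0 (t - s) s h)"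
    using closed st g f h k by (simp add: m_assoc pad_mult[symmetric])
  also have "pad 0 (u - t) t k \<otimes>\<^bsub>G u\<^esub> pad (u - t) t 0 f = pad (u - t) t 0 f \<otimes>\<^bsub>G u\<^esub> pad 0 (u - t) t k"
    using st k(1) f by (intro pad_commute) simp_all
  also have "g \<otimes>\<^bsub>G u\<^esub> \<dots> \<otimes>\<^bsub>G u\<^esub> pad (u - t) t 0 (pad 0 (t - s) s h)
      = g \<otimes>\<^bsub>G u\<^esub> pad (u - t) t 0 f \<otimes>\<^bsub>G u\<^esub> ?k \<otimes>\<^bsub>G u\<^esub> ?h"
    using closed g stab by (simp add: m_assoc)
  finally have "crep (mor t u g) \<otimes>\<^bsub>G u\<^esub> os (u - t) t (e (u - t)) (crep (mor s t f))
      = g \<otimes>\<^bsub>G u\<^esub> pad (u - t) t 0 f \<otimes>\<^bsub>G u\<^esub> ?k \<otimes>\<^bsub>G u\<^esub> ?h"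
    using crep_UHom(1)[OF mor_UHom[OF st(1) f]] by (simp add: os_one_left)
  then show ?thesis
    unfolding ucomp_def mor_def[symmetric] using closed(1) st g k(1) h(1) by (simp add: mor_absorb)
qed

lemma ucomp_UHom [simp]: "\<lbrakk>\<phi> \<in> UHom G os s t; \<psi> \<in> UHom G os t u\<rbrakk> \<Longrightarrow> ucomp G os s t u \<psi> \<phi> \<in> UHom G os s u"
  by (auto simp: UHom_iff ucomp_mor intro!: bexI)

lemma ucomp_assoc:
  assumes "\<phi> \<in> UHom G os s t" "\<psi> \<in> UHom G os t u" "\<chi> \<in> UHom G os u v"
  shows "ucomp G os s u v \<chi> (ucomp G os s t u \<psi> \<phi>) = ucomp G os s t v (ucomp G os t u v \<chi> \<psi>) \<phi>"
proof -
  from assms obtain f g h where rep: "s \<le> t" "t \<le> u" "u \<le> v"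
    "f \<in> carrier (G t)" "g \<in> carrier (G u)" "h \<in> carrier (G v)" "\<phi> = mor s t f" "\<psi> = mor t u g" "\<chi> = mor u v h"
    by (auto simp: UHom_iff)
  have "pad (v - u) u 0 (g \<otimes>\<^bsub>G u\<^esub> pad (u - t) t 0 f) = pad (v - u) u 0 g \<otimes>\<^bsub>G v\<^esub> pad (v - t) t 0 f"
    using rep(1-6) by (simp add: pad_mult[symmetric] pad_pad)
  then show ?thesis using rep by (simp add: ucomp_mor m_assoc)
qed

lemma uid_eq: "uid G os n = mor n n (e n)"
  by (simp add: uid_def mor_def)

lemma uid_UHom [simp]: "uid G os n \<in> UHom G os n n"
  by (simp add: uid_eq)

lemma ucomp_uid: "\<phi> \<in> UHom G os s t \<Longrightarrow> ucomp G os s t t (uid G os t) \<phi> = \<phi>"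
  by (auto simp: UHom_iff uid_eq ucomp_mor)

lemma ginc_eq: "ginc G os b a = mor a (Suc a) (inv\<^bsub>G (Suc a)\<^esub> (b a 1))"
proof -
  obtain u where u: "u \<in> carrier (G 1)" "crep (mor 0 1 (e 1)) = u"
    using crep_UHom(1)[OF mor_UHom[of 0 1 "e 1"]] by simp
  have "crep (uid G os a) \<in> mor a a (e a)" by (simp add: uid_eq crep_def mor_self
      someI[of "\<lambda>x. x \<in> mor a a (e a)" "e a"])
  then have id: "crep (uid G os a) = e a" by (auto simp: mem_mor_iff carrier_G0 pad_one)
  have iota: "iota G os 1 = mor 0 1 (e 1)" by (simp add: iota_def mor_def)
  have "ginc G os b a = mor a (Suc a) (pad a 1 0 u \<otimes>\<^bsub>G (Suc a)\<^esub> inv\<^bsub>G (Suc a)\<^esub> (b a 1))"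
    using u(1) unfolding ginc_def uoplus_def id iota u(2) by (simp add: mor_def os_one_left)
  also have "pad a 1 0 u \<otimes>\<^bsub>G (Suc a)\<^esub> inv\<^bsub>G (Suc a)\<^esub> (b a 1) = inv\<^bsub>G (Suc a)\<^esub> (b a 1) \<otimes>\<^bsub>G (Suc a)\<^esub> pad 0 1 a u"
    using u(1) by (intro inv_b_pad_right) simp_all
  finally show ?thesis using mor_absorb[of a "Suc a" "inv\<^bsub>G (Suc a)\<^esub> (b a 1)" u] u(1) by simp
qed

lemma ginc_UHom [simp]: "ginc G os b a \<in> UHom G os a (Suc a)"
  by (simp add: ginc_eq)

lemma ginc_equivariant:
  assumes "h \<in> carrier (G a)"
  shows "ucomp G os a a (Suc a) (ginc G os b a) (mor a a h)
    = ucomp G os a (Suc a) (Suc a) (mor (Suc a) (Suc a) (pad 0 a 1 h)) (ginc G os b a)"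
  using assms inv_b_pad_left[of h a "Suc a" 1] by (simp add: ginc_eq ucomp_mor)

lemma ginc_ginc:
  "ucomp G os a (Suc a) (Suc (Suc a)) (ginc G os b (Suc a)) (ginc G os b a)
      = mor a (Suc (Suc a)) (inv\<^bsub>G (Suc (Suc a))\<^esub> (b a 2))"
proof -
  let ?A = "Suc (Suc a)"
  let ?x = "pad 1 (Suc a) 0 (b a 1)"
  have "?x \<otimes>\<^bsub>G ?A\<^esub> b (Suc a) 1 = b a 2 \<otimes>\<^bsub>G ?A\<^esub> pad a 2 0 (b 1 1)"
    using b_add_left[of ?A a 1 1] b_add_right[of ?A a 1 1] by (simp add: m_assoc numeral_2_eq_2)
  also have "\<dots> = pad 0 2 a (b 1 1) \<otimes>\<^bsub>G ?A\<^esub> b a 2"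
    by (rule b_pad_right) simp_all
  finally have commute: "?x \<otimes>\<^bsub>G ?A\<^esub> b (Suc a) 1 = pad 0 2 a (b 1 1) \<otimes>\<^bsub>G ?A\<^esub> b a 2" .
  have "inv\<^bsub>G ?A\<^esub> (b (Suc a) 1) \<otimes>\<^bsub>G ?A\<^esub> pad 1 (Suc a) 0 (inv\<^bsub>G (Suc a)\<^esub> (b a 1))
    = inv\<^bsub>G ?A\<^esub> (?x \<otimes>\<^bsub>G ?A\<^esub> b (Suc a) 1)"
    by (simp add: pad_inv group.inv_mult_group)
  also have "\<dots> = inv\<^bsub>G ?A\<^esub> (b a 2) \<otimes>\<^bsub>G ?A\<^esub> pad 0 2 a (inv\<^bsub>G 2\<^esub> (b 1 1))"
    unfolding commute by (simp add: pad_inv group.inv_mult_group)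
  finally have product: "inv\<^bsub>G ?A\<^esub> (b (Suc a) 1) \<otimes>\<^bsub>G ?A\<^esub> pad 1 (Suc a) 0 (inv\<^bsub>G (Suc a)\<^esub> (b a 1))
    = inv\<^bsub>G ?A\<^esub> (b a 2) \<otimes>\<^bsub>G ?A\<^esub> pad 0 2 a (inv\<^bsub>G 2\<^esub> (b 1 1))" .
  have "?A - a = 2" by simp
  then show ?thesis
    using mor_absorb[of a ?A "inv\<^bsub>G ?A\<^esub> (b a 2)" "inv\<^bsub>G 2\<^esub> (b 1 1)"]
    by (simp add: ginc_eq ucomp_mor product[simplified])
qed

lemma ginc_ginc_invariant:
  assumes "g \<in> carrier (G 2)"
  shows "ucomp G os a (Suc (Suc a)) (Suc (Suc a)) (mor (Suc (Suc a)) (Suc (Suc a)) (pad a 2 0 g))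
     (mor a (Suc (Suc a)) (inv\<^bsub>G (Suc (Suc a))\<^esub> (b a 2))) = mor a (Suc (Suc a)) (inv\<^bsub>G (Suc (Suc a))\<^esub> (b a 2))"
proof -
  let ?A = "Suc (Suc a)"
  have "pad a 2 0 g \<otimes>\<^bsub>G ?A\<^esub> inv\<^bsub>G ?A\<^esub> (b a 2) = inv\<^bsub>G ?A\<^esub> (b a 2) \<otimes>\<^bsub>G ?A\<^esub> pad 0 2 a g"
    by (rule inv_b_pad_right) (use assms in simp_all)
  moreover have "?A - a = 2" by simp
  ultimately show ?thesis
    using mor_absorb[of a ?A "inv\<^bsub>G ?A\<^esub> (b a 2)" g] assms by (simp add: ucomp_mor)
qed

abbreviation face_elt :: "nat \<Rightarrow> nat \<Rightarrow> nat \<Rightarrow> 'g" where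
  "face_elt n q i \<equiv> cs_face G os b q n i"

lemma face_elt_eq: "i \<le> q \<Longrightarrow> face_elt n q i = pad (n - Suc q) (Suc i) (q - i) (b 1 i)"
  by (simp add: cs_face_def pad_def)

lemma face_elt_closed [simp]: "\<lbrakk>Suc q \<le> n; i \<le> q\<rbrakk> \<Longrightarrow> face_elt n q i \<in> carrier (G n)"
  by (simp add: face_elt_eq)

lemma pad_face_elt:
  assumes "Suc q \<le> n" "i \<le> q" "h \<in> carrier (G (n - Suc q))"
  shows "pad 0 (n - Suc q) (Suc q) h \<otimes>\<^bsub>G n\<^esub> face_elt n q i
    = face_elt n q i \<otimes>\<^bsub>G n\<^esub> pad 0 (n - q) q (pad 0 (n - Suc q) 1 h)"
proof -
  have "face_elt n q i = pad (n - Suc q) (Suc q) 0 (pad 0 (Suc i) (q - i) (b 1 i))"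
    using assms by (simp add: face_elt_eq pad_pad)
  moreover have "pad 0 (n - q) q (pad 0 (n - Suc q) 1 h) = pad 0 (n - Suc q) (Suc q) h"
    using assms by (simp add: pad_pad)
  ultimately show ?thesis using assms by (simp add: pad_commute)
qed

lemma b_exchange:
  "b 1 (Suc i + l) \<otimes>\<^bsub>G (Suc (Suc i + l))\<^esub> pad 1 (Suc i) l (b 1 i)
    = pad 0 (Suc i) (Suc l) (b 1 i) \<otimes>\<^bsub>G (Suc (Suc i + l))\<^esub> pad 1 (Suc i + l) 0 (b 1 (i + l))
      \<otimes>\<^bsub>G (Suc (Suc i + l))\<^esub> pad 0 2 (i + l) (b 1 1)"
proof -
  let ?A = "Suc (Suc i + l)"
  have "b 1 (Suc i + l) \<otimes>\<^bsub>G ?A\<^esub> pad 1 (Suc i) l (b 1 i)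
      = b 1 (Suc i + l) \<otimes>\<^bsub>G ?A\<^esub> pad 1 (Suc i + l) 0 (pad 0 (Suc i) l (b 1 i))"
    by (simp add: pad_pad)
  also have "\<dots> = pad 0 (Suc i + l) 1 (pad 0 (Suc i) l (b 1 i)) \<otimes>\<^bsub>G ?A\<^esub> b 1 (Suc i + l)"
    by (rule b_pad_right) simp_all
  also have "pad 0 (Suc i + l) 1 (pad 0 (Suc i) l (b 1 i)) = pad 0 (Suc i) (Suc l) (b 1 i)"
    by (simp add: pad_pad)
  finally have "b 1 (Suc i + l) \<otimes>\<^bsub>G ?A\<^esub> pad 1 (Suc i) l (b 1 i) = pad 0 (Suc i) (Suc l) (b 1 i) \<otimes>\<^bsub>G ?A\<^esub> b 1 (Suc i + l)" .
  moreover have "b 1 (Suc i + l) = pad 1 (Suc i + l) 0 (b 1 (i + l)) \<otimes>\<^bsub>G ?A\<^esub> pad 0 2 (i + l) (b 1 1)"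
    using b_add_right[of ?A 1 1 "i + l"] by (simp add: numeral_2_eq_2)
  ultimately show ?thesis by (simp add: m_assoc)
qed

text \<open>The last factor is the crossing of the two strands that are deleted by the composite face.\<close>

lemma face_elt_face_elt:
  assumes "Suc (Suc q) \<le> n" "i < j" "j \<le> Suc q"
  shows "face_elt n (Suc q) j \<otimes>\<^bsub>G n\<^esub> face_elt n q i
    = face_elt n (Suc q) i \<otimes>\<^bsub>G n\<^esub> face_elt n q (j - 1) \<otimes>\<^bsub>G n\<^esub> pad 0 (n - q) q (pad (n - Suc (Suc q)) 2 0 (b 1 1))"
proof -
  define m where "m = n - Suc (Suc q)"
  obtain l where l: "j = Suc i + l" using assms(2) by (metis Suc_leI le_Suc_ex)
  obtain c where c: "Suc q = j + c" using assms(3) le_Suc_ex by blast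
  let ?A = "Suc (Suc i + l)"
  have n: "n = m + ?A + c" "n - q = m + 2" and q: "q = i + l + c" using assms l c by (auto simp: m_def)
  have faces: "face_elt n (Suc q) j = pad m ?A c (b 1 (Suc i + l))"
    "face_elt n q i = pad m ?A c (pad 1 (Suc i) l (b 1 i))"
    "face_elt n (Suc q) i = pad m ?A c (pad 0 (Suc i) (Suc l) (b 1 i))"
    "face_elt n q (j - 1) = pad m ?A c (pad 1 (Suc i + l) 0 (b 1 (i + l)))"
    "pad 0 (n - q) q (pad (n - Suc (Suc q)) 2 0 (b 1 1)) = pad m ?A c (pad 0 2 (i + l) (b 1 1))"
    using l n q by (simp_all add: face_elt_eq pad_pad)
  have "face_elt n (Suc q) j \<otimes>\<^bsub>G n\<^esub> face_elt n q i
      = pad m ?A c (b 1 (Suc i + l) \<otimes>\<^bsub>G ?A\<^esub> pad 1 (Suc i) l (b 1 i))"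
    unfolding faces using n(1) by (simp add: pad_mult)
  also have "\<dots> = pad m ?A c (pad 0 (Suc i) (Suc l) (b 1 i) \<otimes>\<^bsub>G ?A\<^esub> pad 1 (Suc i + l) 0 (b 1 (i + l))
      \<otimes>\<^bsub>G ?A\<^esub> pad 0 2 (i + l) (b 1 1))"
    unfolding b_exchange ..
  also have "\<dots> = face_elt n (Suc q) i \<otimes>\<^bsub>G n\<^esub> face_elt n q (j - 1)
      \<otimes>\<^bsub>G n\<^esub> pad 0 (n - q) q (pad (n - Suc (Suc q)) 2 0 (b 1 1))"
    unfolding faces using n(1) by (simp add: pad_mult)
  finally show ?thesis .
qed

definition twist :: "nat \<Rightarrow> nat \<Rightarrow> nat \<Rightarrow> 'g" where
  "twist m n q = pad (n - m - q) (m + q) 0 (b m q)"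

lemma twist_closed [simp]: "m + q \<le> n \<Longrightarrow> twist m n q \<in> carrier (G n)"
  by (simp add: twist_def)

lemma pad_twist:
  assumes "m + q \<le> n" "h \<in> carrier (G (n - m - q))"
  shows "pad 0 (n - m) m (pad 0 (n - m - q) q h) \<otimes>\<^bsub>G n\<^esub> twist m n q
    = twist m n q \<otimes>\<^bsub>G n\<^esub> pad 0 (n - q) q (pad 0 (n - m - q) m h)"
  using assms by (simp add: twist_def pad_pad pad_commute add.commute)

lemma twist_face_elt:
  assumes "m + Suc q \<le> n" "i \<le> q"
  shows "twist m n (Suc q) \<otimes>\<^bsub>G n\<^esub> face_elt n q i
      \<otimes>\<^bsub>G n\<^esub> pad 0 (n - q) q (pad (n - m - Suc q) (Suc m) 0 (inv\<^bsub>G (Suc m)\<^esub> (b m 1)))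
    = pad 0 (n - m) m (face_elt (n - m) q i) \<otimes>\<^bsub>G n\<^esub> twist m n q"
proof -
  define s where "s = n - m - Suc q"
  define x where "x = pad 0 (Suc i) (q - i) (b 1 i)"
  define K where "K = m + Suc q"
  have n: "n = s + K" "n - q = s + Suc m" "n - Suc q = s + m" "n - m = s + Suc q"
    using assms by (auto simp: s_def K_def)
  have x: "x \<in> carrier (G (Suc q))" using assms by (simp add: x_def)
  let ?i = "pad 0 (Suc m) q (inv\<^bsub>G (Suc m)\<^esub> (b m 1))" and ?b = "pad 1 (m + q) 0 (b m q)"
  have closed: "?i \<in> carrier (G K)" "?b \<in> carrier (G K)" "b m (Suc q) \<in> carrier (G K)"
    "pad m (Suc q) 0 x \<in> carrier (G K)" "pad 0 (Suc q) m x \<in> carrier (G K)"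
    using x by (simp_all add: K_def)
  have padded: "twist m n (Suc q) = pad s K 0 (b m (Suc q))"
    "face_elt n q i = pad s K 0 (pad m (Suc q) 0 x)"
    "pad 0 (n - q) q (pad s (Suc m) 0 (inv\<^bsub>G (Suc m)\<^esub> (b m 1))) = pad s K 0 ?i"
    "pad 0 (n - m) m (face_elt (n - m) q i) = pad s K 0 (pad 0 (Suc q) m x)"
    "twist m n q = pad s K 0 ?b"
    using n assms by (simp_all add: twist_def face_elt_eq x_def K_def pad_pad)
  have "b m (Suc q) \<otimes>\<^bsub>G K\<^esub> ?i = ?b \<otimes>\<^bsub>G K\<^esub> (pad 0 (Suc m) q (b m 1) \<otimes>\<^bsub>G K\<^esub> ?i)"
    using b_add_right[of K m 1 q] by (simp add: K_def m_assoc)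
  also have "\<dots> = ?b" using closed by (simp add: K_def pad_mult pad_one)
  finally have b: "b m (Suc q) \<otimes>\<^bsub>G K\<^esub> ?i = ?b" .
  have "b m (Suc q) \<otimes>\<^bsub>G K\<^esub> pad m (Suc q) 0 x = pad 0 (Suc q) m x \<otimes>\<^bsub>G K\<^esub> b m (Suc q)"
    using x by (intro b_pad_right) (simp_all add: K_def)
  then have "b m (Suc q) \<otimes>\<^bsub>G K\<^esub> pad m (Suc q) 0 x \<otimes>\<^bsub>G K\<^esub> ?i = pad 0 (Suc q) m x \<otimes>\<^bsub>G K\<^esub> ?b"
    using closed b by (simp add: m_assoc)
  then show ?thesis unfolding s_def[symmetric] padded using closed n(1) by (simp add: pad_mult)
qed

lemma ginc_unit:
  assumes "m \<le> r"
  shows "ucomp G os m r (Suc r) (ginc G os b r) (mor m r (e r))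
    = mor m (Suc r) (pad (r - m) (Suc m) 0 (inv\<^bsub>G (Suc m)\<^esub> (b m 1)))"
proof -
  define s where "s = r - m"
  have r: "r = s + m" "Suc r - m = Suc s" using assms by (auto simp: s_def)
  have "b r 1 = pad 0 (Suc s) m (b s 1) \<otimes>\<^bsub>G (Suc r)\<^esub> pad s (Suc m) 0 (b m 1)"
    using b_add_left[of "Suc r" s m 1] r(1) by simp
  then have "inv\<^bsub>G (Suc r)\<^esub> (b r 1) = pad s (Suc m) 0 (inv\<^bsub>G (Suc m)\<^esub> (b m 1))
      \<otimes>\<^bsub>G (Suc r)\<^esub> pad 0 (Suc s) m (inv\<^bsub>G (Suc s)\<^esub> (b s 1))"
    using r(1) by (simp add: group.inv_mult_group pad_inv)
  then have "mor m (Suc r) (inv\<^bsub>G (Suc r)\<^esub> (b r 1)) = mor m (Suc r) (pad s (Suc m) 0 (inv\<^bsub>G (Suc m)\<^esub> (b m 1)))"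
    using mor_absorb[of m "Suc r" "pad s (Suc m) 0 (inv\<^bsub>G (Suc m)\<^esub> (b m 1))" "inv\<^bsub>G (Suc s)\<^esub> (b s 1)"] r by simp
  then show ?thesis using assms by (simp add: ginc_eq ucomp_mor s_def[symmetric] pad_one)
qed

end

section \<open>The central stability complex\<close>

locale braided_ug_module = braided_stability_groupoid G os b for G :: "nat \<Rightarrow> 'g monoid" and os b +
  fixes R :: "'r ring" and M :: "nat \<Rightarrow> ('r, 'x) module" and act :: "nat \<Rightarrow> nat \<Rightarrow> 'g set \<Rightarrow> 'x \<Rightarrow> 'x"
  assumes ug_module: "ug_module G os R M act"
begin

lemma module_M: "module R (M n)"
  using ug_module by (simp add: ug_module_def)

lemma cring_R [simp]: "cring R"
  using module_M[of 0] by (simp add: module_def)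

lemma abelian_M [simp]: "abelian_group (M n)"
  using module_M by (simp add: module_def)

lemma M_add_closed [simp]: "\<lbrakk>x \<in> carrier (M n); y \<in> carrier (M n)\<rbrakk> \<Longrightarrow> x \<oplus>\<^bsub>M n\<^esub> y \<in> carrier (M n)"
  and M_zero_closed [simp]: "\<zero>\<^bsub>M n\<^esub> \<in> carrier (M n)"
  by (simp_all add: abelian_groupE(1,2))

lemma M_smult_closed [simp]: "\<lbrakk>r \<in> carrier R; x \<in> carrier (M n)\<rbrakk> \<Longrightarrow> r \<odot>\<^bsub>M n\<^esub> x \<in> carrier (M n)"
  by (rule module.smult_closed[OF module_M])

lemma act_linear: "\<phi> \<in> UHom G os s t \<Longrightarrow> linear_map R (M s) (M t) (act s t \<phi>)"
  using ug_module by (simp add: ug_module_def)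

lemma act_closed [simp]: "\<lbrakk>\<phi> \<in> UHom G os s t; x \<in> carrier (M s)\<rbrakk> \<Longrightarrow> act s t \<phi> x \<in> carrier (M t)"
  and act_add: "\<lbrakk>\<phi> \<in> UHom G os s t; x \<in> carrier (M s); y \<in> carrier (M s)\<rbrakk>
    \<Longrightarrow> act s t \<phi> (x \<oplus>\<^bsub>M s\<^esub> y) = act s t \<phi> x \<oplus>\<^bsub>M t\<^esub> act s t \<phi> y"
  and act_smult: "\<lbrakk>\<phi> \<in> UHom G os s t; x \<in> carrier (M s); r \<in> carrier R\<rbrakk>
    \<Longrightarrow> act s t \<phi> (r \<odot>\<^bsub>M s\<^esub> x) = r \<odot>\<^bsub>M t\<^esub> act s t \<phi> x"
  using act_linear by (auto simp: linear_map_def)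

lemma act_uid: "x \<in> carrier (M n) \<Longrightarrow> act n n (uid G os n) x = x"
  using ug_module by (simp add: ug_module_def)

lemma act_ucomp: "\<lbrakk>\<phi> \<in> UHom G os s t; \<psi> \<in> UHom G os t u; x \<in> carrier (M s)\<rbrakk>
    \<Longrightarrow> act s u (ucomp G os s t u \<psi> \<phi>) x = act t u \<psi> (act s t \<phi> x)"
  using ug_module by (simp add: ug_module_def)

lemma act_hom: "\<phi> \<in> UHom G os s t \<Longrightarrow> abelian_group_hom (M s) (M t) (act s t \<phi>)"
  by (rule abelian_group_homI_add) (simp_all add: act_add)

lemma act_zero: "\<phi> \<in> UHom G os s t \<Longrightarrow> act s t \<phi> \<zero>\<^bsub>M s\<^esub> = \<zero>\<^bsub>M t\<^esub>"
  by (rule abelian_group_hom.hom_zero[OF act_hom])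

abbreviation g_act :: "nat \<Rightarrow> 'g \<Rightarrow> 'x \<Rightarrow> 'x" where "g_act \<equiv> gact G os act"
abbreviation sigma :: "nat \<Rightarrow> 'x \<Rightarrow> 'x" where "sigma \<equiv> minc G os b act"

lemma g_act_eq: "g_act n g x = act n n (mor n n g) x"
  by (simp add: gact_def mor_def)

lemma g_act_closed [simp]: "\<lbrakk>g \<in> carrier (G n); x \<in> carrier (M n)\<rbrakk> \<Longrightarrow> g_act n g x \<in> carrier (M n)"
  and g_act_add: "\<lbrakk>g \<in> carrier (G n); x \<in> carrier (M n); y \<in> carrier (M n)\<rbrakk>
    \<Longrightarrow> g_act n g (x \<oplus>\<^bsub>M n\<^esub> y) = g_act n g x \<oplus>\<^bsub>M n\<^esub> g_act n g y"
  and g_act_smult: "\<lbrakk>g \<in> carrier (G n); x \<in> carrier (M n); r \<in> carrier R\<rbrakk>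
    \<Longrightarrow> g_act n g (r \<odot>\<^bsub>M n\<^esub> x) = r \<odot>\<^bsub>M n\<^esub> g_act n g x"
  and g_act_one: "x \<in> carrier (M n) \<Longrightarrow> g_act n (e n) x = x"
  by (simp_all add: g_act_eq act_add act_smult act_uid[unfolded uid_eq])

lemma g_act_mult:
  "\<lbrakk>g \<in> carrier (G n); h \<in> carrier (G n); x \<in> carrier (M n)\<rbrakk> \<Longrightarrow> g_act n (g \<otimes>\<^bsub>G n\<^esub> h) x = g_act n g (g_act n h x)"
  using act_ucomp[of "mor n n h" n n "mor n n g" n x] by (simp add: g_act_eq ucomp_mor)

lemma sigma_closed [simp]: "x \<in> carrier (M n) \<Longrightarrow> sigma n x \<in> carrier (M (Suc n))"
  and sigma_add: "\<lbrakk>x \<in> carrier (M n); y \<in> carrier (M n)\<rbrakk>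
    \<Longrightarrow> sigma n (x \<oplus>\<^bsub>M n\<^esub> y) = sigma n x \<oplus>\<^bsub>M (Suc n)\<^esub> sigma n y"
  and sigma_smult: "\<lbrakk>x \<in> carrier (M n); r \<in> carrier R\<rbrakk> \<Longrightarrow> sigma n (r \<odot>\<^bsub>M n\<^esub> x) = r \<odot>\<^bsub>M (Suc n)\<^esub> sigma n x"
  by (simp_all add: minc_def act_add act_smult)

lemma sigma_g_act:
  assumes "h \<in> carrier (G n)" "x \<in> carrier (M n)"
  shows "sigma n (g_act n h x) = g_act (Suc n) (pad 0 n 1 h) (sigma n x)"
  using act_ucomp[of "mor n n h" n n "ginc G os b n" "Suc n" x]
    act_ucomp[of "ginc G os b n" n "Suc n" "mor (Suc n) (Suc n) (pad 0 n 1 h)" "Suc n" x]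
    ginc_equivariant[OF assms(1)] assms
  by (simp add: minc_def g_act_eq)

lemma sigma_sigma_invariant:
  assumes "g \<in> carrier (G 2)" "x \<in> carrier (M n)"
  shows "g_act (Suc (Suc n)) (pad n 2 0 g) (sigma (Suc n) (sigma n x)) = sigma (Suc n) (sigma n x)"
proof -
  let ?\<sigma>\<sigma> = "mor n (Suc (Suc n)) (inv\<^bsub>G (Suc (Suc n))\<^esub> (b n 2))"
  have "sigma (Suc n) (sigma n x) = act n (Suc (Suc n)) ?\<sigma>\<sigma> x"
    using act_ucomp[of "ginc G os b n" n "Suc n" "ginc G os b (Suc n)" "Suc (Suc n)" x] assms
    by (simp add: minc_def ginc_ginc)
  then show ?thesis
    using assms ginc_ginc_invariant[OF assms(1), of n]
      act_ucomp[of ?\<sigma>\<sigma> n "Suc (Suc n)" "mor (Suc (Suc n)) (Suc (Suc n)) (pad n 2 0 g)" "Suc (Suc n)" x]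
    by (simp add: g_act_eq)
qed

lemma level: "q \<le> n \<Longrightarrow> induced_module (G n) (G (n - q)) (M (n - q)) (pad 0 (n - q) q) (g_act (n - q))"
  by (intro induced_module.intro induced_module_axioms.intro)
    (simp_all add: pad_mult pad_inj g_act_add g_act_one g_act_mult)

abbreviation level_ind :: "nat \<Rightarrow> nat \<Rightarrow> ('g \<Rightarrow> 'x) ring" where
  "level_ind n q \<equiv> induced_module.ind (G n) (G (n - q)) (M (n - q)) (pad 0 (n - q) q) (g_act (n - q))"

definition tensor :: "nat \<Rightarrow> nat \<Rightarrow> 'g \<Rightarrow> 'x \<Rightarrow> 'g \<Rightarrow> 'x" where
  "tensor n q = induced_module.tensor (G n) (G (n - q)) (M (n - q)) (pad 0 (n - q) q) (g_act (n - q))"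

definition chain_group :: "nat \<Rightarrow> nat \<Rightarrow> ('g \<Rightarrow> 'x) ring" where
  "chain_group n q = pointwise (M (n - q)) (if q \<le> n then carrier (level_ind n q) else {\<lambda>_. \<zero>\<^bsub>M (n - q)\<^esub>})"

lemma chain_group_level: "q \<le> n \<Longrightarrow> chain_group n q = level_ind n q"
  by (simp add: chain_group_def induced_module.ind_def[OF level])

lemma chain_group_simps [simp]: "\<zero>\<^bsub>chain_group n q\<^esub> = (\<lambda>_. \<zero>\<^bsub>M (n - q)\<^esub>)"
    "c \<oplus>\<^bsub>chain_group n q\<^esub> d = (\<lambda>g. c g \<oplus>\<^bsub>M (n - q)\<^esub> d g)"
  by (simp_all add: chain_group_def)

lemma chain_group_empty: "\<not> q \<le> n \<Longrightarrow> carrier (chain_group n q) = {\<zero>\<^bsub>chain_group n q\<^esub>}"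
  by (simp add: chain_group_def)

lemma abelian_chain_group [simp]: "abelian_group (chain_group n q)"
proof (cases "q \<le> n")
  case True
  then show ?thesis by (simp add: chain_group_level induced_module.abelian_group_ind[OF level])
next
  case False
  interpret M: abelian_group "M (n - q)" by simp
  show ?thesis by (rule abelian_groupI) (simp_all add: chain_group_empty[OF False])
qed

lemma tensor_closed [simp]:
  "\<lbrakk>q \<le> n; g \<in> carrier (G n); x \<in> carrier (M (n - q))\<rbrakk> \<Longrightarrow> tensor n q g x \<in> carrier (chain_group n q)"
  by (simp add: tensor_def chain_group_level induced_module.tensor_in_ind[OF level])

lemma chain_value_closed: "c \<in> carrier (chain_group n q) \<Longrightarrow> c g \<in> carrier (M (n - q))"
  by (cases "q \<le> n") (auto simp: chain_group_level chain_group_empty induced_module.ind_value_closed[OF level])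

lemma chain_value_hom: "abelian_group_hom (chain_group n q) (M (n - q)) (\<lambda>c. c g)"
  by (rule abelian_group_homI_add) (simp_all add: chain_value_closed)

lemma tensor_add:
  "\<lbrakk>q \<le> n; g \<in> carrier (G n); x \<in> carrier (M (n - q)); y \<in> carrier (M (n - q))\<rbrakk>
    \<Longrightarrow> tensor n q g (x \<oplus>\<^bsub>M (n - q)\<^esub> y) = tensor n q g x \<oplus>\<^bsub>chain_group n q\<^esub> tensor n q g y"
  by (simp add: tensor_def chain_group_level induced_module.tensor_add_ind[OF level] del: chain_group_simps)

lemma tensor_mult_pad:
  "\<lbrakk>q \<le> n; g \<in> carrier (G n); h \<in> carrier (G (n - q)); x \<in> carrier (M (n - q))\<rbrakk>
    \<Longrightarrow> tensor n q (g \<otimes>\<^bsub>G n\<^esub> pad 0 (n - q) q h) x = tensor n q g (g_act (n - q) h x)"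
  unfolding tensor_def by (rule induced_module.tensor_mult_emb[OF level])

lemma tensor_hom:
  "\<lbrakk>q \<le> n; g \<in> carrier (G n)\<rbrakk> \<Longrightarrow> abelian_group_hom (M (n - q)) (chain_group n q) (tensor n q g)"
  by (rule abelian_group_homI_add) (simp_all add: tensor_add del: chain_group_simps)

lemma tensor_zero: "\<lbrakk>q \<le> n; g \<in> carrier (G n)\<rbrakk> \<Longrightarrow> tensor n q g \<zero>\<^bsub>M (n - q)\<^esub> = \<zero>\<^bsub>chain_group n q\<^esub>"
  by (rule abelian_group_hom.hom_zero[OF tensor_hom])

lemma chain_induct [consumes 1, case_names zero add]:
  assumes c: "c \<in> carrier (chain_group n q)" and zero: "P \<zero>\<^bsub>chain_group n q\<^esub>"
    and add: "\<And>g x c. \<lbrakk>q \<le> n; g \<in> carrier (G n); x \<in> carrier (M (n - q)); c \<in> carrier (chain_group n q); P c\<rbrakk>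
      \<Longrightarrow> P (tensor n q g x \<oplus>\<^bsub>chain_group n q\<^esub> c)"
  shows "P c"
proof (cases "q \<le> n")
  case True
  show ?thesis
    by (rule induced_module.ind_induct[OF level[OF True], of c P])
      (use True c zero add in \<open>simp_all add: chain_group_level[symmetric] tensor_def[symmetric] del: chain_group_simps\<close>)
next
  case False
  then show ?thesis using c zero by (simp add: chain_group_empty)
qed

lemma chain_hom_eqI:
  assumes hom: "abelian_group_hom (chain_group n q) N f" "abelian_group_hom (chain_group n q) N f'"
    and tensor: "\<And>g x. \<lbrakk>q \<le> n; g \<in> carrier (G n); x \<in> carrier (M (n - q))\<rbrakk> \<Longrightarrow> f (tensor n q g x) = f' (tensor n q g x)"
    and "c \<in> carrier (chain_group n q)"
  shows "f c = f' c"
  using assms(4)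
proof (induction rule: chain_induct)
  case zero
  show ?case using abelian_group_hom.hom_zero[OF hom(1)] abelian_group_hom.hom_zero[OF hom(2)] by (simp only:)
next
  case (add g x c)
  then show ?case
    using abelian_group_hom.hom_add[OF hom(1), of "tensor n q g x" c]
      abelian_group_hom.hom_add[OF hom(2), of "tensor n q g x" c] tensor by (simp del: chain_group_simps)
qed

lemma tensor_inside:
  "\<lbrakk>q \<le> n; g \<in> carrier (G n); h \<in> carrier (G (n - q))\<rbrakk>
    \<Longrightarrow> tensor n q (g \<otimes>\<^bsub>G n\<^esub> pad 0 (n - q) q h) x g = g_act (n - q) h x"
  unfolding tensor_def by (rule induced_module.tensor_inside[OF level])

lemma tensor_outside:
  assumes "q \<le> n" "\<nexists>h. h \<in> carrier (G (n - q)) \<and> g = g' \<otimes>\<^bsub>G n\<^esub> pad 0 (n - q) q h"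
  shows "tensor n q g x g' = \<zero>\<^bsub>M (n - q)\<^esub>"
  unfolding tensor_def
  by (rule induced_module.tensor_outside[OF level[OF assms(1)]])
    (use assms in \<open>auto simp: induced_module.mem_coset_iff[OF level]\<close>)

lemma chain_outside_carrier:
  assumes "c \<in> carrier (chain_group n q)" "g \<notin> carrier (G n)"
  shows "c g = \<zero>\<^bsub>M (n - q)\<^esub>"
  using assms(1)
proof (induction rule: chain_induct)
  case (add g' x c)
  have "tensor n q g' x g = \<zero>\<^bsub>M (n - q)\<^esub>"
    unfolding tensor_def by (rule induced_module.tensor_outside_carrier[OF level[OF add(1)] assms(2)])
  then show ?case using add(5) abelian_monoid.l_zero[OF abelian_group.axioms(1)[OF abelian_M]] by simp
qed simp

lemma hom_from_empty_chain_group: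
  assumes "\<not> q \<le> n" "abelian_group N" "f \<zero>\<^bsub>chain_group n q\<^esub> = \<zero>\<^bsub>N\<^esub>"
  shows "abelian_group_hom (chain_group n q) N f"
proof (rule abelian_group_homI_add[OF abelian_chain_group assms(2)])
  interpret N: abelian_group N by fact
  interpret C: abelian_group "chain_group n q" by simp
  fix c assume "c \<in> carrier (chain_group n q)"
  then have c: "c = \<zero>\<^bsub>chain_group n q\<^esub>" using chain_group_empty[OF assms(1)] by simp
  show "f c \<in> carrier N" unfolding c assms(3) by simp
  fix d assume "d \<in> carrier (chain_group n q)"
  then have d: "d = \<zero>\<^bsub>chain_group n q\<^esub>" using chain_group_empty[OF assms(1)] by simp
  show "f (c \<oplus>\<^bsub>chain_group n q\<^esub> d) = f c \<oplus>\<^bsub>N\<^esub> f d"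
    unfolding c d C.l_zero[OF C.zero_closed] assms(3) by simp
qed

definition chain_face :: "nat \<Rightarrow> nat \<Rightarrow> nat \<Rightarrow> ('g \<Rightarrow> 'x) \<Rightarrow> 'g \<Rightarrow> 'x" where
  "chain_face n q i = (if Suc q \<le> n
     then balanced_map.extension (G n) (G (n - Suc q)) (M (n - Suc q)) (pad 0 (n - Suc q) (Suc q)) (g_act (n - Suc q))
       (add_monoid (chain_group n q)) (\<lambda>g x. tensor n q (g \<otimes>\<^bsub>G n\<^esub> face_elt n q i) (sigma (n - Suc q) x))
     else (\<lambda>_. \<zero>\<^bsub>chain_group n q\<^esub>))"

lemma chain_face_balanced:
  assumes q: "Suc q \<le> n" and i: "i \<le> q"
  shows "balanced_map (G n) (G (n - Suc q)) (M (n - Suc q)) (pad 0 (n - Suc q) (Suc q)) (g_act (n - Suc q))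
    (add_monoid (chain_group n q)) (\<lambda>g x. tensor n q (g \<otimes>\<^bsub>G n\<^esub> face_elt n q i) (sigma (n - Suc q) x))"
proof (intro balanced_map.intro balanced_map_axioms.intro level[OF q] abelian_group.a_comm_group abelian_chain_group)
  define m where "m = n - Suc q"
  have nq: "n - q = Suc m" and qn: "q \<le> n" using q by (auto simp: m_def)
  fix g x assume g: "g \<in> carrier (G n)" and x: "x \<in> carrier (M (n - Suc q))"
  then have x': "sigma m x \<in> carrier (M (n - q))" by (simp add: nq m_def)
  have gf: "g \<otimes>\<^bsub>G n\<^esub> face_elt n q i \<in> carrier (G n)" using g q i by simp
  show "tensor n q (g \<otimes>\<^bsub>G n\<^esub> face_elt n q i) (sigma (n - Suc q) x) \<in> carrier (add_monoid (chain_group n q))"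
    using qn gf x' by (simp add: m_def)
  show "tensor n q (g \<otimes>\<^bsub>G n\<^esub> face_elt n q i) (sigma (n - Suc q) (x \<oplus>\<^bsub>M (n - Suc q)\<^esub> y))
      = tensor n q (g \<otimes>\<^bsub>G n\<^esub> face_elt n q i) (sigma (n - Suc q) x)
        \<otimes>\<^bsub>add_monoid (chain_group n q)\<^esub> tensor n q (g \<otimes>\<^bsub>G n\<^esub> face_elt n q i) (sigma (n - Suc q) y)"
    if "y \<in> carrier (M (n - Suc q))" for y
    using tensor_add[OF qn gf, of "sigma m x" "sigma m y"] x that by (simp add: sigma_add m_def[symmetric] nq)
  fix h assume h: "h \<in> carrier (G (n - Suc q))"
  have ph: "pad 0 m 1 h \<in> carrier (G (n - q))" using h nq by (simp add: m_def)
  have "g \<otimes>\<^bsub>G n\<^esub> pad 0 (n - Suc q) (Suc q) h \<otimes>\<^bsub>G n\<^esub> face_elt n q i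
      = g \<otimes>\<^bsub>G n\<^esub> face_elt n q i \<otimes>\<^bsub>G n\<^esub> pad 0 (n - q) q (pad 0 m 1 h)"
    using pad_face_elt[OF q i h] g h q i ph by (simp add: m_assoc m_def)
  moreover have "sigma m (g_act m h x) = g_act (n - q) (pad 0 m 1 h) (sigma m x)"
    using sigma_g_act[of h m x] h x by (simp add: nq m_def)
  ultimately show "tensor n q (g \<otimes>\<^bsub>G n\<^esub> pad 0 (n - Suc q) (Suc q) h \<otimes>\<^bsub>G n\<^esub> face_elt n q i) (sigma (n - Suc q) x)
      = tensor n q (g \<otimes>\<^bsub>G n\<^esub> face_elt n q i) (sigma (n - Suc q) (g_act (n - Suc q) h x))"
    using tensor_mult_pad[OF qn gf ph x'] by (simp add: m_def)
qed

lemma chain_face_tensor: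
  "\<lbrakk>Suc q \<le> n; i \<le> q; g \<in> carrier (G n); x \<in> carrier (M (n - Suc q))\<rbrakk>
    \<Longrightarrow> chain_face n q i (tensor n (Suc q) g x) = tensor n q (g \<otimes>\<^bsub>G n\<^esub> face_elt n q i) (sigma (n - Suc q) x)"
  unfolding chain_face_def tensor_def[of n "Suc q"]
  by (simp only: if_True balanced_map.extension_tensor[OF chain_face_balanced])

lemma chain_face_hom:
  assumes "i \<le> q"
  shows "abelian_group_hom (chain_group n (Suc q)) (chain_group n q) (chain_face n q i)"
proof (cases "Suc q \<le> n")
  case True
  then have "chain_face n q i \<in> hom (add_monoid (chain_group n (Suc q))) (add_monoid (chain_group n q))"
    using balanced_map.extension_hom[OF chain_face_balanced[OF True assms]]
    by (simp add: chain_face_def chain_group_level)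
  then show ?thesis
    by (intro abelian_group_homI group_hom.intro group_hom_axioms.intro abelian_group.a_group) simp_all
next
  case False
  then show ?thesis by (intro hom_from_empty_chain_group) (simp_all add: chain_face_def)
qed

lemma chain_face_chain_face:
  assumes "i < j" "j \<le> Suc q" and c: "c \<in> carrier (chain_group n (Suc (Suc q)))"
  shows "chain_face n q i (chain_face n (Suc q) j c) = chain_face n q (j - 1) (chain_face n (Suc q) i c)"
proof (rule chain_hom_eqI[OF _ _ _ c])
  show "abelian_group_hom (chain_group n (Suc (Suc q))) (chain_group n q)
      (\<lambda>c. chain_face n q i (chain_face n (Suc q) j c))"
    "abelian_group_hom (chain_group n (Suc (Suc q))) (chain_group n q)
      (\<lambda>c. chain_face n q (j - 1) (chain_face n (Suc q) i c))"
    using assms(1,2) by (intro abelian_group_hom_compose[OF chain_face_hom chain_face_hom]; simp)+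
  fix g x assume n: "Suc (Suc q) \<le> n" and g: "g \<in> carrier (G n)" and x: "x \<in> carrier (M (n - Suc (Suc q)))"
  define m where "m = n - Suc (Suc q)"
  have nq: "n - q = Suc (Suc m)" "n - Suc q = Suc m" and qn: "q \<le> n" using n by (auto simp: m_def)
  define z where "z = sigma (Suc m) (sigma m x)"
  define g' where "g' = g \<otimes>\<^bsub>G n\<^esub> face_elt n (Suc q) i \<otimes>\<^bsub>G n\<^esub> face_elt n q (j - 1)"
  define u where "u = pad m 2 0 (b 1 1)"
  have z: "z \<in> carrier (M (n - q))" using x by (simp add: z_def nq m_def)
  have g': "g' \<in> carrier (G n)" using g n assms(1,2) by (simp add: g'_def)
  have u: "u \<in> carrier (G (n - q))" by (simp add: u_def nq)
  have twice: "chain_face n q k (chain_face n (Suc q) l (tensor n (Suc (Suc q)) g x))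
      = tensor n q (g \<otimes>\<^bsub>G n\<^esub> face_elt n (Suc q) l \<otimes>\<^bsub>G n\<^esub> face_elt n q k) z" if "k \<le> q" "l \<le> Suc q" for k l
    using that n g x by (simp add: chain_face_tensor z_def nq m_def)
  have "g \<otimes>\<^bsub>G n\<^esub> face_elt n (Suc q) j \<otimes>\<^bsub>G n\<^esub> face_elt n q i = g' \<otimes>\<^bsub>G n\<^esub> pad 0 (n - q) q u"
    using face_elt_face_elt[OF n assms(1,2)] g n assms(1,2) u by (simp add: g'_def u_def m_def m_assoc)
  moreover have "g_act (n - q) u z = z"
    using sigma_sigma_invariant[of "b 1 1" x m] x by (simp add: u_def z_def nq m_def numeral_2_eq_2)
  ultimately show "chain_face n q i (chain_face n (Suc q) j (tensor n (Suc (Suc q)) g x))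
      = chain_face n q (j - 1) (chain_face n (Suc q) i (tensor n (Suc (Suc q)) g x))"
    using assms(1,2) tensor_mult_pad[OF qn g' u z] by (simp add: twice g'_def)
qed

sublocale complex: semisimplicial_group "chain_group n" "chain_face n" for n
  by (intro semisimplicial_group.intro abelian_chain_group chain_face_hom chain_face_chain_face)

end

locale braided_ug_hom = A: braided_ug_module G os b R M act + B: braided_ug_module G os b R M' act'
  for G :: "nat \<Rightarrow> 'g monoid" and os b and R :: "'r ring" and M :: "nat \<Rightarrow> ('r, 'x) module" and act
    and M' :: "nat \<Rightarrow> ('r, 'y) module" and act' +
  fixes \<eta> :: "nat \<Rightarrow> 'x \<Rightarrow> 'y"
  assumes ug_hom: "ug_hom G os R M act M' act' \<eta>"
begin

lemma hom_closed [simp]: "x \<in> carrier (M n) \<Longrightarrow> \<eta> n x \<in> carrier (M' n)"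
  and hom_add: "\<lbrakk>x \<in> carrier (M n); y \<in> carrier (M n)\<rbrakk> \<Longrightarrow> \<eta> n (x \<oplus>\<^bsub>M n\<^esub> y) = \<eta> n x \<oplus>\<^bsub>M' n\<^esub> \<eta> n y"
  and hom_smult: "\<lbrakk>r \<in> carrier R; x \<in> carrier (M n)\<rbrakk> \<Longrightarrow> \<eta> n (r \<odot>\<^bsub>M n\<^esub> x) = r \<odot>\<^bsub>M' n\<^esub> \<eta> n x"
  and hom_act: "\<lbrakk>\<phi> \<in> UHom G os s t; x \<in> carrier (M s)\<rbrakk> \<Longrightarrow> \<eta> t (act s t \<phi> x) = act' s t \<phi> (\<eta> s x)"
  using ug_hom by (auto simp: ug_hom_def linear_map_def)

lemma hom_group: "abelian_group_hom (M n) (M' n) (\<eta> n)"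
  by (rule abelian_group_homI_add) (simp_all add: hom_add)

lemmas hom_zero = abelian_group_hom.hom_zero[OF hom_group]
  and hom_a_inv = abelian_group_hom.hom_a_inv[OF hom_group]

lemma hom_g_act: "\<lbrakk>g \<in> carrier (G n); x \<in> carrier (M n)\<rbrakk> \<Longrightarrow> \<eta> n (A.g_act n g x) = B.g_act n g (\<eta> n x)"
  by (simp add: A.g_act_eq B.g_act_eq hom_act)

lemma hom_sigma: "x \<in> carrier (M n) \<Longrightarrow> \<eta> (Suc n) (A.sigma n x) = B.sigma n (\<eta> n x)"
  by (simp add: minc_def hom_act)

lemma level_hom:
  "q \<le> n \<Longrightarrow> induced_hom (G n) (G (n - q)) (M (n - q)) (A.pad 0 (n - q) q) (A.g_act (n - q)) (M' (n - q))
    (B.g_act (n - q)) (\<eta> (n - q))"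
  by (intro induced_hom.intro induced_hom_axioms.intro A.level B.level) (simp_all add: hom_add hom_g_act)

abbreviation chain_map :: "nat \<Rightarrow> nat \<Rightarrow> ('g \<Rightarrow> 'x) \<Rightarrow> 'g \<Rightarrow> 'y" where
  "chain_map n q c \<equiv> \<lambda>g. \<eta> (n - q) (c g)"

lemma chain_map_tensor:
  "\<lbrakk>q \<le> n; g \<in> carrier (G n); x \<in> carrier (M (n - q))\<rbrakk>
    \<Longrightarrow> chain_map n q (A.tensor n q g x) = B.tensor n q g (\<eta> (n - q) x)"
  unfolding A.tensor_def B.tensor_def by (rule ext) (rule induced_hom.comp_tensor[OF level_hom])

lemma chain_map_hom: "abelian_group_hom (A.chain_group n q) (B.chain_group n q) (chain_map n q)"
proof (cases "q \<le> n")
  case True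
  then show ?thesis
    using induced_hom.comp_hom[OF level_hom] by (simp add: A.chain_group_level B.chain_group_level)
qed (rule A.hom_from_empty_chain_group, simp_all add: hom_zero)

lemma semisimplicial_chain_map:
  "semisimplicial_hom (A.chain_group n) (A.chain_face n) (B.chain_group n) (B.chain_face n) (chain_map n)"
proof (intro semisimplicial_hom.intro semisimplicial_hom_axioms.intro
    A.complex.semisimplicial_group_axioms B.complex.semisimplicial_group_axioms chain_map_hom)
  fix i q c assume i: "i \<le> q" and c: "c \<in> carrier (A.chain_group n (Suc q))"
  show "chain_map n q (A.chain_face n q i c) = B.chain_face n q i (chain_map n (Suc q) c)"
  proof (rule A.chain_hom_eqI[OF _ _ _ c])
    show "abelian_group_hom (A.chain_group n (Suc q)) (B.chain_group n q) (\<lambda>c. chain_map n q (A.chain_face n q i c))"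
      by (rule abelian_group_hom_compose[OF A.chain_face_hom[OF i] chain_map_hom])
    show "abelian_group_hom (A.chain_group n (Suc q)) (B.chain_group n q)
        (\<lambda>c. B.chain_face n q i (chain_map n (Suc q) c))"
      by (rule abelian_group_hom_compose[OF chain_map_hom B.chain_face_hom[OF i]])
  next
    fix g x assume "Suc q \<le> n" "g \<in> carrier (G n)" "x \<in> carrier (M (n - Suc q))"
    moreover from this have "n - q = Suc (n - Suc q)" by simp
    ultimately show "chain_map n q (A.chain_face n q i (A.tensor n (Suc q) g x))
        = B.chain_face n q i (chain_map n (Suc q) (A.tensor n (Suc q) g x))"
      using i chain_map_tensor[of q n "g \<otimes>\<^bsub>G n\<^esub> A.face_elt n q i" "A.sigma (n - Suc q) x"]
      by (simp add: A.chain_face_tensor B.chain_face_tensor chain_map_tensor hom_sigma)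
  qed
qed

lemma chain_map_inj:
  assumes "inj_on (\<eta> (n - q)) (carrier (M (n - q)))"
  shows "inj_on (chain_map n q) (carrier (A.chain_group n q))"
proof (cases "q \<le> n")
  case True
  then show ?thesis using induced_hom.comp_inj[OF level_hom assms] by (simp add: A.chain_group_level)
qed (simp add: A.chain_group_empty)

lemma chain_map_surj:
  assumes "q \<le> n \<Longrightarrow> \<eta> (n - q) ` carrier (M (n - q)) = carrier (M' (n - q))"
  shows "chain_map n q ` carrier (A.chain_group n q) = carrier (B.chain_group n q)"
proof (cases "q \<le> n")
  case True
  then show ?thesis
    using induced_hom.comp_surj[OF level_hom assms[OF True]] by (simp add: A.chain_group_level B.chain_group_level)
qed (simp add: A.chain_group_empty B.chain_group_empty hom_zero)

lemma exact_at_bij: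
  assumes "\<And>m. bij_betw (\<eta> m) (carrier (M m)) (carrier (M' m))" "A.complex.exact_at n q"
  shows "B.complex.exact_at n q"
  using semisimplicial_hom.exact_at_bij[OF semisimplicial_chain_map _ assms(2)] assms(1)
  by (simp add: bij_betw_def chain_map_inj chain_map_surj)

lemma exact_at_0_surj:
  assumes "\<And>m. \<eta> m ` carrier (M m) = carrier (M' m)" "A.complex.exact_at n 0"
  shows "B.complex.exact_at n 0"
  using semisimplicial_hom.exact_at_0_surj[OF semisimplicial_chain_map _ assms(2)] assms(1)
  by (simp add: chain_map_surj)

end

locale braided_ug_ses = I: braided_ug_hom G os b R K actK P actP \<kappa> + E: braided_ug_hom G os b R P actP V actV \<epsilon>
  for G :: "nat \<Rightarrow> 'g monoid" and os b and R :: "'r ring" and K :: "nat \<Rightarrow> ('r, 'x) module" and actK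
    and P :: "nat \<Rightarrow> ('r, 'y) module" and actP and V :: "nat \<Rightarrow> ('r, 'z) module" and actV \<kappa> \<epsilon> +
  assumes inj: "inj_on (\<kappa> n) (carrier (K n))"
    and surj: "\<epsilon> n ` carrier (P n) = carrier (V n)"
    and kernel: "\<kappa> n ` carrier (K n) = {x \<in> carrier (P n). \<epsilon> n x = \<zero>\<^bsub>V n\<^esub>}"
begin

lemma chain_map_kernel:
  "I.chain_map n q ` carrier (I.A.chain_group n q)
    = {c \<in> carrier (I.B.chain_group n q). E.chain_map n q c = \<zero>\<^bsub>E.B.chain_group n q\<^esub>}"
proof (cases "q \<le> n")
  case True
  interpret induced_hom_pair "G n" "G (n - q)" "K (n - q)" "I.A.pad 0 (n - q) q" "I.A.g_act (n - q)"
    "P (n - q)" "I.B.g_act (n - q)" "V (n - q)" "E.B.g_act (n - q)" "\<kappa> (n - q)" "\<epsilon> (n - q)"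
    by (intro induced_hom_pair.intro I.level_hom E.level_hom True)
  show ?thesis
    using comp_exact[OF kernel] True by (simp add: I.A.chain_group_level I.B.chain_group_level E.B.chain_group_level)
qed (auto simp: I.A.chain_group_empty I.B.chain_group_empty I.hom_zero E.hom_zero)

sublocale complex: semisimplicial_ses "I.A.chain_group n" "I.A.chain_face n" "I.B.chain_group n" "I.B.chain_face n"
    "E.B.chain_group n" "E.B.chain_face n" "I.chain_map n" "E.chain_map n" for n
  by (intro semisimplicial_ses.intro semisimplicial_ses_axioms.intro I.semisimplicial_chain_map
      E.semisimplicial_chain_map I.chain_map_inj inj E.chain_map_surj surj chain_map_kernel)

end

section \<open>Central stability homology as exactness of the complex\<close>

context braided_ug_module
begin

sublocale coefficients: coefficient_ring R
  by (rule coefficient_ring.intro[OF cring_R])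

abbreviation formal :: "nat \<Rightarrow> nat \<Rightarrow> ('r, 'g \<times> 'x \<Rightarrow> 'r) module" where
  "formal n p \<equiv> finsupp R (cs_gens G M p n)"

abbreviation relations :: "nat \<Rightarrow> nat \<Rightarrow> ('g \<times> 'x \<Rightarrow> 'r) set" where
  "relations n p \<equiv> coefficients.span (cs_rels G os R M act p n)"

lemma cs_gens_iff: "(g, x) \<in> cs_gens G M p n \<longleftrightarrow> Suc p \<le> n \<and> g \<in> carrier (G n) \<and> x \<in> carrier (M (n - Suc p))"
  by (simp add: cs_gens_def)

lemma realize_extension:
  "finsupp_extension R (chain_group n (Suc p)) (cs_gens G M p n) (\<lambda>(g, x) r. tensor n (Suc p) g (r \<odot>\<^bsub>M (n - Suc p)\<^esub> x))"
proof (intro finsupp_extension.intro finsupp_extension_axioms.intro coefficients.coefficient_ring_axioms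
    abelian_chain_group)
  fix k r r' assume k: "k \<in> cs_gens G M p n" and r: "r \<in> carrier R"
  obtain g x where k_eq: "k = (g, x)" by (cases k)
  show "(case k of (g, x) \<Rightarrow> \<lambda>r. tensor n (Suc p) g (r \<odot>\<^bsub>M (n - Suc p)\<^esub> x)) r \<in> carrier (chain_group n (Suc p))"
    using k r by (simp add: k_eq cs_gens_iff)
  assume "r' \<in> carrier R"
  then show "(case k of (g, x) \<Rightarrow> \<lambda>r. tensor n (Suc p) g (r \<odot>\<^bsub>M (n - Suc p)\<^esub> x)) (r \<oplus>\<^bsub>R\<^esub> r')
      = (case k of (g, x) \<Rightarrow> \<lambda>r. tensor n (Suc p) g (r \<odot>\<^bsub>M (n - Suc p)\<^esub> x)) r
        \<oplus>\<^bsub>chain_group n (Suc p)\<^esub> (case k of (g, x) \<Rightarrow> \<lambda>r. tensor n (Suc p) g (r \<odot>\<^bsub>M (n - Suc p)\<^esub> x)) r'"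
    using k r module.smult_l_distr[OF module_M] tensor_add
    by (simp add: k_eq cs_gens_iff del: chain_group_simps)
qed

abbreviation realize :: "nat \<Rightarrow> nat \<Rightarrow> ('g \<times> 'x \<Rightarrow> 'r) \<Rightarrow> 'g \<Rightarrow> 'x" where
  "realize n p \<equiv> finsupp_extension.extend R (chain_group n (Suc p))
     (\<lambda>(g, x) r. tensor n (Suc p) g (r \<odot>\<^bsub>M (n - Suc p)\<^esub> x))"

lemmas realize_hom = finsupp_extension.extend_hom[OF realize_extension]
  and realize_closed = finsupp_extension.extend_closed[OF realize_extension]
  and realize_add = finsupp_extension.extend_add[OF realize_extension]
  and realize_zero = finsupp_extension.extend_zero[OF realize_extension]

lemma realize_single:
  "\<lbrakk>(g, x) \<in> cs_gens G M p n; r \<in> carrier R\<rbrakk>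
    \<Longrightarrow> realize n p (coefficients.single (g, x) r) = tensor n (Suc p) g (r \<odot>\<^bsub>M (n - Suc p)\<^esub> x)"
  using finsupp_extension.extend_single[OF realize_extension, of "(g, x)" p n r] by simp

definition chain_of :: "nat \<Rightarrow> nat \<Rightarrow> ('r \<times> 'g \<times> 'x) list \<Rightarrow> 'g \<Rightarrow> 'x" where
  "chain_of n p L = realize n p (fs R L)"

lemma chain_of_closed [simp]: "valid R (cs_gens G M p n) L \<Longrightarrow> chain_of n p L \<in> carrier (chain_group n (Suc p))"
  by (simp add: chain_of_def realize_closed)

lemma chain_of_Nil [simp]: "chain_of n p [] = \<zero>\<^bsub>chain_group n (Suc p)\<^esub>"
  using realize_zero by (simp add: chain_of_def)

lemma chain_of_Cons:
  assumes "valid R (cs_gens G M p n) ((r, g, x) # L)"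
  shows "chain_of n p ((r, g, x) # L)
    = tensor n (Suc p) g (r \<odot>\<^bsub>M (n - Suc p)\<^esub> x) \<oplus>\<^bsub>chain_group n (Suc p)\<^esub> chain_of n p L"
proof -
  have "chain_of n p ((r, g, x) # L)
      = realize n p (coefficients.single (g, x) r \<oplus>\<^bsub>formal n p\<^esub> fs R L)"
    unfolding chain_of_def using coefficients.fs_Cons[OF assms] by (rule arg_cong)
  also have "\<dots> = realize n p (coefficients.single (g, x) r) \<oplus>\<^bsub>chain_group n (Suc p)\<^esub> chain_of n p L"
    unfolding chain_of_def by (rule realize_add) (use assms in simp_all)
  finally show ?thesis using assms by (simp add: realize_single)
qed

lemma chain_of_append:
  assumes "valid R (cs_gens G M p n) L" "valid R (cs_gens G M p n) L'"
  shows "chain_of n p (L @ L') = chain_of n p L \<oplus>\<^bsub>chain_group n (Suc p)\<^esub> chain_of n p L'"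
proof -
  have "chain_of n p (L @ L') = realize n p (fs R L \<oplus>\<^bsub>formal n p\<^esub> fs R L')"
    unfolding chain_of_def using coefficients.fs_append[OF assms] by (rule arg_cong)
  also have "\<dots> = chain_of n p L \<oplus>\<^bsub>chain_group n (Suc p)\<^esub> chain_of n p L'"
    unfolding chain_of_def by (rule realize_add) (use assms in simp_all)
  finally show ?thesis .
qed

lemma chain_of_surj:
  assumes "c \<in> carrier (chain_group n (Suc p))"
  obtains L where "valid R (cs_gens G M p n) L" "chain_of n p L = c"
proof -
  have "\<exists>L. valid R (cs_gens G M p n) L \<and> chain_of n p L = c"
    using assms
  proof (induction rule: chain_induct)
    case zero
    show ?case by (intro exI[of _ "[]"]) simp
  next
    case (add g x c)
    then obtain L where L: "valid R (cs_gens G M p n) L" "chain_of n p L = c" by blast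
    then show ?case
      using add(1-3) chain_of_Cons[of p n "\<one>\<^bsub>R\<^esub>" g x L]
      by (intro exI[of _ "(\<one>\<^bsub>R\<^esub>, g, x) # L"]) (simp add: cs_gens_iff module.smult_one[OF module_M])
  qed
  then show thesis using that by blast
qed

lemma cs_rels_valid: "\<forall>s\<in>cs_rels G os R M act p n. valid R (cs_gens G M p n) s"
  by (auto simp: cs_rels_def cs_gens_iff)

lemma cs_rels_add:
  "\<lbrakk>(g, x) \<in> cs_gens G M p n; (g, y) \<in> cs_gens G M p n\<rbrakk>
    \<Longrightarrow> [(\<one>\<^bsub>R\<^esub>, g, x \<oplus>\<^bsub>M (n - Suc p)\<^esub> y), (\<ominus>\<^bsub>R\<^esub> \<one>\<^bsub>R\<^esub>, g, x), (\<ominus>\<^bsub>R\<^esub> \<one>\<^bsub>R\<^esub>, g, y)] \<in> cs_rels G os R M act p n"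
  unfolding cs_rels_def by (rule UnI1, rule UnI1) (force simp: cs_gens_iff)

lemma cs_rels_smult:
  "\<lbrakk>(g, x) \<in> cs_gens G M p n; r \<in> carrier R\<rbrakk>
    \<Longrightarrow> [(\<one>\<^bsub>R\<^esub>, g, r \<odot>\<^bsub>M (n - Suc p)\<^esub> x), (\<ominus>\<^bsub>R\<^esub> r, g, x)] \<in> cs_rels G os R M act p n"
  unfolding cs_rels_def by (rule UnI1, rule UnI2, intro CollectI exI conjI) auto

lemma cs_rels_act:
  "\<lbrakk>(g, x) \<in> cs_gens G M p n; h \<in> carrier (G (n - Suc p))\<rbrakk>
    \<Longrightarrow> [(\<one>\<^bsub>R\<^esub>, g \<otimes>\<^bsub>G n\<^esub> pad 0 (n - Suc p) (Suc p) h, x), (\<ominus>\<^bsub>R\<^esub> \<one>\<^bsub>R\<^esub>, g, g_act (n - Suc p) h x)]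
      \<in> cs_rels G os R M act p n"
  unfolding cs_rels_def by (rule UnI2, intro CollectI exI conjI) (auto simp: os_one_right)

lemma cs_rels_cases [consumes 1, case_names add smult act]:
  assumes "s \<in> cs_rels G os R M act p n"
  obtains g x y where "(g, x) \<in> cs_gens G M p n" "(g, y) \<in> cs_gens G M p n"
      "s = [(\<one>\<^bsub>R\<^esub>, g, x \<oplus>\<^bsub>M (n - Suc p)\<^esub> y), (\<ominus>\<^bsub>R\<^esub> \<one>\<^bsub>R\<^esub>, g, x), (\<ominus>\<^bsub>R\<^esub> \<one>\<^bsub>R\<^esub>, g, y)]"
  | g x r where "(g, x) \<in> cs_gens G M p n" "r \<in> carrier R" "s = [(\<one>\<^bsub>R\<^esub>, g, r \<odot>\<^bsub>M (n - Suc p)\<^esub> x), (\<ominus>\<^bsub>R\<^esub> r, g, x)]"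
  | g h x where "(g, x) \<in> cs_gens G M p n" "h \<in> carrier (G (n - Suc p))"
      "s = [(\<one>\<^bsub>R\<^esub>, g \<otimes>\<^bsub>G n\<^esub> pad 0 (n - Suc p) (Suc p) h, x), (\<ominus>\<^bsub>R\<^esub> \<one>\<^bsub>R\<^esub>, g, g_act (n - Suc p) h x)]"
  using assms unfolding cs_rels_def by (auto simp: os_one_right)

lemma chain_of_Cons_same:
  assumes "valid R (cs_gens G M p n) ((r, g, x) # L)" "chain_of n p L = tensor n (Suc p) g y"
      "y \<in> carrier (M (n - Suc p))"
  shows "chain_of n p ((r, g, x) # L) = tensor n (Suc p) g (r \<odot>\<^bsub>M (n - Suc p)\<^esub> x \<oplus>\<^bsub>M (n - Suc p)\<^esub> y)"
  using assms tensor_add[of "Suc p" n g "r \<odot>\<^bsub>M (n - Suc p)\<^esub> x" y]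
  by (simp add: chain_of_Cons cs_gens_iff del: chain_group_simps)

lemma chain_of_Nil_tensor: "(g, x) \<in> cs_gens G M p n \<Longrightarrow> chain_of n p [] = tensor n (Suc p) g \<zero>\<^bsub>M (n - Suc p)\<^esub>"
  using tensor_zero[of "Suc p" n g] by (simp add: cs_gens_iff)

lemma chain_of_cancel:
  assumes "(g, x) \<in> cs_gens G M p n"
  shows "chain_of n p [(\<one>\<^bsub>R\<^esub>, g, x), (\<ominus>\<^bsub>R\<^esub> \<one>\<^bsub>R\<^esub>, g, x)] = \<zero>\<^bsub>chain_group n (Suc p)\<^esub>"
proof -
  let ?M = "M (n - Suc p)"
  interpret M: module R ?M by (rule module_M)
  have "chain_of n p [(\<one>\<^bsub>R\<^esub>, g, x), (\<ominus>\<^bsub>R\<^esub> \<one>\<^bsub>R\<^esub>, g, x)]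
      = tensor n (Suc p) g (\<one>\<^bsub>R\<^esub> \<odot>\<^bsub>?M\<^esub> x \<oplus>\<^bsub>?M\<^esub> (\<ominus>\<^bsub>R\<^esub> \<one>\<^bsub>R\<^esub> \<odot>\<^bsub>?M\<^esub> x \<oplus>\<^bsub>?M\<^esub> \<zero>\<^bsub>?M\<^esub>))"
    using chain_of_Cons_same[OF _ chain_of_Cons_same[OF _ chain_of_Nil_tensor[OF assms]]] assms
    by (simp add: cs_gens_iff)
  then show ?thesis using assms tensor_zero[of "Suc p" n g] by (simp add: cs_gens_iff M.smult_l_minus M.M.r_neg)
qed

lemma chain_of_rel:
  assumes "s \<in> cs_rels G os R M act p n"
  shows "chain_of n p s = \<zero>\<^bsub>chain_group n (Suc p)\<^esub>"
proof -
  let ?M = "M (n - Suc p)"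
  interpret M: module R ?M by (rule module_M)
  note valid = bspec[OF cs_rels_valid assms]
  show ?thesis using assms
  proof (cases rule: cs_rels_cases)
    case (add g x y)
    then have "chain_of n p s = tensor n (Suc p) g
        (\<one>\<^bsub>R\<^esub> \<odot>\<^bsub>?M\<^esub> (x \<oplus>\<^bsub>?M\<^esub> y) \<oplus>\<^bsub>?M\<^esub> (\<ominus>\<^bsub>R\<^esub> \<one>\<^bsub>R\<^esub> \<odot>\<^bsub>?M\<^esub> x \<oplus>\<^bsub>?M\<^esub> (\<ominus>\<^bsub>R\<^esub> \<one>\<^bsub>R\<^esub> \<odot>\<^bsub>?M\<^esub> y \<oplus>\<^bsub>?M\<^esub> \<zero>\<^bsub>?M\<^esub>)))"
      using chain_of_Cons_same[OF _ chain_of_Cons_same[OF _ chain_of_Cons_same[OF _ chain_of_Nil_tensor[OF add(1)]]]]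
      by (simp add: cs_gens_iff)
    moreover have "\<one>\<^bsub>R\<^esub> \<odot>\<^bsub>?M\<^esub> (x \<oplus>\<^bsub>?M\<^esub> y) \<oplus>\<^bsub>?M\<^esub> (\<ominus>\<^bsub>R\<^esub> \<one>\<^bsub>R\<^esub> \<odot>\<^bsub>?M\<^esub> x \<oplus>\<^bsub>?M\<^esub> (\<ominus>\<^bsub>R\<^esub> \<one>\<^bsub>R\<^esub> \<odot>\<^bsub>?M\<^esub> y \<oplus>\<^bsub>?M\<^esub> \<zero>\<^bsub>?M\<^esub>)) = \<zero>\<^bsub>?M\<^esub>"
      using add by (simp add: cs_gens_iff M.smult_l_minus M.M.minus_add[symmetric] M.M.r_neg)
    ultimately show ?thesis using tensor_zero[of "Suc p" n g] add(1) by (simp add: cs_gens_iff)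
  next
    case (smult g x r)
    then have "chain_of n p s = tensor n (Suc p) g
        (\<one>\<^bsub>R\<^esub> \<odot>\<^bsub>?M\<^esub> (r \<odot>\<^bsub>?M\<^esub> x) \<oplus>\<^bsub>?M\<^esub> (\<ominus>\<^bsub>R\<^esub> r \<odot>\<^bsub>?M\<^esub> x \<oplus>\<^bsub>?M\<^esub> \<zero>\<^bsub>?M\<^esub>))"
      using chain_of_Cons_same[OF _ chain_of_Cons_same[OF _ chain_of_Nil_tensor[OF smult(1)]]]
      by (simp add: cs_gens_iff)
    moreover have "\<one>\<^bsub>R\<^esub> \<odot>\<^bsub>?M\<^esub> (r \<odot>\<^bsub>?M\<^esub> x) \<oplus>\<^bsub>?M\<^esub> (\<ominus>\<^bsub>R\<^esub> r \<odot>\<^bsub>?M\<^esub> x \<oplus>\<^bsub>?M\<^esub> \<zero>\<^bsub>?M\<^esub>) = \<zero>\<^bsub>?M\<^esub>"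
      using smult by (simp add: cs_gens_iff M.smult_l_minus M.M.r_neg)
    ultimately show ?thesis using tensor_zero[of "Suc p" n g] smult(1) by (simp add: cs_gens_iff)
  next
    case (act g h x)
    let ?hx = "g_act (n - Suc p) h x"
    have hx: "(g, ?hx) \<in> cs_gens G M p n" using act by (simp add: cs_gens_iff)
    have "tensor n (Suc p) (g \<otimes>\<^bsub>G n\<^esub> pad 0 (n - Suc p) (Suc p) h) x = tensor n (Suc p) g ?hx"
      using act by (intro tensor_mult_pad) (simp_all add: cs_gens_iff)
    then have "chain_of n p s = chain_of n p [(\<one>\<^bsub>R\<^esub>, g, ?hx), (\<ominus>\<^bsub>R\<^esub> \<one>\<^bsub>R\<^esub>, g, ?hx)]"
      using act hx valid by (simp add: chain_of_Cons cs_gens_iff M.smult_one del: chain_group_simps)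
    then show ?thesis using chain_of_cancel[OF hx] by simp
  qed
qed

lemma tensor_smult:
  assumes "q \<le> n" "g \<in> carrier (G n)" "r \<in> carrier R" "x \<in> carrier (M (n - q))"
  shows "tensor n q g (r \<odot>\<^bsub>M (n - q)\<^esub> x) g' = r \<odot>\<^bsub>M (n - q)\<^esub> tensor n q g x g'"
  unfolding tensor_def
  by (rule induced_module.tensor_cases[OF level[OF assms(1)] assms(2), of g'])
    (use assms module.smult_r_null[OF module_M] in \<open>simp_all add: g_act_smult\<close>)

lemma realize_smult:
  assumes "c \<in> carrier (formal n p)" "r \<in> carrier R"
  shows "realize n p (r \<odot>\<^bsub>formal n p\<^esub> c) g' = r \<odot>\<^bsub>M (n - Suc p)\<^esub> realize n p c g'"
proof (rule coefficients.finsupp_hom_eqI[OF _ _ _ assms(1)])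
  interpret M: module R "M (n - Suc p)" by (rule module_M)
  have eval: "abelian_group_hom (formal n p) (M (n - Suc p)) (\<lambda>c. realize n p c g')"
    by (rule abelian_group_hom_compose[OF realize_hom chain_value_hom])
  show "abelian_group_hom (formal n p) (M (n - Suc p)) (\<lambda>c. realize n p (r \<odot>\<^bsub>formal n p\<^esub> c) g')"
    by (rule abelian_group_hom_compose[OF module.smult_hom[OF coefficients.module_finsupp assms(2)] eval])
  show "abelian_group_hom (formal n p) (M (n - Suc p)) (\<lambda>c. r \<odot>\<^bsub>M (n - Suc p)\<^esub> realize n p c g')"
    by (rule abelian_group_hom_compose[OF eval M.smult_hom[OF assms(2)]])
  fix k a assume k: "k \<in> cs_gens G M p n" and a: "a \<in> carrier R"
  obtain g x where gx: "k = (g, x)" by (cases k)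
  then have "Suc p \<le> n" "g \<in> carrier (G n)" "x \<in> carrier (M (n - Suc p))" using k by (simp_all add: cs_gens_iff)
  then show "realize n p (r \<odot>\<^bsub>formal n p\<^esub> coefficients.single k a) g'
      = r \<odot>\<^bsub>M (n - Suc p)\<^esub> realize n p (coefficients.single k a) g'"
    unfolding coefficients.smult_single[OF assms(2)] gx
    using k a assms(2) gx by (simp add: realize_single tensor_smult M.smult_assoc1)
qed

lemma realize_span:
  assumes "c \<in> relations n p"
  shows "realize n p c = \<zero>\<^bsub>chain_group n (Suc p)\<^esub>"
  using assms
proof (induction rule: coefficients.span_induct[OF cs_rels_valid, consumes 1, case_names zero add])
  case zero
  show ?case by (rule realize_zero)
next
  case (add r s c)
  interpret F: module R "formal n p" by (rule coefficients.module_finsupp)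
  interpret C: abelian_group "chain_group n (Suc p)" by simp
  have s: "fs R s \<in> carrier (formal n p)" using bspec[OF cs_rels_valid add(2)] by simp
  have "realize n p (fs R s) = \<zero>\<^bsub>chain_group n (Suc p)\<^esub>"
    using chain_of_rel[OF add(2)] by (simp add: chain_of_def)
  then have "realize n p (r \<odot>\<^bsub>formal n p\<^esub> fs R s) = \<zero>\<^bsub>chain_group n (Suc p)\<^esub>"
    using realize_smult[OF s add(1)] module.smult_r_null[OF module_M] add(1) by (auto simp: fun_eq_iff)
  moreover have "realize n p (r \<odot>\<^bsub>formal n p\<^esub> fs R s \<oplus>\<^bsub>formal n p\<^esub> c)
      = realize n p (r \<odot>\<^bsub>formal n p\<^esub> fs R s) \<oplus>\<^bsub>chain_group n (Suc p)\<^esub> realize n p c"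
    using coefficients.span_closed[OF cs_rels_valid add(3)] s add(1) by (intro realize_add F.smult_closed)
  ultimately show ?case using add(4) C.l_zero[OF C.zero_closed] by (simp only:)
qed

lemma relations_subgroup: "abelian_subgroup (relations n p) (formal n p)"
  by (rule coefficients.abelian_subgroup_span[OF cs_rels_valid])

abbreviation generator_class :: "nat \<Rightarrow> nat \<Rightarrow> 'g \<Rightarrow> 'x \<Rightarrow> ('g \<times> 'x \<Rightarrow> 'r) set" where
  "generator_class n p g x \<equiv> relations n p +>\<^bsub>formal n p\<^esub> coefficients.single (g, x) \<one>\<^bsub>R\<^esub>"

lemma class_eqI:
  assumes c: "c \<in> carrier (formal n p)" and d: "d \<in> carrier (formal n p)" and diff: "c \<ominus>\<^bsub>formal n p\<^esub> d \<in> relations n p"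
  shows "relations n p +>\<^bsub>formal n p\<^esub> c = relations n p +>\<^bsub>formal n p\<^esub> d"
proof -
  interpret B: abelian_subgroup "relations n p" "formal n p" by (rule relations_subgroup)
  have "c \<in> relations n p +>\<^bsub>formal n p\<^esub> d"
    using B.a_rcos_module[OF d c] diff by (simp add: a_minus_def)
  then show ?thesis using B.a_repr_independence'[OF _ d] by simp
qed

lemma class_eq_if_rel:
  assumes "[(r, k), (\<ominus>\<^bsub>R\<^esub> r', k')] \<in> cs_rels G os R M act p n" "r' \<in> carrier R"
  shows "relations n p +>\<^bsub>formal n p\<^esub> coefficients.single k r = relations n p +>\<^bsub>formal n p\<^esub> coefficients.single k' r'"
proof (rule class_eqI)
  have valid: "k \<in> cs_gens G M p n" "k' \<in> cs_gens G M p n" "r \<in> carrier R"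
    using bspec[OF cs_rels_valid assms(1)] by simp_all
  show closed: "coefficients.single k r \<in> carrier (formal n p)" "coefficients.single k' r' \<in> carrier (formal n p)"
    using valid assms(2) by simp_all
  show "coefficients.single k r \<ominus>\<^bsub>formal n p\<^esub> coefficients.single k' r' \<in> relations n p"
  proof -
    have "fs R ([(r, k)] @ [(\<ominus>\<^bsub>R\<^esub> r', k')]) = coefficients.single k r \<oplus>\<^bsub>formal n p\<^esub> coefficients.single k' (\<ominus>\<^bsub>R\<^esub> r')"
      using valid assms(2) coefficients.fs_append[of "cs_gens G M p n" "[(r, k)]" "[(\<ominus>\<^bsub>R\<^esub> r', k')]"]
        coefficients.fs_singleton[OF valid(1,3)] coefficients.fs_singleton[OF valid(2), of "\<ominus>\<^bsub>R\<^esub> r'"]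
      by (simp del: coefficients.finsupp_simps)
    also have "\<dots> = coefficients.single k r \<ominus>\<^bsub>formal n p\<^esub> coefficients.single k' r'"
      using abelian_group_hom.hom_a_inv[OF coefficients.single_hom[OF valid(2)] assms(2)] by (simp add: a_minus_def)
    finally show ?thesis
      using coefficients.generator_in_span[OF cs_rels_valid assms(1)] by simp
  qed
qed

lemma class_hom: "(\<lambda>c. relations n p +>\<^bsub>formal n p\<^esub> c) \<in> hom (add_monoid (formal n p)) (formal n p A_Mod relations n p)"
  by (rule abelian_subgroup.a_r_coset_hom_A_Mod[OF relations_subgroup])

lemma class_sum:
  "\<lbrakk>c \<in> carrier (formal n p); d \<in> carrier (formal n p)\<rbrakk>
    \<Longrightarrow> relations n p +>\<^bsub>formal n p\<^esub> (c \<oplus>\<^bsub>formal n p\<^esub> d)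
      = (relations n p +>\<^bsub>formal n p\<^esub> c) <+>\<^bsub>formal n p\<^esub> (relations n p +>\<^bsub>formal n p\<^esub> d)"
  using abelian_subgroup.a_rcos_sum[OF relations_subgroup] by simp

lemma class_add:
  assumes "(g, x) \<in> cs_gens G M p n" "(g, y) \<in> cs_gens G M p n"
  shows "generator_class n p g (x \<oplus>\<^bsub>M (n - Suc p)\<^esub> y)
    = generator_class n p g x <+>\<^bsub>formal n p\<^esub> generator_class n p g y"
proof -
  interpret F: abelian_group "formal n p" by (rule coefficients.abelian_finsupp)
  let ?one = "\<lambda>x. coefficients.single (g, x) \<one>\<^bsub>R\<^esub>" and ?xy = "x \<oplus>\<^bsub>M (n - Suc p)\<^esub> y"
  have gens: "(g, ?xy) \<in> cs_gens G M p n" using assms by (simp add: cs_gens_iff)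
  have closed: "?one x \<in> carrier (formal n p)" "?one y \<in> carrier (formal n p)" "?one ?xy \<in> carrier (formal n p)"
    using assms gens by simp_all
  have inv: "coefficients.single (g, z) (\<ominus>\<^bsub>R\<^esub> \<one>\<^bsub>R\<^esub>) = \<ominus>\<^bsub>formal n p\<^esub> ?one z" if "(g, z) \<in> cs_gens G M p n" for z
    using abelian_group_hom.hom_a_inv[OF coefficients.single_hom[OF that] coefficients.one_closed] .
  have "fs R ([(\<one>\<^bsub>R\<^esub>, g, ?xy)] @ [(\<ominus>\<^bsub>R\<^esub> \<one>\<^bsub>R\<^esub>, g, x)] @ [(\<ominus>\<^bsub>R\<^esub> \<one>\<^bsub>R\<^esub>, g, y)])
      = ?one ?xy \<oplus>\<^bsub>formal n p\<^esub> (\<ominus>\<^bsub>formal n p\<^esub> ?one x \<oplus>\<^bsub>formal n p\<^esub> \<ominus>\<^bsub>formal n p\<^esub> ?one y)"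
    using assms gens coefficients.fs_append[of "cs_gens G M p n"] coefficients.fs_singleton[of _ "cs_gens G M p n"] inv
    by (simp del: coefficients.finsupp_simps append_Cons)
  also have "\<dots> = ?one ?xy \<ominus>\<^bsub>formal n p\<^esub> (?one x \<oplus>\<^bsub>formal n p\<^esub> ?one y)"
    using closed by (simp add: a_minus_def F.minus_add del: coefficients.finsupp_simps)
  finally have "?one ?xy \<ominus>\<^bsub>formal n p\<^esub> (?one x \<oplus>\<^bsub>formal n p\<^esub> ?one y) \<in> relations n p"
    using coefficients.generator_in_span[OF cs_rels_valid cs_rels_add[OF assms]] by simp
  then have "generator_class n p g ?xy = relations n p +>\<^bsub>formal n p\<^esub> (?one x \<oplus>\<^bsub>formal n p\<^esub> ?one y)"
    using closed by (intro class_eqI F.a_closed)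
  then show ?thesis using class_sum closed by simp
qed

lemma class_smult:
  assumes "(g, x) \<in> cs_gens G M p n" "r \<in> carrier R"
  shows "generator_class n p g (r \<odot>\<^bsub>M (n - Suc p)\<^esub> x) = relations n p +>\<^bsub>formal n p\<^esub> coefficients.single (g, x) r"
  using assms by (intro class_eq_if_rel cs_rels_smult) simp_all

lemma class_act:
  assumes "(g, x) \<in> cs_gens G M p n" "h \<in> carrier (G (n - Suc p))"
  shows "generator_class n p (g \<otimes>\<^bsub>G n\<^esub> pad 0 (n - Suc p) (Suc p) h) x = generator_class n p g (g_act (n - Suc p) h x)"
  using assms by (intro class_eq_if_rel cs_rels_act) simp_all

lemma generator_class_balanced:
  assumes p: "Suc p \<le> n"
  shows "balanced_map (G n) (G (n - Suc p)) (M (n - Suc p)) (pad 0 (n - Suc p) (Suc p)) (g_act (n - Suc p))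
    (formal n p A_Mod relations n p) (generator_class n p)"
proof -
  interpret B: abelian_subgroup "relations n p" "formal n p" by (rule relations_subgroup)
  show ?thesis
  proof (intro balanced_map.intro balanced_map_axioms.intro level[OF p] B.a_factorgroup_is_comm_group)
    show "generator_class n p g x \<in> carrier (formal n p A_Mod relations n p)"
      if "g \<in> carrier (G n)" "x \<in> carrier (M (n - Suc p))" for g x
      using that p hom_in_carrier[OF B.a_r_coset_hom_A_Mod] by (simp add: cs_gens_iff)
  qed (use p in \<open>simp_all add: class_add class_act cs_gens_iff\<close>)
qed

abbreviation class_extension :: "nat \<Rightarrow> nat \<Rightarrow> ('g \<Rightarrow> 'x) \<Rightarrow> ('g \<times> 'x \<Rightarrow> 'r) set" where
  "class_extension n p \<equiv> balanced_map.extension (G n) (G (n - Suc p)) (M (n - Suc p)) (pad 0 (n - Suc p) (Suc p))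
     (g_act (n - Suc p)) (formal n p A_Mod relations n p) (generator_class n p)"

lemma class_extension_hom:
  assumes "Suc p \<le> n"
  shows "group_hom (add_monoid (chain_group n (Suc p))) (formal n p A_Mod relations n p) (class_extension n p)"
proof (intro group_hom.intro group_hom_axioms.intro abelian_group.a_group abelian_chain_group
    abelian_subgroup.a_factorgroup_is_group relations_subgroup)
  show "class_extension n p \<in> hom (add_monoid (chain_group n (Suc p))) (formal n p A_Mod relations n p)"
    using balanced_map.extension_hom[OF generator_class_balanced[OF assms]] assms by (simp only: chain_group_level)
qed

lemma class_extension_single:
  assumes p: "Suc p \<le> n" and k: "k \<in> cs_gens G M p n" and r: "r \<in> carrier R"
  shows "class_extension n p (realize n p (coefficients.single k r))
      = relations n p +>\<^bsub>formal n p\<^esub> coefficients.single k r"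
proof -
  obtain g x where k_eq: "k = (g, x)" by (cases k)
  have gx: "(g, x) \<in> cs_gens G M p n" "g \<in> carrier (G n)" "r \<odot>\<^bsub>M (n - Suc p)\<^esub> x \<in> carrier (M (n - Suc p))"
    using k r by (auto simp: k_eq cs_gens_iff)
  have "class_extension n p (realize n p (coefficients.single k r)) = generator_class n p g (r \<odot>\<^bsub>M (n - Suc p)\<^esub> x)"
    unfolding k_eq realize_single[OF gx(1) r]
    using balanced_map.extension_tensor[OF generator_class_balanced[OF p] gx(2,3)] by (simp only: tensor_def)
  also have "\<dots> = relations n p +>\<^bsub>formal n p\<^esub> coefficients.single k r"
    unfolding k_eq by (rule class_smult[OF gx(1) r])
  finally show ?thesis .
qed

lemma class_extension_realize:
  assumes p: "Suc p \<le> n" and c: "c \<in> carrier (formal n p)"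
  shows "class_extension n p (realize n p c) = relations n p +>\<^bsub>formal n p\<^esub> c"
  using c
proof (induction rule: coefficients.finsupp_induct)
  interpret E: group_hom "add_monoid (chain_group n (Suc p))" "formal n p A_Mod relations n p" "class_extension n p"
    by (rule class_extension_hom[OF p])
  interpret C: group_hom "add_monoid (formal n p)" "formal n p A_Mod relations n p" "\<lambda>c. relations n p +>\<^bsub>formal n p\<^esub> c"
    by (intro group_hom.intro group_hom_axioms.intro abelian_group.a_group
        coefficients.abelian_finsupp E.H.is_group class_hom)
  {
    case zero
    show ?case using E.hom_one C.hom_one realize_zero[of n p]
      by (simp del: coefficients.finsupp_simps chain_group_simps)
  next
    case (add k r c)
    have single: "coefficients.single k r \<in> carrier (formal n p)" using add(1,2) by simp
    show ?case
      using E.hom_mult[of "realize n p (coefficients.single k r)" "realize n p c"]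
        C.hom_mult[of "coefficients.single k r" c]
        class_extension_single[OF p add(1,2)] realize_add[OF single add(3)] realize_closed[OF single]
        realize_closed[OF add(3)] add(4) single add(3)
      by (simp del: coefficients.finsupp_simps chain_group_simps)
  }
qed

lemma realize_eq_zero_imp_relation:
  assumes c: "c \<in> carrier (formal n p)" and zero: "realize n p c = \<zero>\<^bsub>chain_group n (Suc p)\<^esub>"
  shows "c \<in> relations n p"
proof (cases "Suc p \<le> n")
  case True
  have "relations n p +>\<^bsub>formal n p\<^esub> c = class_extension n p \<zero>\<^bsub>chain_group n (Suc p)\<^esub>"
    using class_extension_realize[OF True c] unfolding zero by (rule sym)
  also have "\<dots> = \<one>\<^bsub>formal n p A_Mod relations n p\<^esub>"
    using group_hom.hom_one[OF class_extension_hom[OF True]] by (simp del: chain_group_simps)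
  finally have "relations n p +>\<^bsub>formal n p\<^esub> c = relations n p" by (simp add: A_FactGroup_def FactGroup_def)
  with abelian_subgroup.a_rcos_self[OF relations_subgroup c] show ?thesis by (simp only:)
next
  case False
  have "c = \<zero>\<^bsub>formal n p\<^esub>"
  proof -
    have "cs_gens G M p n = {}" using False by (auto simp: cs_gens_iff)
    then have "coefficients.support c \<subseteq> {}" using c unfolding coefficients.finsupp_carrier_iff by blast
    then show ?thesis by (simp add: coefficients.support_def fun_eq_iff)
  qed
  then show ?thesis
    using additive_subgroup.zero_closed[OF abelian_subgroup.axioms(1)[OF relations_subgroup], of p n]
    by (simp only:)
qed

lemma cs_eq_iff:
  assumes L: "valid R (cs_gens G M p n) L" and L': "valid R (cs_gens G M p n) L'"
  shows "cs_eq G os R M act p n L L' \<longleftrightarrow> chain_of n p L = chain_of n p L'"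
proof -
  interpret F: module R "formal n p" by (rule coefficients.module_finsupp)
  interpret H: abelian_group_hom "formal n p" "chain_group n (Suc p)" "realize n p" by (rule realize_hom)
  let ?L' = "map (\<lambda>(r, k). (\<ominus>\<^bsub>R\<^esub> r, k)) L'"
  have "?L' = coefficients.scale (\<ominus>\<^bsub>R\<^esub> \<one>\<^bsub>R\<^esub>) L'"
    using L' by (auto simp: coefficients.scale_def valid_def coefficients.l_minus)
  then have neg: "valid R (cs_gens G M p n) ?L'" "fs R ?L' = \<ominus>\<^bsub>formal n p\<^esub> fs R L'"
    using L' coefficients.fs_scale[OF L', of "\<ominus>\<^bsub>R\<^esub> \<one>\<^bsub>R\<^esub>"]
    by (simp_all add: F.smult_l_minus del: coefficients.finsupp_simps)
  have diff: "fs R (L @ ?L') = fs R L \<ominus>\<^bsub>formal n p\<^esub> fs R L'"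
    using coefficients.fs_append[OF L neg(1)] neg(2) by (simp add: a_minus_def)
  have "cs_eq G os R M act p n L L' \<longleftrightarrow> fs R L \<ominus>\<^bsub>formal n p\<^esub> fs R L' \<in> relations n p"
    by (simp add: cs_eq_def coefficients.in_span_iff diff)
  also have "\<dots> \<longleftrightarrow> realize n p (fs R L \<ominus>\<^bsub>formal n p\<^esub> fs R L') = \<zero>\<^bsub>chain_group n (Suc p)\<^esub>"
    using realize_span realize_eq_zero_imp_relation[OF F.M.minus_closed] L L' coefficients.fs_closed by metis
  also have "realize n p (fs R L \<ominus>\<^bsub>formal n p\<^esub> fs R L') = chain_of n p L \<ominus>\<^bsub>chain_group n (Suc p)\<^esub> chain_of n p L'"
    using L L' by (simp add: H.hom_minus chain_of_def)
  also have "\<dots> = \<zero>\<^bsub>chain_group n (Suc p)\<^esub> \<longleftrightarrow> chain_of n p L = chain_of n p L'"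
    using chain_of_closed[OF L] chain_of_closed[OF L']
    by (metis H.H.a_inv_closed H.H.minus_equality H.H.minus_minus H.H.r_neg a_minus_def)
  finally show ?thesis .
qed

lemma chain_of_map_upt:
  assumes "\<And>i. i < m \<Longrightarrow> s i \<in> carrier R \<and> (g i, x i) \<in> cs_gens G M p n"
  shows "chain_of n p (map (\<lambda>i. (s i, g i, x i)) [0..<m])
    = (\<Oplus>\<^bsub>chain_group n (Suc p)\<^esub>i\<in>{..<m}. tensor n (Suc p) (g i) (s i \<odot>\<^bsub>M (n - Suc p)\<^esub> x i))"
  using assms
proof (induction m)
  interpret C: abelian_group "chain_group n (Suc p)" by simp
  {
    case 0
    show ?case by (simp only: chain_of_Nil upt_0 list.map lessThan_0 C.finsum_empty)
  next
    case (Suc m)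
    have gen: "s i \<in> carrier R" "(g i, x i) \<in> cs_gens G M p n"
        "tensor n (Suc p) (g i) (s i \<odot>\<^bsub>M (n - Suc p)\<^esub> x i) \<in> carrier (chain_group n (Suc p))" if "i \<le> m" for i
      using Suc.prems[of i] that by (simp_all add: cs_gens_iff)
    have "valid R (cs_gens G M p n) (map (\<lambda>i. (s i, g i, x i)) [0..<m])" using Suc.prems by (auto simp: valid_def)
    then show ?case
      using Suc.IH Suc.prems gen
        chain_of_append[of p n "map (\<lambda>i. (s i, g i, x i)) [0..<m]" "[(s m, g m, x m)]"]
      by (simp add: chain_of_Cons lessThan_Suc C.finsum_insert Pi_iff C.r_zero del: chain_group_simps)
        (intro C.a_comm C.finsum_closed; simp add: Pi_iff)
  }
qed

lemma cs_d_Cons: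
  "cs_d G os b R act p n ((r, g, x) # L) = map (\<lambda>i. (if even i then r else \<ominus>\<^bsub>R\<^esub> r,
      g \<otimes>\<^bsub>G n\<^esub> face_elt n p i, sigma (n - Suc p) x)) [0..<Suc p] @ cs_d G os b R act p n L"
  by (simp add: cs_d_def)

lemma face_gens:
  assumes "(g, x) \<in> cs_gens G M (Suc p) n" "i \<le> Suc p"
  shows "(g \<otimes>\<^bsub>G n\<^esub> face_elt n (Suc p) i, sigma (n - Suc (Suc p)) x) \<in> cs_gens G M p n"
proof -
  have "n - Suc p = Suc (n - Suc (Suc p))" using assms(1) by (auto simp: cs_gens_iff)
  then show ?thesis using assms by (simp add: cs_gens_iff)
qed

lemma cs_d_valid [simp]:
  "valid R (cs_gens G M (Suc p) n) L \<Longrightarrow> valid R (cs_gens G M p n) (cs_d G os b R act (Suc p) n L)"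
proof (induction L)
  case (Cons t L)
  then show ?case
    using face_gens by (cases t) (auto simp: cs_d_Cons valid_def cring.cring_simprules(3)[OF cring_R] simp del: upt_Suc)
qed (simp add: cs_d_def)

lemma chain_of_faces:
  assumes gx: "(g, x) \<in> cs_gens G M (Suc p) n" and r: "r \<in> carrier R"
  shows "chain_of n p (map (\<lambda>i. (if even i then r else \<ominus>\<^bsub>R\<^esub> r, g \<otimes>\<^bsub>G n\<^esub> face_elt n (Suc p) i,
      sigma (n - Suc (Suc p)) x)) [0..<Suc (Suc p)])
    = complex.boundary n (Suc p) (tensor n (Suc (Suc p)) g (r \<odot>\<^bsub>M (n - Suc (Suc p))\<^esub> x))"
proof -
  define m where "m = n - Suc (Suc p)"
  have gx': "Suc (Suc p) \<le> n" "g \<in> carrier (G n)" "x \<in> carrier (M m)" and m: "n - Suc p = Suc m"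
    using gx by (auto simp: cs_gens_iff m_def)
  interpret M: module R "M (Suc m)" by (rule module_M)
  interpret C: abelian_group "chain_group n (Suc p)" by simp
  have face: "tensor n (Suc p) (g \<otimes>\<^bsub>G n\<^esub> face_elt n (Suc p) i) ((if even i then r else \<ominus>\<^bsub>R\<^esub> r) \<odot>\<^bsub>M (Suc m)\<^esub> sigma m x)
      = signed (chain_group n (Suc p)) i (chain_face n (Suc p) i (tensor n (Suc (Suc p)) g (r \<odot>\<^bsub>M m\<^esub> x)))"
    if i: "i \<le> Suc p" for i
  proof -
    interpret T: abelian_group_hom "M (Suc m)" "chain_group n (Suc p)" "tensor n (Suc p) (g \<otimes>\<^bsub>G n\<^esub> face_elt n (Suc p) i)"
      using tensor_hom[of "Suc p" n "g \<otimes>\<^bsub>G n\<^esub> face_elt n (Suc p) i"] gx' i m by simp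
    show ?thesis
      using gx' r i T.hom_a_inv by (simp add: chain_face_tensor m_def[symmetric] sigma_smult signed_def M.smult_l_minus)
  qed
  have "chain_of n p (map (\<lambda>i. (if even i then r else \<ominus>\<^bsub>R\<^esub> r, g \<otimes>\<^bsub>G n\<^esub> face_elt n (Suc p) i,
      sigma m x)) [0..<Suc (Suc p)])
    = (\<Oplus>\<^bsub>chain_group n (Suc p)\<^esub>i\<in>{..<Suc (Suc p)}. tensor n (Suc p) (g \<otimes>\<^bsub>G n\<^esub> face_elt n (Suc p) i)
        ((if even i then r else \<ominus>\<^bsub>R\<^esub> r) \<odot>\<^bsub>M (n - Suc p)\<^esub> sigma m x))"
    using face_gens[OF gx] r cring.cring_simprules(3)[OF cring_R] by (intro chain_of_map_upt) (simp add: m_def)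
  also have "\<dots> = complex.boundary n (Suc p) (tensor n (Suc (Suc p)) g (r \<odot>\<^bsub>M m\<^esub> x))"
    unfolding complex.boundary_def lessThan_Suc_atMost
  proof (rule C.finsum_cong'[OF refl])
    show "(\<lambda>i. signed (chain_group n (Suc p)) i (chain_face n (Suc p) i (tensor n (Suc (Suc p)) g (r \<odot>\<^bsub>M m\<^esub> x))))
        \<in> {..Suc p} \<rightarrow> carrier (chain_group n (Suc p))"
      using gx' r by (auto simp: m_def)
  qed (simp add: face m)
  finally show ?thesis by (simp only: m_def)
qed

lemma chain_of_cs_d:
  "valid R (cs_gens G M (Suc p) n) L
    \<Longrightarrow> chain_of n p (cs_d G os b R act (Suc p) n L) = complex.boundary n (Suc p) (chain_of n (Suc p) L)"
proof (induction L)
  case Nil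
  show ?case using complex.boundary_zero[of n "Suc p"] by (simp add: cs_d_def del: chain_group_simps)
next
  case (Cons t L)
  obtain r g x where t: "t = (r, g, x)" by (cases t)
  have gx: "(g, x) \<in> cs_gens G M (Suc p) n" and r: "r \<in> carrier R" and L: "valid R (cs_gens G M (Suc p) n) L"
    using Cons.prems t by simp_all
  have faces: "valid R (cs_gens G M p n) (map (\<lambda>i. (if even i then r else \<ominus>\<^bsub>R\<^esub> r, g \<otimes>\<^bsub>G n\<^esub> face_elt n (Suc p) i,
      sigma (n - Suc (Suc p)) x)) [0..<Suc (Suc p)])"
    using face_gens[OF gx] r cring.cring_simprules(3)[OF cring_R] by (auto simp: valid_def simp del: upt_Suc)
  have gx': "r \<odot>\<^bsub>M (n - Suc (Suc p))\<^esub> x \<in> carrier (M (n - Suc (Suc p)))" "Suc (Suc p) \<le> n" "g \<in> carrier (G n)"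
    using gx r by (simp_all add: cs_gens_iff)
  have "chain_of n p (cs_d G os b R act (Suc p) n (t # L))
      = complex.boundary n (Suc p) (tensor n (Suc (Suc p)) g (r \<odot>\<^bsub>M (n - Suc (Suc p))\<^esub> x))
        \<oplus>\<^bsub>chain_group n (Suc p)\<^esub> complex.boundary n (Suc p) (chain_of n (Suc p) L)"
    unfolding t cs_d_Cons chain_of_append[OF faces cs_d_valid[OF L]] chain_of_faces[OF gx r] Cons.IH[OF L] ..
  also have "\<dots> = complex.boundary n (Suc p) (chain_of n (Suc p) (t # L))"
    using chain_of_Cons[OF Cons.prems[unfolded t]]
      abelian_group_hom.hom_add[OF complex.boundary_hom[of n "Suc p"]] gx' L
    by (simp add: t del: chain_group_simps)
  finally show ?case .
qed

lemma tensor_degree_0: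
  assumes "g \<in> carrier (G n)" "x \<in> carrier (M n)"
  shows "tensor n 0 g x = tensor n 0 (e n) (g_act n g x)" "tensor n 0 g x (e n) = g_act n g x"
proof -
  show eq: "tensor n 0 g x = tensor n 0 (e n) (g_act n g x)"
    using tensor_mult_pad[of 0 n "e n" g x] assms by simp
  show "tensor n 0 g x (e n) = g_act n g x"
    unfolding eq using assms induced_module.tensor_self[OF level[of 0 n]] by (simp add: tensor_def)
qed

lemma chain_degree_0:
  assumes "c \<in> carrier (chain_group n 0)"
  shows "c = tensor n 0 (e n) (c (e n))"
  using assms
proof (induction rule: chain_induct)
  case zero
  show ?case using tensor_zero[of 0 n "e n"] by simp
next
  case (add g x c)
  have x: "tensor n 0 g x (e n) \<in> carrier (M n)" "tensor n 0 (e n) (tensor n 0 g x (e n)) = tensor n 0 g x"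
    using tensor_degree_0[of g n x] add(2,3) by simp_all
  have c: "c (e n) \<in> carrier (M n)" using chain_value_closed[OF add(4)] by simp
  have "tensor n 0 (e n) (tensor n 0 g x (e n) \<oplus>\<^bsub>M n\<^esub> c (e n))
      = tensor n 0 (e n) (tensor n 0 g x (e n)) \<oplus>\<^bsub>chain_group n 0\<^esub> tensor n 0 (e n) (c (e n))"
    using tensor_add[of 0 n "e n" "tensor n 0 g x (e n)" "c (e n)"] x(1) c by (simp del: chain_group_simps)
  also have "\<dots> = tensor n 0 g x \<oplus>\<^bsub>chain_group n 0\<^esub> c"
    unfolding x(2) add(5)[symmetric] ..
  finally show ?case by (simp only: chain_group_simps diff_zero)
qed

lemma boundary_tensor_degree_1:
  assumes "Suc 0 \<le> n" "g \<in> carrier (G n)" "x \<in> carrier (M (n - Suc 0))"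
  shows "complex.boundary n 0 (tensor n (Suc 0) g x) = tensor n 0 g (sigma (n - Suc 0) x)"
proof -
  interpret C: abelian_group "chain_group n 0" by simp
  have "n = Suc (n - Suc 0)" using assms(1) by simp
  then have "sigma (n - Suc 0) x \<in> carrier (M n)" using assms(3) sigma_closed by metis
  then show ?thesis
    using assms C.finsum_insert[of "{}" 0]
    by (simp add: complex.boundary_def signed_def chain_face_tensor face_elt_eq b_zero_right pad_one C.r_zero
        del: chain_group_simps)
qed

lemma cs_d0_eq:
  "valid R (cs_gens G M 0 n) L \<Longrightarrow> cs_d0 G os b M act n L = complex.boundary n 0 (chain_of n 0 L) (e n)"
proof (induction L)
  case Nil
  show ?case using complex.boundary_zero[of n 0] by (simp add: cs_d0_def)
next
  case (Cons t L)
  interpret C: abelian_group "chain_group n 0" by simp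
  obtain r g x where t: "t = (r, g, x)" by (cases t)
  have gx: "r \<in> carrier R" "Suc 0 \<le> n" "g \<in> carrier (G n)" "x \<in> carrier (M (n - Suc 0))"
      and L: "valid R (cs_gens G M 0 n) L"
    using Cons.prems t by (simp_all add: cs_gens_iff)
  have n: "n = Suc (n - Suc 0)" using gx(2) by simp
  have sx: "sigma (n - Suc 0) x \<in> carrier (M n)" using gx(4) n sigma_closed by metis
  have "complex.boundary n 0 (tensor n (Suc 0) g (r \<odot>\<^bsub>M (n - Suc 0)\<^esub> x)) = tensor n 0 g (r \<odot>\<^bsub>M n\<^esub> sigma (n - Suc 0) x)"
    using gx n sigma_smult[of x "n - Suc 0" r] by (simp add: boundary_tensor_degree_1)
  then have "complex.boundary n 0 (chain_of n 0 (t # L))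
      = tensor n 0 g (r \<odot>\<^bsub>M n\<^esub> sigma (n - Suc 0) x) \<oplus>\<^bsub>chain_group n 0\<^esub> complex.boundary n 0 (chain_of n 0 L)"
    using chain_of_Cons[OF Cons.prems[unfolded t]] abelian_group_hom.hom_add[OF complex.boundary_hom[of n 0]] gx L
    by (simp add: t del: chain_group_simps)
  moreover have "tensor n 0 g (r \<odot>\<^bsub>M n\<^esub> sigma (n - Suc 0) x) (e n) = r \<odot>\<^bsub>M n\<^esub> g_act n g (sigma (n - Suc 0) x)"
    using gx sx by (simp add: tensor_degree_0(2) g_act_smult)
  ultimately show ?case using Cons.IH[OF L] by (simp add: cs_d0_def t)
qed

lemma cs_d0_eq_zero_iff:
  assumes "valid R (cs_gens G M 0 n) L"
  shows "cs_d0 G os b M act n L = \<zero>\<^bsub>M n\<^esub> \<longleftrightarrow> complex.boundary n 0 (chain_of n 0 L) = \<zero>\<^bsub>chain_group n 0\<^esub>"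
  using chain_degree_0[OF complex.boundary_closed[OF chain_of_closed[OF assms]]]
    tensor_zero[of 0 n "e n"]
  by (auto simp: cs_d0_eq[OF assms])

lemma cs_homology_vanishes_aug_iff: "cs_homology_vanishes G os b R M act (- 1) n \<longleftrightarrow> complex.exact_at n 0"
proof
  assume vanishes: "cs_homology_vanishes G os b R M act (- 1) n"
  show "complex.exact_at n 0"
    unfolding complex.exact_at_def
  proof
    fix c assume "c \<in> complex.cycles n 0"
    then have c: "c \<in> carrier (chain_group n 0)" by (simp add: complex.cycles_def)
    then have "c (e n) \<in> carrier (M n)" using chain_value_closed by fastforce
    then obtain L where L: "valid R (cs_gens G M 0 n) L" "cs_d0 G os b M act n L = c (e n)"
      using vanishes by (auto simp: cs_homology_vanishes_def)
    then have "complex.boundary n 0 (chain_of n 0 L) = c"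
      using chain_degree_0[OF c] chain_degree_0[OF complex.boundary_closed[OF chain_of_closed[OF L(1)]]] cs_d0_eq
      by metis
    then show "c \<in> complex.boundary n 0 ` carrier (chain_group n (Suc 0))" using chain_of_closed[OF L(1)] by blast
  qed
next
  assume exact: "complex.exact_at n 0"
  have "\<exists>L. valid R (cs_gens G M 0 n) L \<and> cs_d0 G os b M act n L = x" if x: "x \<in> carrier (M n)" for x
  proof -
    have "tensor n 0 (e n) x \<in> complex.cycles n 0" using x by (simp add: complex.cycles_def)
    then obtain c where c: "c \<in> carrier (chain_group n (Suc 0))" "complex.boundary n 0 c = tensor n 0 (e n) x"
      using complex.exact_atE[OF exact] by blast
    obtain L where L: "valid R (cs_gens G M 0 n) L" "chain_of n 0 L = c" using chain_of_surj[OF c(1)] by blast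
    then have "cs_d0 G os b M act n L = x"
      using x c(2) tensor_degree_0(2)[of "e n" n x] by (simp add: cs_d0_eq g_act_one)
    then show ?thesis using L(1) by blast
  qed
  then show "cs_homology_vanishes G os b R M act (- 1) n" by (simp add: cs_homology_vanishes_def)
qed

lemma exact_at_Suc_iff:
  "complex.exact_at n (Suc p) \<longleftrightarrow> (\<forall>L. valid R (cs_gens G M p n) L \<and> chain_of n p L \<in> complex.cycles n (Suc p)
    \<longrightarrow> (\<exists>L'. valid R (cs_gens G M (Suc p) n) L' \<and> cs_eq G os R M act p n (cs_d G os b R act (Suc p) n L') L))"
proof -
  have "chain_of n p L \<in> complex.boundary n (Suc p) ` carrier (chain_group n (Suc (Suc p)))
      \<longleftrightarrow> (\<exists>L'. valid R (cs_gens G M (Suc p) n) L' \<and> cs_eq G os R M act p n (cs_d G os b R act (Suc p) n L') L)"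
    (is "?boundary L \<longleftrightarrow> ?bounds L") if L: "valid R (cs_gens G M p n) L" for L
  proof
    assume "?boundary L"
    then obtain c where c: "c \<in> carrier (chain_group n (Suc (Suc p)))" "complex.boundary n (Suc p) c = chain_of n p L"
      by auto
    obtain L' where L': "valid R (cs_gens G M (Suc p) n) L'" "chain_of n (Suc p) L' = c" using chain_of_surj[OF c(1)]
      by blast
    then have "cs_eq G os R M act p n (cs_d G os b R act (Suc p) n L') L"
      using c(2) by (simp add: cs_eq_iff[OF cs_d_valid L] chain_of_cs_d)
    then show "?bounds L" using L'(1) by blast
  next
    assume "?bounds L"
    then obtain L' where L': "valid R (cs_gens G M (Suc p) n) L'"
        "cs_eq G os R M act p n (cs_d G os b R act (Suc p) n L') L" by blast
    then have "chain_of n p L = complex.boundary n (Suc p) (chain_of n (Suc p) L')"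
      by (simp add: cs_eq_iff[OF cs_d_valid L] chain_of_cs_d)
    then show "?boundary L" using chain_of_closed[OF L'(1)] by blast
  qed
  moreover have "complex.exact_at n (Suc p)
      \<longleftrightarrow> (\<forall>L. valid R (cs_gens G M p n) L \<and> chain_of n p L \<in> complex.cycles n (Suc p)
      \<longrightarrow> ?boundary L)"
  proof
    assume exact: "\<forall>L. valid R (cs_gens G M p n) L \<and> chain_of n p L \<in> complex.cycles n (Suc p) \<longrightarrow> ?boundary L"
    show "complex.exact_at n (Suc p)"
      unfolding complex.exact_at_def
    proof
      fix c assume c: "c \<in> complex.cycles n (Suc p)"
      then have "c \<in> carrier (chain_group n (Suc p))" by (simp add: complex.cycles_def)
      then obtain L where "valid R (cs_gens G M p n) L" "chain_of n p L = c" using chain_of_surj by blast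
      then show "c \<in> complex.boundary n (Suc p) ` carrier (chain_group n (Suc (Suc p)))" using exact c by blast
    qed
  qed (auto simp: complex.exact_at_def)
  ultimately show ?thesis by blast
qed

theorem cs_homology_vanishes_iff: "cs_homology_vanishes G os b R M act (int q - 1) n \<longleftrightarrow> complex.exact_at n q"
proof -
  consider (augmentation) "q = 0" | (bottom) "q = Suc 0" | (higher) p where "q = Suc (Suc p)"
    by (metis not0_implies_Suc)
  then show ?thesis
  proof cases
    case augmentation
    then show ?thesis using cs_homology_vanishes_aug_iff by simp
  next
    case bottom
    then show ?thesis unfolding bottom exact_at_Suc_iff
      using cs_d0_eq_zero_iff by (auto simp: cs_homology_vanishes_def complex.cycles_def)
  next
    case higher
    have "cs_eq G os R M act p n (cs_d G os b R act (Suc p) n L) []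
        \<longleftrightarrow> chain_of n (Suc p) L \<in> complex.cycles n (Suc (Suc p))"
      if "valid R (cs_gens G M (Suc p) n) L" for L
      using that by (simp add: cs_eq_iff chain_of_cs_d complex.cycles_def del: chain_group_simps)
    moreover have "nat (1 + int p) = Suc p" by simp
    ultimately show ?thesis unfolding higher exact_at_Suc_iff
      by (auto simp: cs_homology_vanishes_def)
  qed
qed

end

section \<open>Constant and free modules\<close>

lemma const_ug_module:
  assumes "cring R"
  shows "ug_module G os R (\<lambda>n. ring_mod R) const_act"
proof -
  interpret cring R by (rule assms)
  have "abelian_group (ring_mod R)"
  proof (rule abelian_groupI)
    fix x assume "x \<in> carrier (ring_mod R)"
    then show "\<exists>y\<in>carrier (ring_mod R). y \<oplus>\<^bsub>ring_mod R\<^esub> x = \<zero>\<^bsub>ring_mod R\<^esub>"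
      using l_neg by (auto simp: ring_mod_def)
  qed (auto simp: ring_mod_def a_ac)
  then have "module R (ring_mod R)"
    by (intro moduleI assms) (auto simp: ring_mod_def l_distr r_distr m_assoc)
  then show ?thesis by (simp add: ug_module_def linear_map_def const_act_def ring_mod_def)
qed

lemma ring_mod_simps [simp]: "carrier (ring_mod R) = carrier R" "\<zero>\<^bsub>ring_mod R\<^esub> = \<zero>\<^bsub>R\<^esub>"
    "x \<oplus>\<^bsub>ring_mod R\<^esub> y = x \<oplus>\<^bsub>R\<^esub> y" "r \<odot>\<^bsub>ring_mod R\<^esub> x = r \<otimes>\<^bsub>R\<^esub> x"
  by (simp_all add: ring_mod_def)

locale free_ug_module = braided_stability_groupoid G os b + coefficients: coefficient_ring R
  for G :: "nat \<Rightarrow> 'g monoid" and os b and R :: "'r ring" +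
  fixes J :: "'j set" and rk :: "'j \<Rightarrow> nat"
begin

abbreviation F :: "nat \<Rightarrow> ('r, 'j \<times> 'g set \<Rightarrow> 'r) module" where "F \<equiv> free_mod G os R J rk"
abbreviation F_act :: "nat \<Rightarrow> nat \<Rightarrow> 'g set \<Rightarrow> ('j \<times> 'g set \<Rightarrow> 'r) \<Rightarrow> 'j \<times> 'g set \<Rightarrow> 'r" where "F_act \<equiv> free_act G os R rk"

definition basis :: "nat \<Rightarrow> ('j \<times> 'g set) set" where
  "basis n = {(j, \<phi>). j \<in> J \<and> \<phi> \<in> UHom G os (rk j) n}"

lemma mem_basis_iff [simp]: "(j, \<phi>) \<in> basis n \<longleftrightarrow> j \<in> J \<and> \<phi> \<in> UHom G os (rk j) n"
  by (simp add: basis_def)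

lemma F_eq: "F n = finsupp R (basis n)"
  unfolding free_mod_def finsupp_def basis_def ..

definition shift :: "nat \<Rightarrow> nat \<Rightarrow> 'g set \<Rightarrow> 'j \<times> 'g set \<Rightarrow> 'j \<times> 'g set" where
  "shift s t \<psi> = (\<lambda>(j, \<phi>). (j, ucomp G os (rk j) s t \<psi> \<phi>))"

lemma shift_basis [simp]: "\<lbrakk>\<psi> \<in> UHom G os s t; k \<in> basis s\<rbrakk> \<Longrightarrow> shift s t \<psi> k \<in> basis t"
  by (cases k) (simp add: shift_def)

lemma F_act_eq:
  assumes c: "c \<in> carrier (F s)"
  shows "F_act s t \<psi> c = coefficients.pushforward (shift s t \<psi>) c"
proof
  fix k :: "'j \<times> 'g set"
  obtain j \<phi>' where k: "k = (j, \<phi>')" by (cases k)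
  define A where "A = {\<phi> \<in> UHom G os (rk j) s. c (j, \<phi>) \<noteq> \<zero>\<^bsub>R\<^esub> \<and> ucomp G os (rk j) s t \<psi> \<phi> = \<phi>'}"
  have "coefficients.support c \<subseteq> basis s" using c unfolding F_eq coefficients.finsupp_carrier_iff by blast
  then have "{k' \<in> coefficients.support c. shift s t \<psi> k' = k} = Pair j ` A"
    by (auto simp: A_def k shift_def coefficients.support_def basis_def)
  moreover have "(\<Oplus>\<^bsub>R\<^esub>k'\<in>Pair j ` A. c k') = (\<Oplus>\<^bsub>R\<^esub>\<phi>\<in>A. c (j, \<phi>))"
    using c by (intro coefficients.finsum_reindex) (auto simp: F_eq inj_on_def)
  ultimately show "F_act s t \<psi> c k = coefficients.pushforward (shift s t \<psi>) c k"
    by (simp add: coefficients.pushforward_def free_act_def k A_def)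
qed

lemma F_act_hom:
  assumes "\<psi> \<in> UHom G os s t"
  shows "abelian_group_hom (F s) (F t) (F_act s t \<psi>)"
proof (rule abelian_group_hom_cong[OF _ F_act_eq])
  show "abelian_group_hom (F s) (F t) (coefficients.pushforward (shift s t \<psi>))"
    unfolding F_eq by (rule coefficients.pushforward_hom[OF shift_basis[OF assms]])
qed

lemma F_act_single:
  assumes "\<psi> \<in> UHom G os s t" "k \<in> basis s" "r \<in> carrier R"
  shows "F_act s t \<psi> (coefficients.single k r) = coefficients.single (shift s t \<psi> k) r"
  using F_act_eq[of "coefficients.single k r" s t \<psi>]
    coefficients.pushforward_single[OF shift_basis[OF assms(1)] assms(2,3)]
    assms by (simp add: F_eq)

lemma F_act_linear:
  assumes "\<psi> \<in> UHom G os s t"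
  shows "linear_map R (F s) (F t) (F_act s t \<psi>)"
proof -
  interpret F: module R "F s" unfolding F_eq by (rule coefficients.module_finsupp)
  interpret abelian_group_hom "F s" "F t" "F_act s t \<psi>" by (rule F_act_hom[OF assms])
  have "F_act s t \<psi> (r \<odot>\<^bsub>F s\<^esub> c) = r \<odot>\<^bsub>F t\<^esub> F_act s t \<psi> c" if r: "r \<in> carrier R" and c: "c \<in> carrier (F s)" for r c
    unfolding F_act_eq[OF c] F_act_eq[OF F.smult_closed[OF r c]]
    using coefficients.pushforward_smult[OF shift_basis[OF assms] r c[unfolded F_eq]] unfolding F_eq .
  then show ?thesis by (simp add: linear_map_def)
qed

lemma F_induct [consumes 1, case_names zero add]:
  assumes "c \<in> carrier (F n)" and "P \<zero>\<^bsub>F n\<^esub>"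
    and "\<And>k r c. \<lbrakk>k \<in> basis n; r \<in> carrier R; c \<in> carrier (F n); P c\<rbrakk> \<Longrightarrow> P (coefficients.single k r \<oplus>\<^bsub>F n\<^esub> c)"
  shows "P c"
  using assms unfolding F_eq by (rule coefficients.finsupp_induct)

lemma F_hom_eqI:
  assumes "abelian_group_hom (F n) N f" "abelian_group_hom (F n) N f'"
    and "\<And>k r. \<lbrakk>k \<in> basis n; r \<in> carrier R\<rbrakk> \<Longrightarrow> f (coefficients.single k r) = f' (coefficients.single k r)"
    and "c \<in> carrier (F n)"
  shows "f c = f' c"
  using assms unfolding F_eq by (rule coefficients.finsupp_hom_eqI)

lemma free_ug_module: "ug_module G os R F F_act"
  unfolding ug_module_def
proof (intro conjI allI impI)
  show "module R (F n)" for n unfolding F_eq by (rule coefficients.module_finsupp)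
  show "linear_map R (F s) (F t) (F_act s t \<phi>)" if "\<phi> \<in> UHom G os s t" for s t \<phi>
    using that by (rule F_act_linear)
  show "F_act n n (uid G os n) c = c" if "c \<in> carrier (F n)" for n c
  proof (rule F_hom_eqI[OF F_act_hom[OF uid_UHom] _ _ that])
    show "abelian_group_hom (F n) (F n) (\<lambda>c. c)"
      by (rule abelian_group_homI_add) (simp_all add: F_eq coefficients.abelian_finsupp del: coefficients.finsupp_simps)
    show "F_act n n (uid G os n) (coefficients.single k r) = coefficients.single k r" if "k \<in> basis n" "r \<in> carrier R"
        for k r
      using that by (cases k) (simp add: F_act_single shift_def ucomp_uid)
  qed
  show "F_act s u (ucomp G os s t u \<psi> \<phi>) c = F_act t u \<psi> (F_act s t \<phi> c)"
    if "\<phi> \<in> UHom G os s t \<and> \<psi> \<in> UHom G os t u \<and> c \<in> carrier (F s)" for s t u \<phi> \<psi> c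
  proof (rule F_hom_eqI[where f = "F_act s u (ucomp G os s t u \<psi> \<phi>)" and f' = "\<lambda>c. F_act t u \<psi> (F_act s t \<phi> c)"])
    show "F_act s u (ucomp G os s t u \<psi> \<phi>) (coefficients.single k r)
        = F_act t u \<psi> (F_act s t \<phi> (coefficients.single k r))"
      if k: "k \<in> basis s" and r: "r \<in> carrier R" for k r
    proof -
      have "shift s u (ucomp G os s t u \<psi> \<phi>) k = shift t u \<psi> (shift s t \<phi> k)"
        using that \<open>\<phi> \<in> _ \<and> _\<close> by (cases k) (simp add: shift_def ucomp_assoc)
      then show ?thesis using that \<open>\<phi> \<in> _ \<and> _\<close> by (simp add: F_act_single)
    qed
  qed (use that in \<open>auto intro: F_act_hom abelian_group_hom_compose[OF F_act_hom F_act_hom]\<close>)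
qed

sublocale free: braided_ug_module G os b R F F_act
  by (intro braided_ug_module.intro braided_ug_module_axioms.intro braided_stability_groupoid_axioms free_ug_module)

end

locale free_ug_map = free_ug_module G os b R J rk + target: braided_ug_module G os b R M act
  for G :: "nat \<Rightarrow> 'g monoid" and os b and R :: "'r ring" and J :: "'j set" and rk
    and M :: "nat \<Rightarrow> ('r, 'x) module" and act +
  fixes v :: "'j \<Rightarrow> 'x"
  assumes generator_closed: "j \<in> J \<Longrightarrow> v j \<in> carrier (M (rk j))"
begin

definition image :: "nat \<Rightarrow> 'j \<times> 'g set \<Rightarrow> 'x" where
  "image n = (\<lambda>(j, \<phi>). act (rk j) n \<phi> (v j))"

lemma image_closed [simp]: "k \<in> basis n \<Longrightarrow> image n k \<in> carrier (M n)"
  by (cases k) (simp add: image_def generator_closed)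

lemma image_shift: "\<lbrakk>\<psi> \<in> UHom G os s t; k \<in> basis s\<rbrakk> \<Longrightarrow> image t (shift s t \<psi> k) = act s t \<psi> (image s k)"
  by (cases k) (simp add: image_def shift_def target.act_ucomp generator_closed)

lemma image_extension: "finsupp_extension R (M n) (basis n) (\<lambda>k r. r \<odot>\<^bsub>M n\<^esub> image n k)"
  by (intro finsupp_extension.intro finsupp_extension_axioms.intro coefficients.coefficient_ring_axioms)
    (simp_all add: module.smult_l_distr[OF target.module_M])

abbreviation lift :: "nat \<Rightarrow> ('j \<times> 'g set \<Rightarrow> 'r) \<Rightarrow> 'x" where
  "lift n \<equiv> finsupp_extension.extend R (M n) (\<lambda>k r. r \<odot>\<^bsub>M n\<^esub> image n k)"

lemma lift_hom: "abelian_group_hom (F n) (M n) (lift n)"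
  unfolding F_eq by (rule finsupp_extension.extend_hom[OF image_extension])

lemma lift_single: "\<lbrakk>k \<in> basis n; r \<in> carrier R\<rbrakk> \<Longrightarrow> lift n (coefficients.single k r) = r \<odot>\<^bsub>M n\<^esub> image n k"
  by (rule finsupp_extension.extend_single[OF image_extension])

lemma lift_ug_hom: "ug_hom G os R F F_act M act lift"
  unfolding ug_hom_def linear_map_def
proof (intro conjI allI ballI impI)
  interpret M: module R "M n" for n by (rule target.module_M)
  show "lift n (r \<odot>\<^bsub>F n\<^esub> c) = r \<odot>\<^bsub>M n\<^esub> lift n c" if "r \<in> carrier R" "c \<in> carrier (F n)" for n r c
    using finsupp_extension.extend_smult[OF image_extension M.smult_hom[OF that(1)] that(1), of c] that
    by (simp add: F_eq M.smult_assoc1 del: coefficients.finsupp_simps)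
  show "lift t (F_act s t \<psi> c) = act s t \<psi> (lift s c)" if "\<psi> \<in> UHom G os s t \<and> c \<in> carrier (F s)" for s t \<psi> c
  proof (rule F_hom_eqI[where f = "\<lambda>c. lift t (F_act s t \<psi> c)" and f' = "\<lambda>c. act s t \<psi> (lift s c)"])
    have \<psi>: "\<psi> \<in> UHom G os s t" using that by simp
    show "abelian_group_hom (F s) (M t) (\<lambda>c. lift t (F_act s t \<psi> c))"
      by (rule abelian_group_hom_compose[OF F_act_hom[OF \<psi>] lift_hom])
    show "abelian_group_hom (F s) (M t) (\<lambda>c. act s t \<psi> (lift s c))"
      by (rule abelian_group_hom_compose[OF lift_hom target.act_hom[OF \<psi>]])
    show "lift t (F_act s t \<psi> (coefficients.single k r)) = act s t \<psi> (lift s (coefficients.single k r))"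
      if "k \<in> basis s" "r \<in> carrier R" for k r
      using that \<psi> by (simp add: F_act_single lift_single image_shift target.act_smult)
  qed (use that in simp)
qed (simp_all add: abelian_group_hom.hom_closed[OF lift_hom]
  abelian_group_hom.hom_add[OF lift_hom] del: coefficients.finsupp_simps)

sublocale lift: braided_ug_hom G os b R F F_act M act lift
  by (intro braided_ug_hom.intro braided_ug_hom_axioms.intro free.braided_ug_module_axioms
      target.braided_ug_module_axioms lift_ug_hom)

end

section \<open>Acyclicity of free modules\<close>

context free_ug_module
begin

sublocale const: braided_ug_module G os b R "\<lambda>n. ring_mod R" const_act
  by (intro braided_ug_module.intro braided_ug_module_axioms.intro braided_stability_groupoid_axioms
      const_ug_module coefficients.is_cring)

lemma const_act_trivial [simp]: "const.g_act n g r = r" "const.sigma n r = r"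
  by (simp_all add: gact_def minc_def const_act_def)

lemma const_exact_at_0:
  assumes "0 < n"
  shows "const.complex.exact_at n 0"
  unfolding const.complex.exact_at_def
proof
  fix c assume "c \<in> const.complex.cycles n 0"
  then have c: "c \<in> carrier (const.chain_group n 0)" by (simp add: const.complex.cycles_def)
  have "c (e n) \<in> carrier R" using const.chain_value_closed[OF c] by simp
  then have "const.complex.boundary n 0 (const.tensor n (Suc 0) (e n) (c (e n))) = c"
    and "const.tensor n (Suc 0) (e n) (c (e n)) \<in> carrier (const.chain_group n (Suc 0))"
    using const.boundary_tensor_degree_1[of n "e n" "c (e n)"] const.chain_degree_0[OF c] assms by simp_all
  then show "c \<in> const.complex.boundary n 0 ` carrier (const.chain_group n (Suc 0))" by (metis imageI)
qed

abbreviation unit :: "nat \<Rightarrow> 'j \<Rightarrow> 'j \<times> 'g set" where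
  "unit n j \<equiv> (j, mor (rk j) n (e n))"

lemma F_single_closed [simp]: "\<lbrakk>k \<in> basis n; r \<in> carrier R\<rbrakk> \<Longrightarrow> coefficients.single k r \<in> carrier (F n)"
  by (simp add: F_eq)

lemma g_act_single_unit:
  "\<lbrakk>j \<in> J; rk j \<le> n; g \<in> carrier (G n); r \<in> carrier R\<rbrakk>
    \<Longrightarrow> free.g_act n g (coefficients.single (unit n j) r) = coefficients.single (j, mor (rk j) n g) r"
  by (simp add: free.g_act_eq F_act_single shift_def ucomp_mor)

lemma sigma_single_unit:
  "\<lbrakk>j \<in> J; rk j \<le> n; r \<in> carrier R\<rbrakk>
    \<Longrightarrow> free.sigma n (coefficients.single (unit n j) r)
      = free.g_act (Suc n) (pad (n - rk j) (Suc (rk j)) 0 (inv\<^bsub>G (Suc (rk j))\<^esub> (b (rk j) 1)))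
        (coefficients.single (unit (Suc n) j) r)"
  by (simp add: minc_def F_act_single shift_def ginc_unit g_act_single_unit)

text \<open>
  For \<open>s = (j, \<phi>)\<close> with \<open>\<phi>\<close> a morphism from \<open>m = rk j\<close> to \<open>n\<close>, these are the elements of \<open>G n\<close> in front of the
  generator \<open>j\<close> that lie in the summand indexed by \<open>s\<close>. The braiding moves the \<open>m\<close> strands of the generator past the
  \<open>q\<close> strands that are added by the complex.
\<close>

definition position :: "nat \<Rightarrow> nat \<Rightarrow> 'j \<times> 'g set \<Rightarrow> 'g \<Rightarrow> 'g" where
  "position n q s f = crep (snd s) \<otimes>\<^bsub>G n\<^esub> pad 0 (n - rk (fst s)) (rk (fst s)) f \<otimes>\<^bsub>G n\<^esub> twist (rk (fst s)) n q"

lemma basisD: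
  assumes "s \<in> basis n"
  shows "fst s \<in> J" "rk (fst s) \<le> n" "crep (snd s) \<in> carrier (G n)" "mor (rk (fst s)) n (crep (snd s)) = snd s"
proof -
  have "fst s \<in> J" "snd s \<in> UHom G os (rk (fst s)) n" using assms by (auto simp: basis_def)
  then show "fst s \<in> J" "rk (fst s) \<le> n" "crep (snd s) \<in> carrier (G n)" "mor (rk (fst s)) n (crep (snd s)) = snd s"
    by (simp_all add: crep_UHom UHom_iff)
qed

lemma position_closed [simp]:
  "\<lbrakk>s \<in> basis n; rk (fst s) + q \<le> n; f \<in> carrier (G (n - rk (fst s)))\<rbrakk> \<Longrightarrow> position n q s f \<in> carrier (G n)"
  using basisD[of s n] by (simp add: position_def)

lemma position_mult_pad:
  assumes "s \<in> basis n" "rk (fst s) + q \<le> n" "f \<in> carrier (G (n - rk (fst s)))" "h \<in> carrier (G (n - rk (fst s) - q))"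
  shows "position n q s (f \<otimes>\<^bsub>G (n - rk (fst s))\<^esub> pad 0 (n - rk (fst s) - q) q h)
    = position n q s f \<otimes>\<^bsub>G n\<^esub> pad 0 (n - q) q (pad 0 (n - rk (fst s) - q) (rk (fst s)) h)"
proof -
  let ?m = "rk (fst s)"
  have closed: "crep (snd s) \<in> carrier (G n)" "pad 0 (n - ?m) ?m f \<in> carrier (G n)" "twist ?m n q \<in> carrier (G n)"
    "pad 0 (n - ?m - q) q h \<in> carrier (G (n - ?m))" "pad 0 (n - ?m) ?m (pad 0 (n - ?m - q) q h) \<in> carrier (G n)"
    "pad 0 (n - q) q (pad 0 (n - ?m - q) ?m h) \<in> carrier (G n)"
    using assms basisD[OF assms(1)] by simp_all
  have "pad 0 (n - ?m) ?m (f \<otimes>\<^bsub>G (n - ?m)\<^esub> pad 0 (n - ?m - q) q h)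
      = pad 0 (n - ?m) ?m f \<otimes>\<^bsub>G n\<^esub> pad 0 (n - ?m) ?m (pad 0 (n - ?m - q) q h)"
    using assms closed by (simp add: pad_mult)
  then show ?thesis
    using closed pad_twist[OF assms(2,4)] by (simp add: position_def m_assoc)
qed

lemma position_eq_imp_eq:
  assumes s: "s \<in> basis n" and s': "s' \<in> basis n" "fst s' = fst s" and q: "rk (fst s) + q \<le> n"
    and f: "f \<in> carrier (G (n - rk (fst s)))" "f' \<in> carrier (G (n - rk (fst s)))"
    and eq: "position n q s' f' = position n q s f"
  shows "s' = s" "f' = f"
proof -
  let ?m = "rk (fst s)"
  have closed: "crep (snd s) \<in> carrier (G n)" "crep (snd s') \<in> carrier (G n)" "pad 0 (n - ?m) ?m f \<in> carrier (G n)"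
    "pad 0 (n - ?m) ?m f' \<in> carrier (G n)" "twist ?m n q \<in> carrier (G n)"
    using q f basisD[OF s] basisD[OF s'(1)] s'(2) by simp_all
  have pads: "crep (snd s') \<otimes>\<^bsub>G n\<^esub> pad 0 (n - ?m) ?m f' = crep (snd s) \<otimes>\<^bsub>G n\<^esub> pad 0 (n - ?m) ?m f"
    using eq closed group.right_cancel[OF group_G, of "twist ?m n q" n] by (simp add: position_def s'(2))
  have "snd s' = mor ?m n (crep (snd s') \<otimes>\<^bsub>G n\<^esub> pad 0 (n - ?m) ?m f')"
    using basisD[OF s'(1)] s'(2) f by (simp add: mor_absorb)
  also have "\<dots> = snd s" unfolding pads using basisD[OF s] f by (simp add: mor_absorb)
  finally show "s' = s" using s'(2) by (simp add: prod_eq_iff)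
  then have "pad 0 (n - ?m) ?m f' = pad 0 (n - ?m) ?m f"
    using pads closed monoid.Units_l_cancel[OF monoid_G, of "crep (snd s)" n] by (simp add: group.Units_eq)
  then show "f' = f" using inj_onD[OF pad_inj] f by blast
qed

definition summand_map :: "nat \<Rightarrow> 'j \<times> 'g set \<Rightarrow> nat \<Rightarrow> ('g \<Rightarrow> 'r) \<Rightarrow> 'g \<Rightarrow> 'j \<times> 'g set \<Rightarrow> 'r" where
  "summand_map n s q = (if rk (fst s) + q \<le> n
     then balanced_map.extension (G (n - rk (fst s))) (G (n - rk (fst s) - q)) (ring_mod R) (pad 0 (n - rk (fst s) - q) q)
       (const.g_act (n - rk (fst s) - q)) (add_monoid (free.chain_group n q))
       (\<lambda>f r. free.tensor n q (position n q s f) (coefficients.single (unit (n - q) (fst s)) r))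
     else (\<lambda>_. \<zero>\<^bsub>free.chain_group n q\<^esub>))"

lemma summand_map_balanced:
  assumes s: "s \<in> basis n" and q: "rk (fst s) + q \<le> n"
  shows "balanced_map (G (n - rk (fst s))) (G (n - rk (fst s) - q)) (ring_mod R) (pad 0 (n - rk (fst s) - q) q)
     (const.g_act (n - rk (fst s) - q)) (add_monoid (free.chain_group n q))
     (\<lambda>f r. free.tensor n q (position n q s f) (coefficients.single (unit (n - q) (fst s)) r))"
proof (intro balanced_map.intro balanced_map_axioms.intro const.level abelian_group.a_comm_group
    free.abelian_chain_group)
  let ?m = "rk (fst s)" and ?unit = "\<lambda>r. coefficients.single (unit (n - q) (fst s)) r"
  show "q \<le> n - ?m" using q by simp
  have qn: "q \<le> n" and m: "?m \<le> n - q" using q by simp_all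
  have unit: "?unit r \<in> carrier (F (n - q))" if "r \<in> carrier R" for r using that m basisD(1)[OF s] by simp
  fix f r assume f: "f \<in> carrier (G (n - ?m))" and r: "r \<in> carrier (ring_mod R)"
  note position = position_closed[OF s q f]
  show "free.tensor n q (position n q s f) (?unit r) \<in> carrier (add_monoid (free.chain_group n q))"
    using position qn unit r by simp
  show "free.tensor n q (position n q s f) (?unit (r \<oplus>\<^bsub>ring_mod R\<^esub> r'))
      = free.tensor n q (position n q s f) (?unit r)
        \<otimes>\<^bsub>add_monoid (free.chain_group n q)\<^esub> free.tensor n q (position n q s f) (?unit r')"
    if "r' \<in> carrier (ring_mod R)" for r'
    using free.tensor_add[OF qn position unit unit, of r r'] coefficients.single_add[of r r' _ "basis (n - q)"] r that
    by (simp add: F_eq[symmetric] del: coefficients.finsupp_simps free.chain_group_simps)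
  fix h assume h: "h \<in> carrier (G (n - ?m - q))"
  let ?h = "pad 0 (n - ?m - q) ?m h"
  have h': "?h \<in> carrier (G (n - q))" using h q by simp
  have "n - q - ?m = n - ?m - q" by simp
  then have "mor ?m (n - q) ?h = mor ?m (n - q) (e (n - q))"
    using mor_absorb[of ?m "n - q" "e (n - q)" h] h h' m by simp
  then have "free.g_act (n - q) ?h (?unit r) = ?unit r"
    using g_act_single_unit[OF basisD(1)[OF s] m h'] r by simp
  then show "free.tensor n q (position n q s (f \<otimes>\<^bsub>G (n - ?m)\<^esub> pad 0 (n - ?m - q) q h)) (?unit r)
      = free.tensor n q (position n q s f) (?unit (const.g_act (n - ?m - q) h r))"
    using position_mult_pad[OF s q f h] free.tensor_mult_pad[OF qn position h' unit] r by simp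
qed

lemma summand_map_tensor:
  "\<lbrakk>s \<in> basis n; rk (fst s) + q \<le> n; f \<in> carrier (G (n - rk (fst s))); r \<in> carrier R\<rbrakk>
    \<Longrightarrow> summand_map n s q (const.tensor (n - rk (fst s)) q f r)
      = free.tensor n q (position n q s f) (coefficients.single (unit (n - q) (fst s)) r)"
  unfolding summand_map_def const.tensor_def
  using balanced_map.extension_tensor[OF summand_map_balanced, of s n q f r] by simp

lemma summand_map_hom:
  assumes s: "s \<in> basis n"
  shows "abelian_group_hom (const.chain_group (n - rk (fst s)) q) (free.chain_group n q) (summand_map n s q)"
proof (cases "rk (fst s) + q \<le> n")
  case True
  then have "summand_map n s q
      \<in> hom (add_monoid (const.chain_group (n - rk (fst s)) q)) (add_monoid (free.chain_group n q))"
    using balanced_map.extension_hom[OF summand_map_balanced[OF s True]] const.chain_group_level[of q "n - rk (fst s)"]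
    by (simp add: summand_map_def)
  then show ?thesis
    by (intro abelian_group_homI group_hom.intro group_hom_axioms.intro abelian_group.a_group) simp_all
next
  case False
  then show ?thesis
    using basisD(2)[OF s] by (intro const.hom_from_empty_chain_group) (simp_all add: summand_map_def)
qed

lemma position_face_elt:
  assumes s: "s \<in> basis n" and q: "rk (fst s) + Suc q \<le> n" and i: "i \<le> q" and f: "f \<in> carrier (G (n - rk (fst s)))"
  shows "position n (Suc q) s f \<otimes>\<^bsub>G n\<^esub> face_elt n q i \<otimes>\<^bsub>G n\<^esub> pad 0 (n - q) q
      (pad (n - rk (fst s) - Suc q) (Suc (rk (fst s))) 0 (inv\<^bsub>G (Suc (rk (fst s)))\<^esub> (b (rk (fst s)) 1)))
    = position n q s (f \<otimes>\<^bsub>G (n - rk (fst s))\<^esub> face_elt (n - rk (fst s)) q i)"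
proof -
  let ?m = "rk (fst s)" and ?i = "face_elt (n - rk (fst s)) q i"
  let ?w = "pad 0 (n - q) q (pad (n - ?m - Suc q) (Suc ?m) 0 (inv\<^bsub>G (Suc ?m)\<^esub> (b ?m 1)))"
  have closed: "crep (snd s) \<in> carrier (G n)" "pad 0 (n - ?m) ?m f \<in> carrier (G n)" "twist ?m n (Suc q) \<in> carrier (G n)"
    "face_elt n q i \<in> carrier (G n)" "?w \<in> carrier (G n)" "?i \<in> carrier (G (n - ?m))" "twist ?m n q \<in> carrier (G n)"
    using q f i basisD[OF s] by simp_all
  have "position n (Suc q) s f \<otimes>\<^bsub>G n\<^esub> face_elt n q i \<otimes>\<^bsub>G n\<^esub> ?w
      = crep (snd s) \<otimes>\<^bsub>G n\<^esub> pad 0 (n - ?m) ?m f \<otimes>\<^bsub>G n\<^esub> (twist ?m n (Suc q) \<otimes>\<^bsub>G n\<^esub> face_elt n q i \<otimes>\<^bsub>G n\<^esub> ?w)"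
    using closed by (simp add: position_def m_assoc)
  also have "\<dots> = crep (snd s) \<otimes>\<^bsub>G n\<^esub> (pad 0 (n - ?m) ?m f \<otimes>\<^bsub>G n\<^esub> pad 0 (n - ?m) ?m ?i) \<otimes>\<^bsub>G n\<^esub> twist ?m n q"
    unfolding twist_face_elt[OF q i] using closed basisD(2)[OF s] by (simp add: m_assoc)
  also have "\<dots> = position n q s (f \<otimes>\<^bsub>G (n - ?m)\<^esub> ?i)"
    using f closed basisD(2)[OF s] by (simp add: position_def pad_mult)
  finally show ?thesis .
qed

lemma semisimplicial_summand_map:
  assumes s: "s \<in> basis n"
  shows "semisimplicial_hom (const.chain_group (n - rk (fst s))) (const.chain_face (n - rk (fst s)))
    (free.chain_group n) (free.chain_face n) (summand_map n s)"
proof (intro semisimplicial_hom.intro semisimplicial_hom_axioms.intro const.complex.semisimplicial_group_axioms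
    free.complex.semisimplicial_group_axioms summand_map_hom s)
  let ?m = "rk (fst s)"
  fix i q c assume i: "i \<le> q" and c: "c \<in> carrier (const.chain_group (n - ?m) (Suc q))"
  show "summand_map n s q (const.chain_face (n - ?m) q i c) = free.chain_face n q i (summand_map n s (Suc q) c)"
  proof (rule const.chain_hom_eqI[OF _ _ _ c])
    show "abelian_group_hom (const.chain_group (n - ?m) (Suc q)) (free.chain_group n q)
        (\<lambda>c. summand_map n s q (const.chain_face (n - ?m) q i c))"
      by (rule abelian_group_hom_compose[OF const.chain_face_hom[OF i] summand_map_hom[OF s]])
    show "abelian_group_hom (const.chain_group (n - ?m) (Suc q)) (free.chain_group n q)
        (\<lambda>c. free.chain_face n q i (summand_map n s (Suc q) c))"
      by (rule abelian_group_hom_compose[OF summand_map_hom[OF s] free.chain_face_hom[OF i]])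
    fix f r assume q: "Suc q \<le> n - ?m" and f: "f \<in> carrier (G (n - ?m))" and r: "r \<in> carrier (ring_mod R)"
    let ?w = "pad (n - ?m - Suc q) (Suc ?m) 0 (inv\<^bsub>G (Suc ?m)\<^esub> (b ?m 1))"
        and ?g = "position n (Suc q) s f \<otimes>\<^bsub>G n\<^esub> face_elt n q i"
      and ?unit = "\<lambda>n. coefficients.single (unit n (fst s)) r"
    have m: "?m + Suc q \<le> n" "?m \<le> n - Suc q" "n - q = Suc (n - Suc q)" "n - Suc q - ?m = n - ?m - Suc q"
      using q basisD(2)[OF s] by simp_all
    have w: "?w \<in> carrier (G (n - q))" using m by simp
    have sigma: "free.sigma (n - Suc q) (?unit (n - Suc q)) = free.g_act (n - q) ?w (?unit (n - q))"
      using sigma_single_unit[OF basisD(1)[OF s] m(2)] r m(3,4) by simp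
    have "free.chain_face n q i (summand_map n s (Suc q) (const.tensor (n - ?m) (Suc q) f r))
        = free.tensor n q ?g (free.sigma (n - Suc q) (?unit (n - Suc q)))"
      using m(1,2) s f r i basisD(1)[OF s] by (simp add: summand_map_tensor free.chain_face_tensor)
    also have "\<dots> = free.tensor n q (?g \<otimes>\<^bsub>G n\<^esub> pad 0 (n - q) q ?w) (?unit (n - q))"
      unfolding sigma using m s f r i w basisD(1)[OF s] by (intro free.tensor_mult_pad[symmetric]) simp_all
    also have "\<dots> = free.tensor n q (position n q s (f \<otimes>\<^bsub>G (n - ?m)\<^esub> face_elt (n - ?m) q i)) (?unit (n - q))"
      unfolding position_face_elt[OF s m(1) i f] ..
    also have "\<dots> = summand_map n s q (const.chain_face (n - ?m) q i (const.tensor (n - ?m) (Suc q) f r))"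
      using m(1) s f r i q by (simp add: summand_map_tensor const.chain_face_tensor)
    finally show "summand_map n s q (const.chain_face (n - ?m) q i (const.tensor (n - ?m) (Suc q) f r))
        = free.chain_face n q i (summand_map n s (Suc q) (const.tensor (n - ?m) (Suc q) f r))" ..
  qed
qed

sublocale summands: semisimplicial_sum "free.chain_group n" "free.chain_face n" "basis n"
    "\<lambda>s. const.chain_group (n - rk (fst s))" "\<lambda>s. const.chain_face (n - rk (fst s))" "summand_map n" for n
  by (intro semisimplicial_sum.intro semisimplicial_sum_axioms.intro free.complex.semisimplicial_group_axioms
      semisimplicial_summand_map)

lemma tensor_single_in_family_sums:
  assumes q: "q \<le> n" and g: "g \<in> carrier (G n)" and k: "k \<in> basis (n - q)" and r: "r \<in> carrier R"
  shows "free.tensor n q g (coefficients.single k r) \<in> summands.family_sums n q"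
proof -
  obtain j f where k_eq: "k = (j, mor (rk j) (n - q) f)" and j: "j \<in> J" "rk j \<le> n - q" and f: "f \<in> carrier (G (n - q))"
    using k by (auto simp: basis_def UHom_iff)
  let ?m = "rk j"
  define x where "x = g \<otimes>\<^bsub>G n\<^esub> pad 0 (n - q) q f"
  have m: "?m + q \<le> n" "?m \<le> n" using j(2) q by simp_all
  have x: "x \<in> carrier (G n)" using g f q by (simp add: x_def)
  define s where "s = (j, mor ?m n (x \<otimes>\<^bsub>G n\<^esub> inv\<^bsub>G n\<^esub> (twist ?m n q)))"
  have s: "s \<in> basis n" using j(1) m x by (simp add: s_def)
  obtain h where h: "h \<in> carrier (G (n - ?m))"
    and rep: "crep (snd s) = x \<otimes>\<^bsub>G n\<^esub> inv\<^bsub>G n\<^esub> (twist ?m n q) \<otimes>\<^bsub>G n\<^esub> pad 0 (n - ?m) ?m h"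
    using crep_mor[OF m(2), of "x \<otimes>\<^bsub>G n\<^esub> inv\<^bsub>G n\<^esub> (twist ?m n q)"] x m by (auto simp: s_def)
  let ?h = "inv\<^bsub>G (n - ?m)\<^esub> h"
  have "pad 0 (n - ?m) ?m h \<otimes>\<^bsub>G n\<^esub> pad 0 (n - ?m) ?m ?h = e n"
    using h m by (simp add: pad_mult pad_one)
  then have position: "position n q s ?h = x"
    using x h m rep by (simp add: position_def s_def m_assoc)
  have "free.tensor n q g (coefficients.single k r)
      = free.tensor n q g (free.g_act (n - q) f (coefficients.single (unit (n - q) j) r))"
    using j f r by (simp add: g_act_single_unit k_eq)
  also have "\<dots> = free.tensor n q x (coefficients.single (unit (n - q) j) r)"
    unfolding x_def using q g f j r by (intro free.tensor_mult_pad[symmetric]) simp_all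
  also have "\<dots> = summand_map n s q (const.tensor (n - ?m) q ?h r)"
    using summand_map_tensor[OF s, of q ?h r] m h r by (simp add: position) (simp add: s_def)
  also have "\<dots> \<in> summands.family_sums n q"
    using s summands.family_sums_summand[OF s, of "const.tensor (n - ?m) q ?h r" q] m h r by (simp add: s_def)
  finally show ?thesis .
qed

lemma chain_group_subset_family_sums: "carrier (free.chain_group n q) \<subseteq> summands.family_sums n q"
proof
  fix c assume "c \<in> carrier (free.chain_group n q)"
  then show "c \<in> summands.family_sums n q"
  proof (induction rule: free.chain_induct)
    case zero
    show ?case by (rule summands.family_sums_zero)
  next
    case (add g y c)
    interpret T: abelian_group_hom "F (n - q)" "free.chain_group n q" "free.tensor n q g"
      by (rule free.tensor_hom[OF add(1,2)])
    have "free.tensor n q g y \<in> summands.family_sums n q"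
      using add(3)
    proof (induction rule: F_induct)
      case zero
      show ?case using T.hom_zero summands.family_sums_zero by (simp only:)
    next
      case (add k r y)
      then show ?case
        using T.hom_add[of "coefficients.single k r" y]
          tensor_single_in_family_sums[OF \<open>q \<le> n\<close> \<open>g \<in> carrier (G n)\<close> add(1,2)]
          summands.family_sums_add[OF _ add(4)] by (simp del: free.chain_group_simps)
    qed
    then show ?case using add(5) by (rule summands.family_sums_add)
  qed
qed

abbreviation coefficient_at :: "nat \<Rightarrow> nat \<Rightarrow> 'j \<times> 'g set \<Rightarrow> 'g \<Rightarrow> ('g \<Rightarrow> 'j \<times> 'g set \<Rightarrow> 'r) \<Rightarrow> 'r" where
  "coefficient_at n q s f c \<equiv> c (position n q s f) (unit (n - q) (fst s))"

lemma coefficient_at_hom: "abelian_group_hom (free.chain_group n q) R (coefficient_at n q s f)"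
  by (rule abelian_group_hom_compose[OF free.chain_value_hom
    coefficients.finsupp_value_hom[of "basis (n - q)", folded F_eq]])

lemma position_eq_mult_pad_imp_iff:
  assumes s: "s \<in> basis n" "s' \<in> basis n" and q: "rk (fst s) + q \<le> n"
    and f: "f \<in> carrier (G (n - rk (fst s)))" "f' \<in> carrier (G (n - rk (fst s')))" and h: "h \<in> carrier (G (n - q))"
    and eq: "position n q s' f' = position n q s f \<otimes>\<^bsub>G n\<^esub> pad 0 (n - q) q h"
  shows "fst s' = fst s \<and> mor (rk (fst s)) (n - q) h = mor (rk (fst s)) (n - q) (e (n - q))
    \<longleftrightarrow> s' = s \<and> (\<exists>k\<in>carrier (G (n - rk (fst s) - q)). f' = f \<otimes>\<^bsub>G (n - rk (fst s))\<^esub> pad 0 (n - rk (fst s) - q) q k)"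
    (is "?unit \<longleftrightarrow> ?coset")
proof -
  let ?m = "rk (fst s)"
  let ?p = "\<lambda>k. pad 0 (n - ?m - q) ?m k" and ?f = "\<lambda>k. f \<otimes>\<^bsub>G (n - ?m)\<^esub> pad 0 (n - ?m - q) q k"
  have m: "?m \<le> n - q" "q \<le> n" "n - q - ?m = n - ?m - q" using q by simp_all
  note translate = position_mult_pad[OF s(1) q f(1)]
  show ?thesis
  proof
    assume unit: ?unit
    then obtain k where k: "k \<in> carrier (G (n - ?m - q))" "h = ?p k"
      using mor_eq_iff[OF m(1) h, of "e (n - q)"] m(1,3) by auto
    then have "position n q s' f' = position n q s (?f k)" using eq translate by simp
    then have "s' = s" "f' = ?f k"
      using position_eq_imp_eq[OF s _ q, of "?f k" f'] unit f k(1) m by simp_all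
    then show ?coset using k(1) by blast
  next
    assume ?coset
    then obtain k where k: "k \<in> carrier (G (n - ?m - q))" "s' = s" "f' = ?f k" by blast
    have pk: "?p k \<in> carrier (G (n - q))" using k(1) m by simp
    have "position n q s f \<otimes>\<^bsub>G n\<^esub> pad 0 (n - q) q h = position n q s f \<otimes>\<^bsub>G n\<^esub> pad 0 (n - q) q (?p k)"
      using eq translate k by simp
    then have "pad 0 (n - q) q h = pad 0 (n - q) q (?p k)"
      using monoid.Units_l_cancel[OF monoid_G, of "position n q s f" n] position_closed[OF s(1) q f(1)] h pk m
      by (simp add: group.Units_eq)
    then have "h = ?p k" using inj_onD[OF pad_inj] h pk by blast
    then show ?unit using k mor_absorb[OF m(1), of "e (n - q)" k] m pk by simp
  qed
qed

lemma coefficient_at_tensor: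
  assumes s: "s \<in> basis n" "s' \<in> basis n" and q: "rk (fst s) + q \<le> n" "rk (fst s') + q \<le> n"
    and f: "f \<in> carrier (G (n - rk (fst s)))" "f' \<in> carrier (G (n - rk (fst s')))" and r: "r \<in> carrier R"
  shows "coefficient_at n q s f (free.tensor n q (position n q s' f') (coefficients.single (unit (n - q) (fst s')) r))
    = (if s' = s then const.tensor (n - rk (fst s)) q f' r f else \<zero>\<^bsub>R\<^esub>)"
proof -
  let ?m = "rk (fst s)"
  let ?t = "free.tensor n q (position n q s' f') (coefficients.single (unit (n - q) (fst s')) r)"
  let ?coset = "s' = s \<and> (\<exists>k\<in>carrier (G (n - ?m - q)). f' = f \<otimes>\<^bsub>G (n - ?m)\<^esub> pad 0 (n - ?m - q) q k)"
  have qn: "q \<le> n" "q \<le> n - ?m" using q(1) by simp_all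
  have "coefficient_at n q s f ?t = (if ?coset then r else \<zero>\<^bsub>R\<^esub>)"
  proof (cases "\<exists>h. h \<in> carrier (G (n - q)) \<and> position n q s' f' = position n q s f \<otimes>\<^bsub>G n\<^esub> pad 0 (n - q) q h")
    case True
    then obtain h where h: "h \<in> carrier (G (n - q))" "position n q s' f' = position n q s f \<otimes>\<^bsub>G n\<^esub> pad 0 (n - q) q h"
      by blast
    have "?t (position n q s f) = coefficients.single (fst s', mor (rk (fst s')) (n - q) h) r"
      unfolding h(2) using free.tensor_inside[OF qn(1) position_closed[OF s(1) q(1) f(1)] h(1)]
        q(2) basisD(1)[OF s(2)] h(1) r
      by (simp add: g_act_single_unit)
    then have "coefficient_at n q s f ?t
        = coefficients.single (fst s', mor (rk (fst s')) (n - q) h) r (unit (n - q) (fst s))"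
      by (rule fun_cong)
    also have "\<dots> = (if fst s' = fst s \<and> mor ?m (n - q) h = mor ?m (n - q) (e (n - q)) then r else \<zero>\<^bsub>R\<^esub>)"
      unfolding coefficients.single_def prod.inject by (cases "fst s' = fst s") (simp_all add: eq_commute)
    finally show ?thesis unfolding position_eq_mult_pad_imp_iff[OF s q(1) f h] .
  next
    case False
    moreover have "pad 0 (n - ?m - q) ?m k \<in> carrier (G (n - q))" if "k \<in> carrier (G (n - ?m - q))" for k
      using that q(1) by simp
    ultimately have "\<not> ?coset" using position_mult_pad[OF s(1) q(1) f(1)] by metis
    then show ?thesis using free.tensor_outside[OF qn(1) False] by (auto simp: F_eq)
  qed
  moreover have "const.tensor (n - ?m) q f' r f = (if ?coset then r else \<zero>\<^bsub>R\<^esub>)" if "s' = s"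
    using that const.tensor_inside[OF qn(2) f(1)] const.tensor_outside[OF qn(2), of f' f r] by auto
  ultimately show ?thesis by auto
qed

lemma coefficient_at_summand_map:
  assumes s: "s \<in> basis n" "s' \<in> basis n" and q: "rk (fst s) + q \<le> n" and f: "f \<in> carrier (G (n - rk (fst s)))"
    and c: "c \<in> carrier (const.chain_group (n - rk (fst s')) q)"
  shows "coefficient_at n q s f (summand_map n s' q c) = (if s' = s then c f else \<zero>\<^bsub>R\<^esub>)"
proof (rule const.chain_hom_eqI[where f = "\<lambda>c. coefficient_at n q s f (summand_map n s' q c)"
      and f' = "\<lambda>c. if s' = s then c f else \<zero>\<^bsub>R\<^esub>", OF _ _ _ c])
  show "abelian_group_hom (const.chain_group (n - rk (fst s')) q) R (\<lambda>c. coefficient_at n q s f (summand_map n s' q c))"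
    by (rule abelian_group_hom_compose[OF summand_map_hom[OF s(2)] coefficient_at_hom])
  show "abelian_group_hom (const.chain_group (n - rk (fst s')) q) R (\<lambda>c. if s' = s then c f else \<zero>\<^bsub>R\<^esub>)"
    using const.chain_value_closed
    by (intro abelian_group_homI_add) (auto simp: coefficients.abelian_group_axioms)
  fix f' r assume "q \<le> n - rk (fst s')" "f' \<in> carrier (G (n - rk (fst s')))" "r \<in> carrier (ring_mod R)"
  moreover from this have "rk (fst s') + q \<le> n" using basisD(2)[OF s(2)] by simp
  ultimately show "coefficient_at n q s f (summand_map n s' q (const.tensor (n - rk (fst s')) q f' r))
      = (if s' = s then const.tensor (n - rk (fst s')) q f' r f else \<zero>\<^bsub>R\<^esub>)"
    using s q f by (simp add: summand_map_tensor coefficient_at_tensor)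
qed

lemma summands_independent:
  assumes y: "y \<in> summands.families n q T" "summands.family_sum n q T y = \<zero>\<^bsub>free.chain_group n q\<^esub>" and s: "s \<in> T"
  shows "y s = \<zero>\<^bsub>const.chain_group (n - rk (fst s)) q\<^esub>"
proof -
  have T: "finite T" "\<And>s. s \<in> T \<Longrightarrow> s \<in> basis n \<and> y s \<in> carrier (const.chain_group (n - rk (fst s)) q)"
    using y(1) by (auto simp: summands.families_def)
  show ?thesis
  proof (cases "q \<le> n - rk (fst s)")
    case True
    then have q: "rk (fst s) + q \<le> n" using basisD(2)[of s n] T(2)[OF s] by simp
    have "y s f = \<zero>\<^bsub>R\<^esub>" for f
    proof (cases "f \<in> carrier (G (n - rk (fst s)))")
      case f: True
      interpret E: abelian_group_hom "free.chain_group n q" R "coefficient_at n q s f" by (rule coefficient_at_hom)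
      have value_closed: "y s' f \<in> carrier R" if "s' \<in> T" for s'
        using const.chain_value_closed T(2)[OF that] by auto
      have "coefficient_at n q s f (summands.family_sum n q T y)
          = (\<Oplus>\<^bsub>R\<^esub>s'\<in>T. coefficient_at n q s f (summand_map n s' q (y s')))"
        unfolding summands.family_sum_def using T summands.summand_closed by (intro E.hom_finsum) auto
      also have "\<dots> = (\<Oplus>\<^bsub>R\<^esub>s'\<in>T. if s = s' then y s' f else \<zero>\<^bsub>R\<^esub>)"
        using T s q f value_closed by (intro coefficients.finsum_cong') (auto simp: coefficient_at_summand_map)
      also have "\<dots> = y s f"
        using coefficients.finsum_singleton[OF s T(1), of "\<lambda>s'. y s' f"] value_closed by simp
      finally show ?thesis using E.hom_zero y(2) by simp
    next
      case False
      then show ?thesis using const.chain_outside_carrier T(2)[OF s] by fastforce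
    qed
    then show ?thesis by auto
  next
    case False
    then show ?thesis using const.chain_group_empty[OF False] T(2)[OF s] by simp
  qed
qed

theorem free_exact_at:
  assumes "\<And>j. \<lbrakk>j \<in> J; rk j \<le> n\<rbrakk> \<Longrightarrow> const.complex.exact_at (n - rk j) q"
  shows "free.complex.exact_at n q"
proof (rule summands.exact_at_sum[OF _ chain_group_subset_family_sums])
  show "y s = \<zero>\<^bsub>const.chain_group (n - rk (fst s)) p\<^esub>"
    if "y \<in> summands.families n p T" "summands.family_sum n p T y = \<zero>\<^bsub>free.chain_group n p\<^esub>" "s \<in> T" for p T y s
    using that by (rule summands_independent)
  show "const.complex.exact_at (n - rk (fst s)) q" if "s \<in> basis n" for s
    using assms basisD[OF that] by blast
qed

end

section \<open>Free covers and kernels\<close>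

lemma infinite_pairing:
  assumes "infinite (UNIV :: 'p set)"
  obtains pair :: "'p \<times> 'p \<Rightarrow> 'p" where "inj pair"
  using Times_same_infinite_bij_betw_types[OF assms] by (auto simp: bij_betw_def)

lemma (in coefficient_ring) finsupp_embedding:
  fixes f :: "'k \<Rightarrow> 'p" and f' :: "'r \<Rightarrow> 'p"
  assumes inf: "infinite (UNIV :: 'p set)" and inj: "inj_on f S" "inj f'"
  obtains enc :: "('k \<Rightarrow> 'r) \<Rightarrow> 'p" where "inj_on enc (carrier (finsupp R S))"
proof -
  obtain pair :: "'p \<times> 'p \<Rightarrow> 'p" where pair: "inj pair" by (rule infinite_pairing[OF inf])
  obtain fin :: "'p set \<Rightarrow> 'p" where fin: "inj_on fin (Fpow UNIV)"
    using Fpow_infinite_bij_betw[OF inf] by (auto simp: bij_betw_def)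
  have "carrier (finsupp R S) \<subseteq> {c. c ` S \<subseteq> carrier R \<and> {k. c k \<noteq> \<zero>} \<subseteq> S \<and> finite {k. c k \<noteq> \<zero>}}"
    unfolding finsupp_def by auto
  then have "lepoll (carrier (finsupp R S)) (Fpow (S \<times> carrier R))"
    by (rule lepoll_trans[OF subset_imp_lepoll lepoll_restricted_funspace])
  then obtain graph where graph: "inj_on graph (carrier (finsupp R S))"
      "graph ` carrier (finsupp R S) \<subseteq> Fpow (S \<times> carrier R)"
    by (auto simp: lepoll_def)
  let ?code = "\<lambda>(k, r). pair (f k, f' r)"
  have "inj_on ?code (S \<times> carrier R)"
    using inj by (auto simp: inj_on_def dest!: injD[OF pair])
  then have "inj_on (image ?code) (Fpow (S \<times> carrier R))" by (rule inj_on_image_Fpow)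
  moreover have "image ?code ` Fpow (S \<times> carrier R) \<subseteq> Fpow UNIV" by (auto simp: Fpow_def)
  ultimately have "inj_on (fin \<circ> image ?code) (Fpow (S \<times> carrier R))"
    by (rule comp_inj_on[OF _ inj_on_subset[OF fin]])
  then have "inj_on ((fin \<circ> image ?code) \<circ> graph) (carrier (finsupp R S))"
    by (rule comp_inj_on[OF graph(1) inj_on_subset[OF _ graph(2)]])
  then show thesis by (rule that)
qed

definition transport :: "('r, 'y) module \<Rightarrow> ('y \<Rightarrow> 'p) \<Rightarrow> ('p \<Rightarrow> 'y) \<Rightarrow> ('r, 'p) module" where
  "transport N enc dec = \<lparr>carrier = enc ` carrier N, monoid.mult = undefined, one = undefined, ring.zero = enc \<zero>\<^bsub>N\<^esub>,
     add = (\<lambda>x y. enc (dec x \<oplus>\<^bsub>N\<^esub> dec y)), smult = (\<lambda>r x. enc (r \<odot>\<^bsub>N\<^esub> dec x))\<rparr>"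

lemma transport_simps [simp]: "carrier (transport N enc dec) = enc ` carrier N" "\<zero>\<^bsub>transport N enc dec\<^esub> = enc \<zero>\<^bsub>N\<^esub>"
    "x \<oplus>\<^bsub>transport N enc dec\<^esub> y = enc (dec x \<oplus>\<^bsub>N\<^esub> dec y)" "r \<odot>\<^bsub>transport N enc dec\<^esub> x = enc (r \<odot>\<^bsub>N\<^esub> dec x)"
  by (simp_all add: transport_def)

lemma transport_module:
  assumes "module R N" and dec: "\<And>x. x \<in> carrier N \<Longrightarrow> dec (enc x) = x"
  shows "module R (transport N enc dec)"
proof -
  interpret module R N by (rule assms(1))
  show ?thesis
  proof (rule moduleI)
    show "abelian_group (transport N enc dec)"
    proof (rule abelian_groupI)
      fix x assume "x \<in> carrier (transport N enc dec)"
      then obtain y where y: "y \<in> carrier N" "x = enc y" by auto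
      then have "enc (\<ominus>\<^bsub>N\<^esub> y) \<in> carrier (transport N enc dec)"
          "enc (\<ominus>\<^bsub>N\<^esub> y) \<oplus>\<^bsub>transport N enc dec\<^esub> x = \<zero>\<^bsub>transport N enc dec\<^esub>"
        using dec M.l_neg by auto
      then show "\<exists>y\<in>carrier (transport N enc dec). y \<oplus>\<^bsub>transport N enc dec\<^esub> x = \<zero>\<^bsub>transport N enc dec\<^esub>" by blast
    qed (auto simp: dec M.a_ac)
  qed (auto simp: dec smult_l_distr smult_r_distr smult_assoc1 is_cring)
qed

context braided_ug_module
begin

context
  fixes enc :: "nat \<Rightarrow> 'x \<Rightarrow> 'p" and dec :: "nat \<Rightarrow> 'p \<Rightarrow> 'x"
  assumes dec: "\<And>n x. x \<in> carrier (M n) \<Longrightarrow> dec n (enc n x) = x"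
begin

lemma transport_ug_module:
  "ug_module G os R (\<lambda>n. transport (M n) (enc n) (dec n)) (\<lambda>s t \<phi> x. enc t (act s t \<phi> (dec s x)))"
  unfolding ug_module_def
  by (auto simp: linear_map_def dec act_add act_smult act_uid act_ucomp intro!: transport_module[OF module_M])

lemma transport_encode_hom:
  "ug_hom G os R M act (\<lambda>n. transport (M n) (enc n) (dec n)) (\<lambda>s t \<phi> x. enc t (act s t \<phi> (dec s x))) enc"
  by (auto simp: ug_hom_def linear_map_def dec)

lemma transport_decode_hom:
  "ug_hom G os R (\<lambda>n. transport (M n) (enc n) (dec n)) (\<lambda>s t \<phi> x. enc t (act s t \<phi> (dec s x))) M act dec"
  by (auto simp: ug_hom_def linear_map_def dec)

end

end

lemma ug_hom_comp:
  assumes "ug_hom G os R M act M' act' \<eta>" "ug_hom G os R M' act' M'' act'' \<eta>'"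
  shows "ug_hom G os R M act M'' act'' (\<lambda>n x. \<eta>' n (\<eta> n x))"
  using assms by (auto simp: ug_hom_def linear_map_def)

context free_ug_module
begin

lemma F_embedding:
  fixes f_r :: "'r \<Rightarrow> 'p" and f_g :: "'g \<Rightarrow> 'p" and f_j :: "'j \<Rightarrow> 'p"
  assumes inf: "infinite (UNIV :: 'p set)" and inj: "inj f_r" "inj f_g" "inj f_j"
  obtains enc :: "nat \<Rightarrow> ('j \<times> 'g set \<Rightarrow> 'r) \<Rightarrow> 'p" where "\<And>n. inj_on (enc n) (carrier (F n))"
proof -
  obtain pair :: "'p \<times> 'p \<Rightarrow> 'p" where pair: "inj pair" by (rule infinite_pairing[OF inf])
  have "inj_on (\<lambda>s. pair (f_j (fst s), f_g (crep (snd s)))) (basis n)" for n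
  proof (rule inj_onI)
    fix s t assume basis: "s \<in> basis n" "t \<in> basis n"
      and "pair (f_j (fst s), f_g (crep (snd s))) = pair (f_j (fst t), f_g (crep (snd t)))"
    then have "fst s = fst t" "crep (snd s) = crep (snd t)"
      using inj(2,3) by (auto dest!: injD[OF pair] dest: injD)
    then show "s = t" using basisD(4)[OF basis(1)] basisD(4)[OF basis(2)] by (metis prod_eqI)
  qed
  then have "\<exists>enc :: ('j \<times> 'g set \<Rightarrow> 'r) \<Rightarrow> 'p. inj_on enc (carrier (F n))" for n
    using coefficients.finsupp_embedding[OF inf _ inj(1)] unfolding F_eq by metis
  then show thesis using that by metis
qed

end

context free_ug_map
begin

lemma lift_surj:
  assumes low: "\<And>n x. \<lbrakk>int n \<le> d; x \<in> carrier (M n)\<rbrakk> \<Longrightarrow> \<exists>j\<in>J. rk j = n \<and> v j = x"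
    and high: "\<And>n. d < int n \<Longrightarrow> target.complex.exact_at n 0"
  shows "lift n ` carrier (F n) = carrier (M n)"
proof (induction n rule: less_induct)
  case (less n)
  have "x \<in> lift n ` carrier (F n)" if x: "x \<in> carrier (M n)" for x
  proof (cases "int n \<le> d")
    case True
    then obtain j where j: "j \<in> J" "rk j = n" "v j = x" using low x by blast
    have k: "(j, uid G os n) \<in> basis n" using j(1,2) uid_UHom by simp
    have "lift n (coefficients.single (j, uid G os n) \<one>\<^bsub>R\<^esub>) = x"
      using lift_single[OF k] j x by (simp add: image_def target.act_uid module.smult_one[OF target.module_M])
    then show ?thesis using k by (metis F_single_closed coefficients.one_closed imageI)
  next
    case False
    have "target.tensor n 0 (e n) x \<in> target.complex.cycles n 0"
      using x by (simp add: target.complex.cycles_def)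
    then obtain c where c: "c \<in> carrier (target.chain_group n (Suc 0))"
        "target.complex.boundary n 0 c = target.tensor n 0 (e n) x"
      using target.complex.exact_atE[OF high] False by (metis not_le)
    have "c \<in> lift.chain_map n (Suc 0) ` carrier (free.chain_group n (Suc 0))"
      using lift.chain_map_surj[OF less.IH, of "Suc 0" n] c(1) by simp
    then obtain c' where c': "c = lift.chain_map n (Suc 0) c'" "c' \<in> carrier (free.chain_group n (Suc 0))"
      by (rule imageE)
    let ?y = "free.complex.boundary n 0 c' (e n)"
    have "target.tensor n 0 (e n) x = lift.chain_map n 0 (free.complex.boundary n 0 c')"
      using semisimplicial_hom.hom_boundary[OF lift.semisimplicial_chain_map c'(2)] c(2) c'(1) by simp
    then have "x = lift n ?y"
      using target.tensor_degree_0(2)[of "e n" n x] x by (simp add: target.g_act_one)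
    moreover have "?y \<in> carrier (F n)"
      using free.chain_value_closed[OF free.complex.boundary_closed[OF c'(2)]] by simp
    ultimately show ?thesis by (rule image_eqI)
  qed
  then show ?case using abelian_group_hom.hom_closed[OF lift_hom] by blast
qed

end

context braided_ug_module
begin

lemma coded_elements:
  fixes f_x :: "'x \<Rightarrow> 'p"
  assumes inf: "infinite (UNIV :: 'p set)" and inj: "inj f_x"
  obtains J :: "'p set" and rk v where "\<forall>j\<in>J. int (rk j) \<le> d \<and> v j \<in> carrier (M (rk j))"
    "\<forall>n x. int n \<le> d \<and> x \<in> carrier (M n) \<longrightarrow> (\<exists>j\<in>J. rk j = n \<and> v j = x)"
proof -
  obtain pair :: "'p \<times> 'p \<Rightarrow> 'p" where pair: "inj pair" by (rule infinite_pairing[OF inf])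
  obtain f_n :: "nat \<Rightarrow> 'p" where f_n: "inj f_n" using inf infinite_countable_subset by blast
  define code where "code = (\<lambda>(k, x). pair (f_n k, f_x x))"
  have "inj code"
    by (rule injI) (auto simp: code_def dest!: injD[OF pair] injD[OF f_n] injD[OF inj])
  then have decode: "the_inv code (code t) = t" for t by (rule the_inv_f_f)
  let ?J = "code ` {(k, x). int k \<le> d \<and> x \<in> carrier (M k)}"
  have "\<forall>j\<in>?J. int (fst (the_inv code j)) \<le> d \<and> snd (the_inv code j) \<in> carrier (M (fst (the_inv code j)))"
    by (auto simp: decode)
  moreover have "\<exists>j\<in>?J. fst (the_inv code j) = n \<and> snd (the_inv code j) = x" if "int n \<le> d" "x \<in> carrier (M n)" for n x
    using that by (intro bexI[of _ "code (n, x)"]) (auto simp: decode)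
  ultimately show thesis using that[of ?J "\<lambda>j. fst (the_inv code j)" "\<lambda>j. snd (the_inv code j)"] by blast
qed

lemma free_cover:
  fixes f_r :: "'r \<Rightarrow> 'p" and f_g :: "'g \<Rightarrow> 'p" and f_x :: "'x \<Rightarrow> 'p"
  assumes inf: "infinite (UNIV :: 'p set)" and inj: "inj f_r" "inj f_g" "inj f_x"
    and exact: "\<And>n. d < int n \<Longrightarrow> complex.exact_at n 0"
  obtains P :: "nat \<Rightarrow> ('r, 'p) module" and Pact \<epsilon> where "ug_module G os R P Pact" "free_gen_le G os R P Pact d"
    "ug_hom G os R P Pact M act \<epsilon>" "\<And>n. \<epsilon> n ` carrier (P n) = carrier (M n)"
proof -
  obtain J :: "'p set" and rk v where J: "\<forall>j\<in>J. int (rk j) \<le> d \<and> v j \<in> carrier (M (rk j))"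
    and low: "\<forall>n x. int n \<le> d \<and> x \<in> carrier (M n) \<longrightarrow> (\<exists>j\<in>J. rk j = n \<and> v j = x)"
    by (rule coded_elements[OF inf inj(3), of d])
  interpret U: free_ug_map G os b R J rk M act v
    using J by (intro free_ug_map.intro free_ug_module.intro free_ug_map_axioms.intro braided_stability_groupoid_axioms
        coefficients.coefficient_ring_axioms braided_ug_module_axioms) simp
  have surj: "U.lift n ` carrier (U.F n) = carrier (M n)" for n
    using low exact by (intro U.lift_surj) auto
  obtain enc where enc: "\<And>n. inj_on (enc n :: ('p \<times> 'g set \<Rightarrow> 'r) \<Rightarrow> 'p) (carrier (U.F n))"
    using U.F_embedding[OF inf inj(1,2) inj_on_id] by metis
  define dec where "dec n = inv_into (carrier (U.F n)) (enc n)" for n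
  have dec: "dec n (enc n c) = c" if "c \<in> carrier (U.F n)" for n c
    using that inv_into_f_f[OF enc] by (simp add: dec_def)
  let ?P = "\<lambda>n. transport (U.F n) (enc n) (dec n)" and ?A = "\<lambda>s t \<phi> x. enc t (U.F_act s t \<phi> (dec s x))"
  have "ug_module G os R ?P ?A" by (rule U.free.transport_ug_module[OF dec])
  moreover have "free_gen_le G os R ?P ?A d"
    unfolding free_gen_le_def
  proof (intro exI conjI allI ballI)
    show "int (rk j) \<le> d" if "j \<in> J" for j using J that by blast
    show "ug_hom G os R U.F U.F_act ?P ?A enc" by (rule U.free.transport_encode_hom[OF dec])
    show "bij_betw (enc n) (carrier (U.F n)) (carrier (?P n))" for n using enc by (simp add: bij_betw_def)
  qed
  moreover have "ug_hom G os R ?P ?A M act (\<lambda>n x. U.lift n (dec n x))"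
    by (rule ug_hom_comp[OF U.free.transport_decode_hom[OF dec] U.lift_ug_hom])
  moreover have "(\<lambda>x. U.lift n (dec n x)) ` carrier (?P n) = carrier (M n)" for n
    using surj[of n] dec by (auto simp: image_image)
  ultimately show thesis by (rule that)
qed

end

context braided_ug_hom
begin

definition ker_mod :: "nat \<Rightarrow> ('r, 'x) module" where
  "ker_mod n = (M n)\<lparr>carrier := {x \<in> carrier (M n). \<eta> n x = \<zero>\<^bsub>M' n\<^esub>}\<rparr>"

lemma ker_mod_simps [simp]: "carrier (ker_mod n) = {x \<in> carrier (M n). \<eta> n x = \<zero>\<^bsub>M' n\<^esub>}"
    "\<zero>\<^bsub>ker_mod n\<^esub> = \<zero>\<^bsub>M n\<^esub>" "x \<oplus>\<^bsub>ker_mod n\<^esub> y = x \<oplus>\<^bsub>M n\<^esub> y" "r \<odot>\<^bsub>ker_mod n\<^esub> x = r \<odot>\<^bsub>M n\<^esub> x"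
  by (simp_all add: ker_mod_def)

lemma module_ker_mod: "module R (ker_mod n)"
proof -
  interpret X: module R "M n" by (rule A.module_M)
  interpret Y: module R "M' n" by (rule B.module_M)
  show ?thesis
  proof (rule moduleI)
    show "abelian_group (ker_mod n)"
    proof (rule abelian_groupI)
      fix x assume "x \<in> carrier (ker_mod n)"
      then have "\<ominus>\<^bsub>M n\<^esub> x \<in> carrier (ker_mod n)" "\<ominus>\<^bsub>M n\<^esub> x \<oplus>\<^bsub>ker_mod n\<^esub> x = \<zero>\<^bsub>ker_mod n\<^esub>"
        using hom_a_inv[of x n] Y.M.minus_equality[of "\<zero>\<^bsub>M' n\<^esub>" "\<zero>\<^bsub>M' n\<^esub>"] X.M.l_neg by auto
      then show "\<exists>y\<in>carrier (ker_mod n). y \<oplus>\<^bsub>ker_mod n\<^esub> x = \<zero>\<^bsub>ker_mod n\<^esub>" by blast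
    qed (auto simp: hom_add hom_zero X.M.a_ac)
  qed (auto simp: hom_smult X.smult_l_distr X.smult_r_distr X.smult_assoc1)
qed

lemma ker_mod_ug_module: "ug_module G os R ker_mod act"
  unfolding ug_module_def
  by (auto simp: module_ker_mod linear_map_def A.act_add A.act_smult A.act_uid A.act_ucomp hom_act B.act_zero)

lemma ker_mod_inclusion: "ug_hom G os R ker_mod act M act (\<lambda>n x. x)"
  by (auto simp: ug_hom_def linear_map_def)

lemma ker_mod_ses:
  assumes "\<And>n. \<eta> n ` carrier (M n) = carrier (M' n)"
  shows "braided_ug_ses G os b R ker_mod act M act M' act' (\<lambda>n x. x) \<eta>"
  by (intro braided_ug_ses.intro braided_ug_ses_axioms.intro braided_ug_hom.intro braided_ug_module.intro
      braided_ug_module_axioms.intro braided_ug_hom_axioms.intro A.braided_stability_groupoid_axioms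
      ker_mod_ug_module ker_mod_inclusion A.ug_module B.ug_module ug_hom) (auto simp: assms)

end

section \<open>Resolutions and vanishing ranges\<close>

locale braided_coefficients = braided_stability_groupoid G os b for G :: "nat \<Rightarrow> 'g monoid" and os b +
  fixes R :: "'r ring"
  assumes cring: "cring R"
begin

lemma braided_ug_moduleI: "ug_module G os R M act \<Longrightarrow> braided_ug_module G os b R M act"
  by (intro braided_ug_module.intro braided_ug_module_axioms.intro braided_stability_groupoid_axioms)

lemma braided_ug_homI:
  "\<lbrakk>ug_module G os R M act; ug_module G os R M' act'; ug_hom G os R M act M' act' \<eta>\<rbrakk>
    \<Longrightarrow> braided_ug_hom G os b R M act M' act' \<eta>"
  by (intro braided_ug_hom.intro braided_ug_hom_axioms.intro braided_ug_moduleI)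

abbreviation cs_exact_at :: "(nat \<Rightarrow> ('r, 'x) module) \<Rightarrow> (nat \<Rightarrow> nat \<Rightarrow> 'g set \<Rightarrow> 'x \<Rightarrow> 'x) \<Rightarrow> nat \<Rightarrow> nat \<Rightarrow> bool" where
  "cs_exact_at M act n \<equiv> semisimplicial_group.exact_at
     (braided_ug_module.chain_group G os M act n) (braided_ug_module.chain_face G os b M act n)"

definition vanishes_above :: "nat \<Rightarrow> (nat \<Rightarrow> int) \<Rightarrow> (nat \<Rightarrow> ('r, 'x) module) \<Rightarrow> (nat \<Rightarrow> nat \<Rightarrow> 'g set \<Rightarrow> 'x \<Rightarrow> 'x) \<Rightarrow> bool" where
  "vanishes_above N d M act \<longleftrightarrow> (\<forall>q n. q \<le> N \<and> d q < int n \<longrightarrow> cs_exact_at M act n q)"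

lemma vanishes_above_Suc: "vanishes_above (Suc N) d M act \<Longrightarrow> vanishes_above N d M act"
  by (simp add: vanishes_above_def)

lemma cs_homology_vanishes_above_iff:
  assumes "ug_module G os R M act"
  shows "(\<forall>i n. -1 \<le> i \<and> i < int N \<and> d (nat (i + 1)) < int n \<longrightarrow> cs_homology_vanishes G os b R M act i n)
    \<longleftrightarrow> vanishes_above N d M act"
proof -
  interpret braided_ug_module G os b R M act by (rule braided_ug_moduleI[OF assms])
  show ?thesis unfolding vanishes_above_def cs_homology_vanishes_iff[symmetric]
  proof (intro iffI allI impI)
    fix q n assume "\<forall>i n. -1 \<le> i \<and> i < int N \<and> d (nat (i + 1)) < int n \<longrightarrow> cs_homology_vanishes G os b R M act i n"
      and "q \<le> N \<and> d q < int n"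
    then show "cs_homology_vanishes G os b R M act (int q - 1) n" by simp
  next
    fix i n assume vanishes: "\<forall>q n. q \<le> N \<and> d q < int n \<longrightarrow> cs_homology_vanishes G os b R M act (int q - 1) n"
      and i: "- 1 \<le> i \<and> i < int N \<and> d (nat (i + 1)) < int n"
    have "int (nat (i + 1)) - 1 = i" "nat (i + 1) \<le> N" using i by auto
    then show "cs_homology_vanishes G os b R M act i n" using vanishes[rule_format, of "nat (i + 1)" n] i by simp
  qed
qed

lemma free_exact_at_if_const:
  fixes P :: "nat \<Rightarrow> ('r, 'x) module"
  assumes P: "ug_module G os R P Pact" "free_gen_le G os R P Pact d"
    and const: "vanishes_above N (\<lambda>q. int k * (int q - 1) + int a) (\<lambda>n. ring_mod R) const_act"
    and q: "q \<le> N" "d < int n" "0 < q \<Longrightarrow> int k * (int q - 1) + int a + d < int n"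
  shows "cs_exact_at P Pact n q"
proof -
  obtain J :: "'x set" and rk \<eta> where J: "\<forall>j\<in>J. int (rk j) \<le> d"
    and \<eta>: "ug_hom G os R (free_mod G os R J rk) (free_act G os R rk) P Pact \<eta>"
      "\<forall>n. bij_betw (\<eta> n) (carrier (free_mod G os R J rk n)) (carrier (P n))"
    using P(2) unfolding free_gen_le_def by blast
  interpret U: free_ug_module G os b R J rk
    by (intro free_ug_module.intro coefficient_ring.intro braided_stability_groupoid_axioms cring)
  interpret E: braided_ug_hom G os b R U.F U.F_act P Pact \<eta>
    by (intro braided_ug_homI U.free_ug_module P \<eta>)
  have "U.free.complex.exact_at n q"
  proof (rule U.free_exact_at)
    fix j assume j: "j \<in> J" "rk j \<le> n"
    have rk: "int (rk j) \<le> d" using J j by blast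
    show "U.const.complex.exact_at (n - rk j) q"
    proof (cases q)
      case 0
      have "0 < n - rk j" using rk q(2) by simp
      then show ?thesis using U.const_exact_at_0 0 by simp
    next
      case (Suc p)
      then have "int k * (int q - 1) + int a < int (n - rk j)" using q(3) rk j(2) by (simp add: of_nat_diff)
      then show ?thesis using const q(1) unfolding vanishes_above_def by blast
    qed
  qed
  then show ?thesis using E.exact_at_bij \<eta>(2) by blast
qed

lemma linear_lower_bound:
  assumes "\<forall>i<N. d (Suc i) - d i \<ge> c" "q \<le> N"
  shows "d 0 + int q * c \<le> d q"
  using assms(2)
proof (induction q)
  case (Suc q)
  then show ?case using assms(1)[rule_format, of q] by (simp add: algebra_simps)
qed simp

lemma free_vanishes_above:
  assumes P: "ug_module G os R P Pact" "free_gen_le G os R P Pact (d 0)"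
    and const: "vanishes_above N (\<lambda>q. int k * (int q - 1) + int a) (\<lambda>n. ring_mod R) const_act"
    and growth: "\<forall>i<N. d (Suc i) - d i \<ge> int (max k a)"
  shows "vanishes_above N d P Pact"
  unfolding vanishes_above_def
proof (intro allI impI)
  fix q n assume q: "q \<le> N \<and> d q < int n"
  then have bound: "d 0 + int q * int (max k a) < int n" using linear_lower_bound[OF growth, of q] by simp
  show "cs_exact_at P Pact n q"
  proof (rule free_exact_at_if_const[OF P const])
    have "0 \<le> int q * int (max k a)" by simp
    then show "d 0 < int n" using bound by linarith
    assume "0 < q"
    then obtain p where p: "q = Suc p" by (cases q) auto
    have "int k * int p \<le> int (max k a) * int p" by (intro mult_right_mono) auto
    then have "int k * (int q - 1) + int a \<le> int q * int (max k a)" by (simp add: p algebra_simps)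
    then show "int k * (int q - 1) + int a + d 0 < int n" using bound by linarith
  qed (use q in simp)
qed

lemma vanishes_above_Suc_iff_kernel:
  assumes V: "ug_module G os R V Vact" and P: "ug_module G os R P Pact" "vanishes_above (Suc N) d P Pact"
    and \<epsilon>: "ug_hom G os R P Pact V Vact \<epsilon>" "\<And>n. \<epsilon> n ` carrier (P n) = carrier (V n)"
    and mono: "\<And>q. q \<le> N \<Longrightarrow> d q \<le> d (Suc q)"
  shows "vanishes_above (Suc N) d V Vact \<longleftrightarrow> vanishes_above N (\<lambda>i. d (Suc i)) (braided_ug_hom.ker_mod P V \<epsilon>) Pact"
proof -
  interpret E: braided_ug_hom G os b R P Pact V Vact \<epsilon> by (intro braided_ug_homI P V \<epsilon>)
  interpret S: braided_ug_ses G os b R E.ker_mod Pact P Pact V Vact "\<lambda>n x. x" \<epsilon> by (rule E.ker_mod_ses[OF \<epsilon>(2)])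
  have P_exact: "E.A.complex.exact_at n q" if "q \<le> Suc N" "d q < int n" for n q
    using P(2) that unfolding vanishes_above_def by blast
  show ?thesis
  proof
    assume V: "vanishes_above (Suc N) d V Vact"
    have "S.I.A.complex.exact_at n q" if q: "q \<le> N" "d (Suc q) < int n" for q n
    proof (rule S.complex.exact_at_sub)
      show "E.A.complex.exact_at n q" using P_exact mono[of q] q by simp
      show "E.B.complex.exact_at n (Suc q)" using V q unfolding vanishes_above_def by blast
    qed
    then show "vanishes_above N (\<lambda>i. d (Suc i)) E.ker_mod Pact" by (simp add: vanishes_above_def)
  next
    assume K: "vanishes_above N (\<lambda>i. d (Suc i)) E.ker_mod Pact"
    have "E.B.complex.exact_at n q" if q: "q \<le> Suc N" "d q < int n" for q n
    proof (cases q)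
      case 0
      then show ?thesis using E.exact_at_0_surj[OF \<epsilon>(2)] P_exact q by blast
    next
      case (Suc p)
      then have "S.I.A.complex.exact_at n p" using K q unfolding vanishes_above_def by blast
      then show ?thesis unfolding Suc using P_exact q Suc by (intro S.complex.exact_at_quotient) simp_all
    qed
    then show "vanishes_above (Suc N) d V Vact" by (simp add: vanishes_above_def)
  qed
qed

lemma free_resolution_tail:
  assumes V: "ug_module G os R V Vact" and res: "free_resolution G os R (Suc N) d V Vact P Pact \<delta> \<epsilon>"
  shows "free_resolution G os R N (\<lambda>i. d (Suc i)) (braided_ug_hom.ker_mod (P 0) V \<epsilon>) (Pact 0)
    (\<lambda>i. P (Suc i)) (\<lambda>i. Pact (Suc i)) (\<lambda>i. \<delta> (Suc i)) (\<delta> 0)"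
proof -
  have P: "ug_module G os R (P i) (Pact i)" "free_gen_le G os R (P i) (Pact i) (d i)" if "i \<le> Suc N" for i
    using res that by (simp_all add: free_resolution_def)
  have \<delta>: "ug_hom G os R (P (Suc i)) (Pact (Suc i)) (P i) (Pact i) (\<delta> i)" if "i < Suc N" for i
    using res that by (simp add: free_resolution_def)
  have \<epsilon>: "ug_hom G os R (P 0) (Pact 0) V Vact \<epsilon>" using res by (simp add: free_resolution_def)
  have exact_0: "\<delta> 0 n ` carrier (P 1 n) = {x \<in> carrier (P 0 n). \<epsilon> n x = \<zero>\<^bsub>V n\<^esub>}" for n
    using res by (simp add: free_resolution_def)
  have exact: "\<delta> i n ` carrier (P (Suc i) n) = {x \<in> carrier (P i n). \<delta> (i - 1) n x = \<zero>\<^bsub>P (i - 1) n\<^esub>}"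
    if "1 \<le> i" "i < Suc N" for i n using res that by (simp add: free_resolution_def)
  interpret E: braided_ug_hom G os b R "P 0" "Pact 0" V Vact \<epsilon>
    by (intro braided_ug_homI P V \<epsilon>) simp
  have "\<delta> 0 n x \<in> carrier (E.ker_mod n)" if "x \<in> carrier (P (Suc 0) n)" for n x
    using exact_0[of n] that by auto
  then have "ug_hom G os R (P (Suc 0)) (Pact (Suc 0)) E.ker_mod (Pact 0) (\<delta> 0)"
    using \<delta>[of 0] unfolding ug_hom_def linear_map_def by simp
  moreover have "\<delta> (Suc i) n ` carrier (P (Suc (Suc i)) n)
      = {x \<in> carrier (P (Suc i) n). \<delta> (Suc (i - 1)) n x = \<zero>\<^bsub>P (Suc (i - 1)) n\<^esub>}" if "1 \<le> i \<and> i < N" for i n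
    using exact[of "Suc i" n] that by simp
  moreover have "\<delta> (Suc 0) n ` carrier (P (Suc 1) n) = {x \<in> carrier (P (Suc 0) n). \<delta> 0 n x = \<zero>\<^bsub>E.ker_mod n\<^esub>}"
    if "1 \<le> N" for n
    using exact[of 1 n] that by simp
  moreover have "\<delta> 0 n ` carrier (P (Suc 0) n) = carrier (E.ker_mod n)" for n
    using exact_0 by simp
  ultimately show ?thesis unfolding free_resolution_def using P \<delta> by auto
qed

lemma free_resolution_Cons:
  assumes V: "ug_module G os R V Vact" and P\<^sub>0: "ug_module G os R P\<^sub>0 Pact\<^sub>0" "free_gen_le G os R P\<^sub>0 Pact\<^sub>0 (d 0)"
    and \<epsilon>: "ug_hom G os R P\<^sub>0 Pact\<^sub>0 V Vact \<epsilon>" "\<And>n. \<epsilon> n ` carrier (P\<^sub>0 n) = carrier (V n)"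
    and res: "free_resolution G os R N (\<lambda>i. d (Suc i)) (braided_ug_hom.ker_mod P\<^sub>0 V \<epsilon>) Pact\<^sub>0 P Pact \<delta> \<epsilon>'"
  shows "free_resolution G os R (Suc N) d V Vact (case_nat P\<^sub>0 P) (case_nat Pact\<^sub>0 Pact) (case_nat \<epsilon>' \<delta>) \<epsilon>"
proof -
  interpret E: braided_ug_hom G os b R P\<^sub>0 Pact\<^sub>0 V Vact \<epsilon> by (intro braided_ug_homI P\<^sub>0 V \<epsilon>)
  note res = res[unfolded free_resolution_def]
  have \<epsilon>': "ug_hom G os R (P 0) (Pact 0) P\<^sub>0 Pact\<^sub>0 \<epsilon>'"
    using ug_hom_comp[OF _ E.ker_mod_inclusion] res by fastforce
  show ?thesis unfolding free_resolution_def
  proof (intro conjI allI impI)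
    fix i assume "i \<le> Suc N"
    then show "ug_module G os R (case_nat P\<^sub>0 P i) (case_nat Pact\<^sub>0 Pact i)"
      and "free_gen_le G os R (case_nat P\<^sub>0 P i) (case_nat Pact\<^sub>0 Pact i) (d i)"
      using P\<^sub>0 res by (cases i; simp)+
  next
    fix i assume "i < Suc N"
    then show "ug_hom G os R (case_nat P\<^sub>0 P (Suc i)) (case_nat Pact\<^sub>0 Pact (Suc i))
        (case_nat P\<^sub>0 P i) (case_nat Pact\<^sub>0 Pact i) (case_nat \<epsilon>' \<delta> i)"
      using \<epsilon>' res by (cases i) simp_all
  next
    show "ug_hom G os R (case_nat P\<^sub>0 P 0) (case_nat Pact\<^sub>0 Pact 0) V Vact \<epsilon>" using \<epsilon> by simp
    show "\<epsilon> n ` carrier (case_nat P\<^sub>0 P 0 n) = carrier (V n)" for n using \<epsilon> by simp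
    show "case_nat \<epsilon>' \<delta> 0 n ` carrier (case_nat P\<^sub>0 P 1 n) = {x \<in> carrier (case_nat P\<^sub>0 P 0 n). \<epsilon> n x = \<zero>\<^bsub>V n\<^esub>}" for n
      using res by simp
  next
    fix i n assume i: "1 \<le> i \<and> i < Suc N"
    then show "case_nat \<epsilon>' \<delta> i n ` carrier (case_nat P\<^sub>0 P (Suc i) n)
      = {x \<in> carrier (case_nat P\<^sub>0 P i n). case_nat \<epsilon>' \<delta> (i - 1) n x = \<zero>\<^bsub>case_nat P\<^sub>0 P (i - 1) n\<^esub>}"
      using res by (cases i; cases "i - 1") auto
  qed
qed

definition has_free_resolution ::
  "'p itself \<Rightarrow> nat \<Rightarrow> (nat \<Rightarrow> int) \<Rightarrow> (nat \<Rightarrow> ('r, 'v) module) \<Rightarrow> (nat \<Rightarrow> nat \<Rightarrow> 'g set \<Rightarrow> 'v \<Rightarrow> 'v) \<Rightarrow> bool" where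
  "has_free_resolution _ N d V Vact \<longleftrightarrow>
     (\<exists>(P :: nat \<Rightarrow> nat \<Rightarrow> ('r, 'p) module) Pact \<delta> \<epsilon>. free_resolution G os R N d V Vact P Pact \<delta> \<epsilon>)"

end

text \<open>The type \<open>'p\<close> is large enough to carry free modules on the elements of any module over \<open>'p\<close>.\<close>

locale braided_resolutions = braided_coefficients G os b R for G :: "nat \<Rightarrow> 'g monoid" and os b and R :: "'r ring" +
  fixes k a :: nat and f_r :: "'r \<Rightarrow> 'p" and f_g :: "'g \<Rightarrow> 'p"
  assumes infinite_UNIV: "infinite (UNIV :: 'p set)" and inj: "inj f_r" "inj f_g"
begin

abbreviation const_vanishes :: "nat \<Rightarrow> bool" where
  "const_vanishes N \<equiv> vanishes_above N (\<lambda>q. int k * (int q - 1) + int a) (\<lambda>n. ring_mod R) const_act"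

lemma vanishes_above_if_resolution:
  assumes V: "ug_module G os R V Vact" and const: "const_vanishes N"
    and growth: "\<forall>i<N. d (Suc i) - d i \<ge> int (max k a)"
    and kernel: "\<And>N' (K :: nat \<Rightarrow> ('r, 'p) module) Kact.
      \<lbrakk>N = Suc N'; ug_module G os R K Kact; has_free_resolution TYPE('p) N' (\<lambda>i. d (Suc i)) K Kact\<rbrakk>
      \<Longrightarrow> vanishes_above N' (\<lambda>i. d (Suc i)) K Kact"
    and "has_free_resolution TYPE('p) N d V Vact"
  shows "vanishes_above N d V Vact"
proof -
  obtain P :: "nat \<Rightarrow> nat \<Rightarrow> ('r, 'p) module" and Pact \<delta> \<epsilon> where res: "free_resolution G os R N d V Vact P Pact \<delta> \<epsilon>"
    using assms(5) unfolding has_free_resolution_def by blast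
  then have P: "ug_module G os R (P 0) (Pact 0)" "free_gen_le G os R (P 0) (Pact 0) (d 0)"
    and \<epsilon>: "ug_hom G os R (P 0) (Pact 0) V Vact \<epsilon>" "\<And>n. \<epsilon> n ` carrier (P 0 n) = carrier (V n)"
    by (simp_all add: free_resolution_def)
  have P_vanishes: "vanishes_above N d (P 0) (Pact 0)" by (rule free_vanishes_above[where d = d, OF P const growth])
  interpret E: braided_ug_hom G os b R "P 0" "Pact 0" V Vact \<epsilon> by (intro braided_ug_homI P V \<epsilon>)
  show ?thesis
  proof (cases N)
    case 0
    then show ?thesis using P_vanishes E.exact_at_0_surj[OF \<epsilon>(2)] by (simp add: vanishes_above_def)
  next
    case (Suc N')
    have "has_free_resolution TYPE('p) N' (\<lambda>i. d (Suc i)) E.ker_mod (Pact 0)"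
      using free_resolution_tail[OF V res[unfolded Suc]] unfolding has_free_resolution_def by blast
    then have "vanishes_above N' (\<lambda>i. d (Suc i)) E.ker_mod (Pact 0)" by (rule kernel[OF Suc E.ker_mod_ug_module])
    moreover have "d q \<le> d (Suc q)" if "q \<le> N'" for q using growth[rule_format, of q] that Suc by simp
    ultimately show ?thesis
      using vanishes_above_Suc_iff_kernel[OF V P(1) P_vanishes[unfolded Suc] \<epsilon>] Suc by blast
  qed
qed

lemma resolution_if_vanishes_above:
  fixes f_v :: "'v \<Rightarrow> 'p" and V :: "nat \<Rightarrow> ('r, 'v) module"
  assumes V: "ug_module G os R V Vact" and f_v: "inj f_v" and const: "const_vanishes N"
    and growth: "\<forall>i<N. d (Suc i) - d i \<ge> int (max k a)"
    and kernel: "\<And>N' (K :: nat \<Rightarrow> ('r, 'p) module) Kact.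
      \<lbrakk>N = Suc N'; ug_module G os R K Kact; vanishes_above N' (\<lambda>i. d (Suc i)) K Kact\<rbrakk>
      \<Longrightarrow> has_free_resolution TYPE('p) N' (\<lambda>i. d (Suc i)) K Kact"
    and vanishes: "vanishes_above N d V Vact"
  shows "has_free_resolution TYPE('p) N d V Vact"
proof -
  interpret V: braided_ug_module G os b R V Vact by (rule braided_ug_moduleI[OF V])
  have "V.complex.exact_at n 0" if "d 0 < int n" for n using vanishes that unfolding vanishes_above_def by blast
  then obtain P :: "nat \<Rightarrow> ('r, 'p) module" and Pact \<epsilon>
    where P: "ug_module G os R P Pact" "free_gen_le G os R P Pact (d 0)"
      and \<epsilon>: "ug_hom G os R P Pact V Vact \<epsilon>" "\<And>n. \<epsilon> n ` carrier (P n) = carrier (V n)"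
    using V.free_cover[OF infinite_UNIV inj f_v, of "d 0"] by metis
  interpret E: braided_ug_hom G os b R P Pact V Vact \<epsilon> by (intro braided_ug_homI P V \<epsilon>)
  show ?thesis
  proof (cases N)
    case 0
    then have "free_resolution G os R N d V Vact (\<lambda>_. P) (\<lambda>_. Pact) (\<lambda>_ _ x. x) \<epsilon>"
      using P \<epsilon> by (simp add: free_resolution_def)
    then show ?thesis unfolding has_free_resolution_def by blast
  next
    case (Suc N')
    have "vanishes_above (Suc N') d P Pact"
      using free_vanishes_above[where d = d, OF P const growth] Suc by simp
    moreover have "d q \<le> d (Suc q)" if "q \<le> N'" for q using growth[rule_format, of q] that Suc by simp
    ultimately have "vanishes_above N' (\<lambda>i. d (Suc i)) E.ker_mod Pact"
      using vanishes_above_Suc_iff_kernel[OF V P(1) _ \<epsilon>] vanishes Suc by blast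
    then obtain P' :: "nat \<Rightarrow> nat \<Rightarrow> ('r, 'p) module" and Pact' \<delta> \<epsilon>'
      where "free_resolution G os R N' (\<lambda>i. d (Suc i)) E.ker_mod Pact P' Pact' \<delta> \<epsilon>'"
      using kernel[OF Suc E.ker_mod_ug_module] unfolding has_free_resolution_def by blast
    then show ?thesis
      unfolding Suc has_free_resolution_def using free_resolution_Cons[where d = d, OF V P \<epsilon>] by blast
  qed
qed

lemma has_free_resolution_iff_large_type:
  fixes V :: "nat \<Rightarrow> ('r, 'p) module"
  shows "\<lbrakk>ug_module G os R V Vact; const_vanishes N; \<forall>i<N. d (Suc i) - d i \<ge> int (max k a)\<rbrakk>
    \<Longrightarrow> has_free_resolution TYPE('p) N d V Vact \<longleftrightarrow> vanishes_above N d V Vact"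
proof (induction N arbitrary: d V Vact)
  case 0
  then show ?case
    using vanishes_above_if_resolution[OF 0] resolution_if_vanishes_above[OF 0(1) inj_on_id 0(2,3)] by blast
next
  case (Suc N)
  have kernel: "has_free_resolution TYPE('p) N (\<lambda>i. d (Suc i)) K Kact \<longleftrightarrow> vanishes_above N (\<lambda>i. d (Suc i)) K Kact"
    if "ug_module G os R K Kact" for K :: "nat \<Rightarrow> ('r, 'p) module" and Kact
    using Suc.IH[OF that vanishes_above_Suc[OF Suc.prems(2)]] Suc.prems(3) by simp
  show ?case
    using vanishes_above_if_resolution[OF Suc.prems]
      resolution_if_vanishes_above[OF Suc.prems(1) inj_on_id Suc.prems(2,3)]
      kernel by blast
qed

theorem has_free_resolution_iff_vanishes_above:
  fixes f_v :: "'v \<Rightarrow> 'p" and V :: "nat \<Rightarrow> ('r, 'v) module"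
  assumes V: "ug_module G os R V Vact" and f_v: "inj f_v" and const: "const_vanishes N"
    and growth: "\<forall>i<N. d (Suc i) - d i \<ge> int (max k a)"
  shows "has_free_resolution TYPE('p) N d V Vact \<longleftrightarrow> vanishes_above N d V Vact"
proof -
  have kernel: "has_free_resolution TYPE('p) N' (\<lambda>i. d (Suc i)) K Kact \<longleftrightarrow> vanishes_above N' (\<lambda>i. d (Suc i)) K Kact"
    if "N = Suc N'" "ug_module G os R K Kact" for N' and K :: "nat \<Rightarrow> ('r, 'p) module" and Kact
    using has_free_resolution_iff_large_type[OF that(2) vanishes_above_Suc[OF const[unfolded that(1)]]] growth that(1)
    by simp
  show ?thesis
    using vanishes_above_if_resolution[OF V const growth] resolution_if_vanishes_above[OF V f_v const growth] kernel
    by blast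
qed

end

theorem theorem5p7:
  fixes G :: "nat \<Rightarrow> 'g monoid" and os :: "nat \<Rightarrow> nat \<Rightarrow> 'g \<Rightarrow> 'g \<Rightarrow> 'g"
    and b :: "nat \<Rightarrow> nat \<Rightarrow> 'g"
    and R :: "'r ring"
    and N k a :: nat
    and V :: "nat \<Rightarrow> ('r, 'v) module" and Vact :: "nat \<Rightarrow> nat \<Rightarrow> 'g set \<Rightarrow> 'v \<Rightarrow> 'v"
    and d :: "nat \<Rightarrow> int"
  assumes "stability_groupoid G os"
    and "braiding G os b"
    and "cring R"
    and H3: "\<forall>i n. -1 \<le> i \<and> i < int N \<and> int n > int k * i + int a \<longrightarrow>
               cs_homology_vanishes G os b R (\<lambda>n. ring_mod R) const_act i n"
    and "ug_module G os R V Vact"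
    and "\<forall>i<N. d (Suc i) - d i \<ge> int (max k a)"
    and big: "\<exists>f :: 'r + 'g + 'v + nat \<Rightarrow> 'p. inj f"
  shows "(\<exists>(P :: nat \<Rightarrow> nat \<Rightarrow> ('r, 'p) module) Pact \<delta> \<epsilon>.
            free_resolution G os R N d V Vact P Pact \<delta> \<epsilon>)
         \<longleftrightarrow> (\<forall>i n. -1 \<le> i \<and> i < int N \<and> int n > d (nat (i + 1)) \<longrightarrow>
                 cs_homology_vanishes G os b R V Vact i n)"
proof -
  obtain f :: "'r + 'g + 'v + nat \<Rightarrow> 'p" where f: "inj f" using big by blast
  have inj_summands: "inj (f \<circ> Inl)" "inj (f \<circ> Inr \<circ> Inl)" "inj (f \<circ> Inr \<circ> Inr \<circ> Inl)" "inj (f \<circ> Inr \<circ> Inr \<circ> Inr)"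
    by (auto intro!: injI dest!: injD[OF f])
  have inf: "infinite (UNIV :: 'p set)"
    using inj_summands(4) infinite_UNIV_nat by (metis finite_imageD finite_subset subset_UNIV)
  interpret braided_resolutions G os b R k a "f \<circ> Inl" "f \<circ> Inr \<circ> Inl"
    by (intro braided_resolutions.intro braided_coefficients.intro braided_stability_groupoid.intro
        braided_coefficients_axioms.intro braided_resolutions_axioms.intro assms(1-3) inf inj_summands)
  have "const_vanishes N"
    unfolding cs_homology_vanishes_above_iff[OF const_ug_module[OF \<open>cring R\<close>], symmetric] using H3 by simp
  then have "has_free_resolution TYPE('p) N d V Vact \<longleftrightarrow> vanishes_above N d V Vact"
    using has_free_resolution_iff_vanishes_above[OF _ inj_summands(3)] assms(5,6) by blast
  then show ?thesis
    unfolding has_free_resolution_def cs_homology_vanishes_above_iff[OF \<open>ug_module G os R V Vact\<close>] .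
qed

end
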